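(* Let $k\in\{1,2,\dots,\infty\}$ and let $\Gamma$ be a (discrete) row-finite higher-rank graph ($k$-graph) with no source, determined by the bijections $T_{i,j}:\Gamma^{e_i}\times_c\Gamma^{e_j}\to\Gamma^{e_j}\times_c\Gamma^{e_i}$ ($i<j$). For each $i$ let $n_i:\Gamma^{e_i}\to\mathbb{Z}_+$ and $m_i:\Gamma^{e_i}\to\mathbb{Z}\setminus\{0\}$ be maps. Suppose that for all $i<j$ and all $(\lambda_1,\lambda_2)\in\Gamma^{e_i}\times_c\Gamma^{e_j}$, writing $T_{i,j}(\lambda_1,\lambda_2)=(\lambda_1^{ij},\lambda_2^{ij})\in\Gamma^{e_j}\times_c\Gamma^{e_i}$, the following hold: (i) $\gcd\bigl(|m_i(\lambda_1)m_j(\lambda_2)|,\,n_i(\lambda_1)n_j(\lambda_2)\bigr)=1$; (ii) $m_i(\lambda_1)m_j(\lambda_2)=m_j(\lambda_1^{ij})m_i(\lambda_2^{ij})$ and $n_i(\lambda_1)n_j(\lambda_2)=n_j(\lambda_1^{ij})n_i(\lambda_2^{ij})$. Then there exist homeomorphisms $$\widetilde T_{i,j}:(\Gamma^{e_i}\times_{n_i,m_i}\mathbb{T})\times_c(\Gamma^{e_j}\times_{n_j,m_j}\mathbb{T})\longrightarrow(\Gamma^{e_j}\times_{n_j,m_j}\mathbb{T})\times_c(\Gamma^{e_i}\times_{n_i,m_i}\mathbb{T})\qquad(i<j)$$ which induce a row-finite topological $k$-graph $\Lambda_{(\Gamma,m,n)}$ with no source; that is, there is a row-finite topological $k$-graph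 $\Lambda=\Lambda_{(\Gamma,m,n)}$ with no source such that $\Lambda^0=\Gamma^0\times\mathbb{T}$, $\Lambda^{e_i}=\Gamma^{e_i}\times_{n_i,m_i}\mathbb{T}$ for every $i$ (with its range and source maps), and $xy=x'y'$ in $\Lambda$ whenever $i<j$ and $\widetilde T_{i,j}(x,y)=(x',y')$.
   Context: Conventions. $\mathbb{N}=\{0,1,2,\dots\}$, $\mathbb{Z}_+=\mathbb{N}\setminus\{0\}$, $\mathbb{T}=\{z\in\mathbb{C}:|z|=1\}$. For $k\in\{1,2,\dots,\infty\}$, $\mathbb{N}^k$ is the direct sum of $k$ copies of $\mathbb{N}$ (finitely supported sequences if $k=\infty$), with standard generators $e_i$; indices $i,j$ are finite and range over $1,\dots,k$ (all positive integers if $k=\infty$). Locally compact spaces are Hausdorff. A topological $k$-graph is a small category $\Lambda$ with range and source maps $r,s$ and a functor $d:\Lambda\to\mathbb{N}^k$ such that: (1) the object space and the morphism space are locally compact; (2) $r,s$ are continuous and $s$ is a local homeomorphism; (3) composition $\Lambda\times_c\Lambda\to\Lambda$ is continuous and open, where $\Lambda\times_c\Lambda=\{(\lambda,\mu): s(\lambda)=r(\mu)\}$ has the relative product topology; (4) $d$ is continuous ($\mathbb{N}^k$ discrete); (5) if $d(\lambda)=m+n$ there is a unique $(\mu,\nu)\in\Lambda\times_c\Lambda$ with $\lambda=\mu\nu$, $d(\mu)=m$, $d(\nu)=n$. Put $\Lambda^m=d^{-1}(\{m\})$ (so $\Lambda^0$ is the object space), and let $r_m,s_m:\Lambda^m\to\Lambda^0$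 be the restrictions of $r,s$. $\Lambda$ is row-finite if for every $m\in\mathbb{N}^k$ each $v\in\Lambda^0$ has a neighborhood $V\subset\Lambda^0$ with $r_m^{-1}(V)$ compact; $\Lambda$ has no source if for every $m$, every $v\in\Lambda^0$ and every neighborhood $V\subset\Lambda^0$ of $v$, $r_m^{-1}(V)\ne\emptyset$. A (discrete) higher-rank graph ($k$-graph) is a topological $k$-graph whose object and morphism spaces are discrete. $U\times_cV=\{(\lambda,\mu)\in U\times V: s(\lambda)=r(\mu)\}$. A topological $k$-graph $\Lambda$ is determined by the $\Lambda^{e_i}$ (with range and source maps to $\Lambda^0$) and range- and source-preserving homeomorphisms $T_{i,j}:\Lambda^{e_i}\times_c\Lambda^{e_j}\to\Lambda^{e_j}\times_c\Lambda^{e_i}$ ($i<j$), where $T_{i,j}(\lambda,\mu)=(\mu',\lambda')$ means $\lambda\mu=\mu'\lambda'$ in $\Lambda$; these satisfy, for $i<j<l$, the hexagonal condition $(T_{j,l}\otimes1_i)(1_j\otimes T_{i,l})(T_{i,j}\otimes1_l)=(1_l\otimes T_{i,j})(T_{i,l}\otimes1_j)(1_i\otimes T_{j,l})$ on $\Lambda^{e_i}\times_c\Lambda^{e_j}\times_c\Lambda^{e_l}$, and conversely such data satisfying this condition induce a topological $k$-graph. $\Gamma^{e_i}\times_{n_i,m_i}\mathbb{T}$ denotes the space $\Gamma^{e_i}\times\mathbb{T}$ equipped with the source and range maps to $\Gamma^0\times\mathbb{T}$ given by $\widetilde s(\lambda,z)=(s(\lambda),z^{n_i(\lambda)})$ and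 $\widetilde r(\lambda,z)=(r(\lambda),z^{m_i(\lambda)})$; fibre products $\times_c$ of these spaces are formed with respect to $\widetilde s$ and $\widetilde r$. *)

theory Defs
  imports "HOL-Analysis.Analysis" "HOL-Library.Poly_Mapping"
begin

text \<open>
  The rank \<open>k \<in> {1, 2, \<dots>, \<infinity>}\<close> is an extended natural number. The monoid \<open>\<nat>\<^sup>k\<close> is the set of
  finitely supported functions on the positive integers whose support lies in \<open>{1, \<dots>, k}\<close>;
  index \<open>0\<close> is never used.
\<close>

definition indices :: "enat \<Rightarrow> nat set" where
  "indices k = {i. 1 \<le> i \<and> enat i \<le> k}"

definition degrees :: "enat \<Rightarrow> (nat \<Rightarrow>\<^sub>0 nat) set" where
  "degrees k = {p. Poly_Mapping.keys p \<subseteq> indices k}"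

abbreviation generator :: "nat \<Rightarrow> (nat \<Rightarrow>\<^sub>0 nat)" where
  "generator i \<equiv> Poly_Mapping.single i 1"

definition local_homeomorphism_map :: "'a topology \<Rightarrow> 'b topology \<Rightarrow> ('a \<Rightarrow> 'b) \<Rightarrow> bool" where
  "local_homeomorphism_map X Y f \<longleftrightarrow>
     (\<forall>x\<in>topspace X. \<exists>U. openin X U \<and> x \<in> U \<and> openin Y (f ` U) \<and>
        homeomorphic_map (subtopology X U) (subtopology Y (f ` U)) f)"

definition is_nbhd :: "'a topology \<Rightarrow> 'a \<Rightarrow> 'a set \<Rightarrow> bool" where
  "is_nbhd X v V \<longleftrightarrow> V \<subseteq> topspace X \<and> (\<exists>U. openin X U \<and> v \<in> U \<and> U \<subseteq> V)"

definition fibre_product ::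
    "'a topology \<Rightarrow> ('a \<Rightarrow> 'v) \<Rightarrow> 'b topology \<Rightarrow> ('b \<Rightarrow> 'v) \<Rightarrow> ('a \<times> 'b) topology" where
  "fibre_product X f Y g = subtopology (prod_topology X Y) {(x, y). f x = g y}"

text \<open>
  Objects and morphisms are the points of two topological spaces; \<open>cat_comp \<Lambda> x y\<close> is the composite
  \<open>xy\<close>, meaningful only if \<open>source \<Lambda> x = rng \<Lambda> y\<close>.
\<close>

record ('v, 'e) kgraph_data =
  Obj :: "'v topology"
  Mor :: "'e topology"
  rng :: "'e \<Rightarrow> 'v"
  source :: "'e \<Rightarrow> 'v"
  ident :: "'v \<Rightarrow> 'e"
  cat_comp :: "'e \<Rightarrow> 'e \<Rightarrow> 'e"
  deg :: "'e \<Rightarrow> (nat \<Rightarrow>\<^sub>0 nat)"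

definition composable :: "('v, 'e) kgraph_data \<Rightarrow> ('e \<times> 'e) topology" where
  "composable \<Lambda> = fibre_product (Mor \<Lambda>) (source \<Lambda>) (Mor \<Lambda>) (rng \<Lambda>)"

definition paths :: "('v, 'e) kgraph_data \<Rightarrow> (nat \<Rightarrow>\<^sub>0 nat) \<Rightarrow> 'e set" where
  "paths \<Lambda> p = {x \<in> topspace (Mor \<Lambda>). deg \<Lambda> x = p}"

definition path_space :: "('v, 'e) kgraph_data \<Rightarrow> (nat \<Rightarrow>\<^sub>0 nat) \<Rightarrow> 'e topology" where
  "path_space \<Lambda> p = subtopology (Mor \<Lambda>) (paths \<Lambda> p)"

locale small_category =
  fixes \<Lambda> :: "('v, 'e) kgraph_data"
  assumes rng_obj: "x \<in> topspace (Mor \<Lambda>) \<Longrightarrow> rng \<Lambda> x \<in> topspace (Obj \<Lambda>)"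
    and source_obj: "x \<in> topspace (Mor \<Lambda>) \<Longrightarrow> source \<Lambda> x \<in> topspace (Obj \<Lambda>)"
    and ident_mor: "v \<in> topspace (Obj \<Lambda>) \<Longrightarrow> ident \<Lambda> v \<in> topspace (Mor \<Lambda>)"
    and rng_ident: "v \<in> topspace (Obj \<Lambda>) \<Longrightarrow> rng \<Lambda> (ident \<Lambda> v) = v"
    and source_ident: "v \<in> topspace (Obj \<Lambda>) \<Longrightarrow> source \<Lambda> (ident \<Lambda> v) = v"
    and comp_mor: "(x, y) \<in> topspace (composable \<Lambda>) \<Longrightarrow> cat_comp \<Lambda> x y \<in> topspace (Mor \<Lambda>)"
    and rng_comp: "(x, y) \<in> topspace (composable \<Lambda>) \<Longrightarrow> rng \<Lambda> (cat_comp \<Lambda> x y) = rng \<Lambda> x"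
    and source_comp: "(x, y) \<in> topspace (composable \<Lambda>) \<Longrightarrow> source \<Lambda> (cat_comp \<Lambda> x y) = source \<Lambda> y"
    and comp_assoc: "(x, y) \<in> topspace (composable \<Lambda>) \<Longrightarrow> (y, z) \<in> topspace (composable \<Lambda>) \<Longrightarrow>
      cat_comp \<Lambda> (cat_comp \<Lambda> x y) z = cat_comp \<Lambda> x (cat_comp \<Lambda> y z)"
    and comp_ident_left: "x \<in> topspace (Mor \<Lambda>) \<Longrightarrow> cat_comp \<Lambda> (ident \<Lambda> (rng \<Lambda> x)) x = x"
    and comp_ident_right: "x \<in> topspace (Mor \<Lambda>) \<Longrightarrow> cat_comp \<Lambda> x (ident \<Lambda> (source \<Lambda> x)) = x"

locale topological_kgraph = small_category \<Lambda>
  for k :: enat and \<Lambda> :: "('v, 'e) kgraph_data" +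
  assumes deg_degrees: "x \<in> topspace (Mor \<Lambda>) \<Longrightarrow> deg \<Lambda> x \<in> degrees k"
    and deg_ident: "v \<in> topspace (Obj \<Lambda>) \<Longrightarrow> deg \<Lambda> (ident \<Lambda> v) = 0"
    and deg_comp: "(x, y) \<in> topspace (composable \<Lambda>) \<Longrightarrow> deg \<Lambda> (cat_comp \<Lambda> x y) = deg \<Lambda> x + deg \<Lambda> y"
    and Obj_locally_compact: "locally_compact_space (Obj \<Lambda>)"
    and Obj_Hausdorff: "Hausdorff_space (Obj \<Lambda>)"
    and Mor_locally_compact: "locally_compact_space (Mor \<Lambda>)"
    and Mor_Hausdorff: "Hausdorff_space (Mor \<Lambda>)"
    and continuous_rng: "continuous_map (Mor \<Lambda>) (Obj \<Lambda>) (rng \<Lambda>)"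
    and continuous_source: "continuous_map (Mor \<Lambda>) (Obj \<Lambda>) (source \<Lambda>)"
    and local_homeo_source: "local_homeomorphism_map (Mor \<Lambda>) (Obj \<Lambda>) (source \<Lambda>)"
    and continuous_comp: "continuous_map (composable \<Lambda>) (Mor \<Lambda>) (\<lambda>(x, y). cat_comp \<Lambda> x y)"
    and open_comp: "open_map (composable \<Lambda>) (Mor \<Lambda>) (\<lambda>(x, y). cat_comp \<Lambda> x y)"
    and continuous_deg: "continuous_map (Mor \<Lambda>) (discrete_topology (degrees k)) (deg \<Lambda>)"
    and unique_factorization:
      "x \<in> topspace (Mor \<Lambda>) \<Longrightarrow> p \<in> degrees k \<Longrightarrow> q \<in> degrees k \<Longrightarrow> deg \<Lambda> x = p + q \<Longrightarrow>
        \<exists>!yz. yz \<in> topspace (composable \<Lambda>) \<and> x = cat_comp \<Lambda> (fst yz) (snd yz) \<and>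
          deg \<Lambda> (fst yz) = p \<and> deg \<Lambda> (snd yz) = q"

definition row_finite :: "enat \<Rightarrow> ('v, 'e) kgraph_data \<Rightarrow> bool" where
  "row_finite k \<Lambda> \<longleftrightarrow>
     (\<forall>p\<in>degrees k. \<forall>v\<in>topspace (Obj \<Lambda>). \<exists>V. is_nbhd (Obj \<Lambda>) v V \<and>
        compactin (path_space \<Lambda> p) {x \<in> paths \<Lambda> p. rng \<Lambda> x \<in> V})"

definition no_source :: "enat \<Rightarrow> ('v, 'e) kgraph_data \<Rightarrow> bool" where
  "no_source k \<Lambda> \<longleftrightarrow>
     (\<forall>p\<in>degrees k. \<forall>v\<in>topspace (Obj \<Lambda>). \<forall>V. is_nbhd (Obj \<Lambda>) v V \<longrightarrow>
        {x \<in> paths \<Lambda> p. rng \<Lambda> x \<in> V} \<noteq> {})"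

definition discrete_kgraph :: "enat \<Rightarrow> ('v, 'e) kgraph_data \<Rightarrow> bool" where
  "discrete_kgraph k \<Gamma> \<longleftrightarrow> topological_kgraph k \<Gamma> \<and>
     Obj \<Gamma> = discrete_topology (topspace (Obj \<Gamma>)) \<and>
     Mor \<Gamma> = discrete_topology (topspace (Mor \<Gamma>))"

definition edge_pairs :: "('v, 'e) kgraph_data \<Rightarrow> nat \<Rightarrow> nat \<Rightarrow> ('e \<times> 'e) set" where
  "edge_pairs \<Gamma> i j = {(x, y). x \<in> paths \<Gamma> (generator i) \<and> y \<in> paths \<Gamma> (generator j) \<and>
     source \<Gamma> x = rng \<Gamma> y}"

text \<open>
  The bijections \<open>T i j\<close>, \<open>i < j\<close>, by which a discrete \<open>k\<close>-graph is determined;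
  only the values of \<open>T i j\<close> on \<open>edge_pairs \<Gamma> i j\<close> are relevant.
\<close>

definition determined_by :: "enat \<Rightarrow> ('v, 'e) kgraph_data \<Rightarrow> (nat \<Rightarrow> nat \<Rightarrow> 'e \<times> 'e \<Rightarrow> 'e \<times> 'e) \<Rightarrow> bool" where
  "determined_by k \<Gamma> T \<longleftrightarrow>
     (\<forall>i\<in>indices k. \<forall>j\<in>indices k. i < j \<longrightarrow>
        bij_betw (T i j) (edge_pairs \<Gamma> i j) (edge_pairs \<Gamma> j i) \<and>
        (\<forall>(x, y)\<in>edge_pairs \<Gamma> i j. \<forall>(y', x')\<in>edge_pairs \<Gamma> j i.
           T i j (x, y) = (y', x') \<longleftrightarrow> cat_comp \<Gamma> x y = cat_comp \<Gamma> y' x'))"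

abbreviation circle :: "complex topology" where
  "circle \<equiv> top_of_set {z. cmod z = 1}"

text \<open>The space \<open>\<Gamma>\<^bsup>e_i\<^esup> \<times>\<^bsub>n_i,m_i\<^esub> \<T>\<close> with its source and range maps to \<open>\<Gamma>\<^sup>0 \<times> \<T>\<close>.\<close>

definition twisted_edges :: "('v, 'e) kgraph_data \<Rightarrow> nat \<Rightarrow> ('e \<times> complex) topology" where
  "twisted_edges \<Gamma> i = prod_topology (path_space \<Gamma> (generator i)) circle"

definition twisted_source ::
    "('v, 'e) kgraph_data \<Rightarrow> ('e \<Rightarrow> nat) \<Rightarrow> 'e \<times> complex \<Rightarrow> 'v \<times> complex" where
  "twisted_source \<Gamma> n = (\<lambda>(x, z). (source \<Gamma> x, z ^ n x))"

definition twisted_range ::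
    "('v, 'e) kgraph_data \<Rightarrow> ('e \<Rightarrow> int) \<Rightarrow> 'e \<times> complex \<Rightarrow> 'v \<times> complex" where
  "twisted_range \<Gamma> m = (\<lambda>(x, z). (rng \<Gamma> x, z powi m x))"

definition twisted_pairs ::
    "('v, 'e) kgraph_data \<Rightarrow> (nat \<Rightarrow> 'e \<Rightarrow> nat) \<Rightarrow> (nat \<Rightarrow> 'e \<Rightarrow> int) \<Rightarrow> nat \<Rightarrow> nat \<Rightarrow>
      (('e \<times> complex) \<times> ('e \<times> complex)) topology" where
  "twisted_pairs \<Gamma> n m i j =
     fibre_product (twisted_edges \<Gamma> i) (twisted_source \<Gamma> (n i))
       (twisted_edges \<Gamma> j) (twisted_range \<Gamma> (m j))"

end

(*
  Over a path w of \<Gamma> a morphism of \<Lambda> is a labelling by points of the circle of all the edges x that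
  occur in factorizations w = u x v, together with labels of the vertices; an edge label a forces the
  labels a^m and a^n at the ends, and around a commuting square e f = f' e' the labels are
  u^(m f), u^(n e), u^(m e'), u^(n f') for a common u. By coprimality such a u is unique for given
  labels of e and f, which yields the flips of the squares. A labelling of a composable pair extends uniquely to the
  composite: pulling one edge through a path square by square reduces this to the hexagonal condition.
  The latter holds because the ratios of the two resulting labels are killed by m2 m3, n1 m3 and n1 n2 (indices
  along the path of length three), hence by m3 and n1; together with the relations at the ends of the
  edges and coprimality this forces them to be 1. The labellings of w form a compact Hausdorff space, so gluing is a
  homeomorphism onto each fibre; the source map is a local homeomorphism because it is an iterated
  pullback of power maps of the circle.
*)
theory Submission
  imports Defs
begin

text \<open>Composites of arbitrary length have to be defined before the flips form a category, and
  no order of the edges of a path is privileged. A labelling records all factorizations at once, so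
  that composition is restriction to two segments read backwards.

  The exponents come from the fibre product: matching labels of e and f satisfy a^(n e) = b^(m f),
  and u -> (u^(m f), u^(n e)) parametrizes this curve when n e and m f are coprime. Condition (ii)
  makes the same u fit the other two sides of the square.

  The obstacle in the hexagonal condition is that coprimality is given for the two edges of a square
  and not for the first and third edge of a path. Three matching labels therefore have no common
  root at hand; one exists only for suitable powers, and the exponents must be cancelled afterwards.

  The morphisms obtained are functions on cells, whereas the theorem names edges as pairs in
  \<open>'e \<times> complex\<close>. A final renaming of morphisms bridges this, chosen so that the
  edges become literally these pairs. The maps of the theorem are then read off from the finished
  graph.\<close>

section \<open>Local homeomorphisms and sums of spaces\<close>

lemma local_homeomorphism_map_iff:
  "local_homeomorphism_map X Y f \<longleftrightarrow> continuous_map X Y f \<and> open_map X Y f \<and>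
     (\<forall>x\<in>topspace X. \<exists>U. openin X U \<and> x \<in> U \<and> inj_on f U)"
proof
  assume L: "local_homeomorphism_map X Y f"
  define P where "P U \<longleftrightarrow> openin X U \<and> openin Y (f ` U) \<and>
      homeomorphic_map (subtopology X U) (subtopology Y (f ` U)) f" for U
  have ex: "\<exists>U. P U \<and> x \<in> U" if "x \<in> topspace X" for x
    using L that unfolding local_homeomorphism_map_def P_def by blast
  have cont: "continuous_map (subtopology X U) Y f" if "P U" for U
    using that unfolding P_def by (meson continuous_map_in_subtopology homeomorphic_imp_continuous_map)
  have op: "openin Y (f ` W)" if "P U" "openin X W" "W \<subseteq> U" for U W
  proof -
    have "openin (subtopology X U) W"
      using that by (simp add: P_def openin_open_subtopology)
    then have "openin (subtopology Y (f ` U)) (f ` W)"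
      using that(1) homeomorphic_imp_open_map unfolding P_def open_map_def by blast
    then show ?thesis
      using that(1) openin_open_subtopology unfolding P_def by blast
  qed
  have "continuous_map X Y f"
    unfolding continuous_map_def
  proof (intro conjI allI impI)
    show "f \<in> topspace X \<rightarrow> topspace Y"
    proof
      fix x assume "x \<in> topspace X"
      then obtain U where "P U" "x \<in> U" using ex by blast
      then show "f x \<in> topspace Y" unfolding P_def using openin_subset by blast
    qed
    fix V assume V: "openin Y V"
    show "openin X {x \<in> topspace X. f x \<in> V}"
    proof (subst openin_subopen, intro ballI)
      fix x assume x: "x \<in> {x \<in> topspace X. f x \<in> V}"
      then obtain U where U: "P U" "x \<in> U" using ex by blast
      let ?W = "{y \<in> topspace (subtopology X U). f y \<in> V}"
      have "openin (subtopology X U) ?W"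
        using openin_continuous_map_preimage[OF cont[OF U(1)] V] .
      then have "openin X ?W"
        using U(1) openin_open_subtopology unfolding P_def by blast
      then show "\<exists>T. openin X T \<and> x \<in> T \<and> T \<subseteq> {x \<in> topspace X. f x \<in> V}"
        using U x by (intro exI[of _ ?W]) auto
    qed
  qed
  moreover have "open_map X Y f"
    unfolding open_map_def
  proof (intro allI impI)
    fix W assume W: "openin X W"
    show "openin Y (f ` W)"
    proof (subst openin_subopen, intro ballI)
      fix y assume "y \<in> f ` W"
      then obtain x where x: "x \<in> W" "y = f x" by blast
      then obtain U where U: "P U" "x \<in> U" using ex openin_subset[OF W] by blast
      have "openin Y (f ` (W \<inter> U))"
        using op[OF U(1)] W U(1) unfolding P_def by (simp add: openin_Int)
      then show "\<exists>T. openin Y T \<and> y \<in> T \<and> T \<subseteq> f ` W"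
        using x U(2) by (intro exI[of _ "f ` (W \<inter> U)"]) auto
    qed
  qed
  moreover have "\<exists>U. openin X U \<and> x \<in> U \<and> inj_on f U" if x: "x \<in> topspace X" for x
  proof -
    obtain U where U: "P U" "x \<in> U" using ex[OF x] by blast
    then have "inj_on f (topspace (subtopology X U))"
      using homeomorphic_imp_injective_map unfolding P_def by blast
    moreover have "topspace (subtopology X U) = U"
      using U openin_subset unfolding P_def by (metis topspace_subtopology_subset)
    ultimately show ?thesis using U P_def by auto
  qed
  ultimately show "continuous_map X Y f \<and> open_map X Y f \<and>
     (\<forall>x\<in>topspace X. \<exists>U. openin X U \<and> x \<in> U \<and> inj_on f U)" by blast
next
  assume R: "continuous_map X Y f \<and> open_map X Y f \<and>
     (\<forall>x\<in>topspace X. \<exists>U. openin X U \<and> x \<in> U \<and> inj_on f U)"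
  show "local_homeomorphism_map X Y f"
    unfolding local_homeomorphism_map_def
  proof
    fix x assume "x \<in> topspace X"
    then obtain U where U: "openin X U" "x \<in> U" "inj_on f U"
      using R by blast
    have fU: "openin Y (f ` U)"
      using R U(1) by (simp add: open_map_def)
    have tU: "topspace (subtopology X U) = U" "topspace (subtopology Y (f ` U)) = f ` U"
      using openin_subset[OF U(1)] openin_subset[OF fU] by auto
    have "homeomorphic_map (subtopology X U) (subtopology Y (f ` U)) f"
    proof (rule bijective_open_imp_homeomorphic_map)
      show "continuous_map (subtopology X U) (subtopology Y (f ` U)) f"
        using R openin_subset[OF U(1)] by (auto simp: continuous_map_in_subtopology continuous_map_from_subtopology)
      show "open_map (subtopology X U) (subtopology Y (f ` U)) f"
        unfolding open_map_def
      proof (intro allI impI)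
        fix W assume "openin (subtopology X U) W"
        then have "openin X W" "W \<subseteq> U"
          using U(1) by (simp_all add: openin_open_subtopology)
        then show "openin (subtopology Y (f ` U)) (f ` W)"
          using R fU by (auto simp: openin_open_subtopology open_map_def)
      qed
    qed (use tU U(3) in auto)
    then show "\<exists>U. openin X U \<and> x \<in> U \<and> openin Y (f ` U) \<and>
        homeomorphic_map (subtopology X U) (subtopology Y (f ` U)) f"
      using U fU by blast
  qed
qed

lemma local_homeomorphism_map_compose:
  assumes f: "local_homeomorphism_map X Y f" and g: "local_homeomorphism_map Y Z g"
  shows "local_homeomorphism_map X Z (\<lambda>x. g (f x))"
  unfolding local_homeomorphism_map_iff
proof (intro conjI ballI)
  note F = f[unfolded local_homeomorphism_map_iff] and G = g[unfolded local_homeomorphism_map_iff]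
  show "continuous_map X Z (\<lambda>x. g (f x))"
    using F G continuous_map_compose[of X Y f Z g] by (simp add: o_def)
  show "open_map X Z (\<lambda>x. g (f x))"
    using F G open_map_compose[of X Y f Z g] by (simp add: o_def)
  fix x assume x: "x \<in> topspace X"
  then obtain U where U: "openin X U" "x \<in> U" "inj_on f U" using F by blast
  have "f x \<in> topspace Y" using F x by (simp add: continuous_map_def Pi_iff)
  then obtain V where V: "openin Y V" "f x \<in> V" "inj_on g V" using G by blast
  have "openin X (U \<inter> {y \<in> topspace X. f y \<in> V})"
    using U V F openin_continuous_map_preimage by (intro openin_Int) blast+
  moreover have "inj_on (\<lambda>x. g (f x)) (U \<inter> {y \<in> topspace X. f y \<in> V})"
    using U(3) V(3) by (auto simp: inj_on_def)
  ultimately show "\<exists>U. openin X U \<and> x \<in> U \<and> inj_on (\<lambda>x. g (f x)) U"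
    using U V x by (intro exI[of _ "U \<inter> {y \<in> topspace X. f y \<in> V}"]) auto
qed

lemma local_homeomorphism_map_homeomorphic:
  assumes "homeomorphic_map X Y f"
  shows "local_homeomorphism_map X Y f"
  using assms homeomorphic_imp_injective_map[OF assms]
  unfolding local_homeomorphism_map_iff homeomorphic_eq_everything_map by blast

section \<open>Fibre products\<close>

lemma topspace_fibre_product:
  "topspace (fibre_product X f Y g) = {(x, y). x \<in> topspace X \<and> y \<in> topspace Y \<and> f x = g y}"
  by (auto simp: fibre_product_def)

lemma continuous_map_fibre_product:
  "continuous_map W (fibre_product X f Y g) h \<longleftrightarrow>
     continuous_map W X (\<lambda>w. fst (h w)) \<and> continuous_map W Y (\<lambda>w. snd (h w)) \<and>
     (\<forall>w\<in>topspace W. f (fst (h w)) = g (snd (h w)))"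
  by (auto simp: fibre_product_def continuous_map_in_subtopology o_def case_prod_unfold continuous_map_pairwise)

text \<open>A basic open set U \<times> V of the fibre product has as image the points of V that
  \<open>g\<close> sends into f(U), an open set because \<open>f\<close> is open. Where
  \<open>f\<close> is injective on U, so is \<open>snd\<close> on the part over U, because the
  second coordinate fixes the value of \<open>f\<close>.\<close>

lemma local_homeomorphism_map_pullback:
  assumes f: "local_homeomorphism_map X Z f" and g: "continuous_map Y Z g"
  shows "local_homeomorphism_map (fibre_product X f Y g) Y snd"
  unfolding local_homeomorphism_map_iff
proof (intro conjI ballI)
  note F = f[unfolded local_homeomorphism_map_iff]
  let ?P = "fibre_product X f Y g"
  show "continuous_map ?P Y snd"
    unfolding fibre_product_def by (intro continuous_map_from_subtopology continuous_map_snd)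
  show "open_map ?P Y snd"
    unfolding open_map_def
  proof (intro allI impI)
    fix Q assume Q: "openin ?P Q"
    show "openin Y (snd ` Q)"
    proof (subst openin_subopen, intro ballI)
      fix y assume "y \<in> snd ` Q"
      then obtain x where xy: "(x, y) \<in> Q" by force
      obtain Q' where Q': "openin (prod_topology X Y) Q'" "Q = Q' \<inter> {(x, y). f x = g y}"
        using Q unfolding fibre_product_def openin_subtopology by blast
      have xy': "(x, y) \<in> Q'" using xy Q'(2) by simp
      from Q'(1)[unfolded openin_prod_topology_alt, rule_format, OF xy']
      obtain U V where UV: "openin X U" "openin Y V" "x \<in> U" "y \<in> V" "U \<times> V \<subseteq> Q'"
        by blast
      let ?W = "V \<inter> {y \<in> topspace Y. g y \<in> f ` U}"
      have "openin Z (f ` U)" using F UV(1) by (simp add: open_map_def)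
      then have "openin Y ?W"
        using UV(2) g openin_continuous_map_preimage by (intro openin_Int) blast+
      moreover have "y \<in> ?W"
      proof -
        have "g y = f x" using xy Q'(2) by auto
        then show ?thesis using UV(2-4) openin_subset[OF UV(2)] by auto
      qed
      moreover have "?W \<subseteq> snd ` Q"
      proof
        fix y' assume y': "y' \<in> ?W"
        then obtain u where u: "u \<in> U" "g y' = f u" by blast
        then have "(u, y') \<in> Q"
          using UV(5) Q'(2) y' by auto
        then show "y' \<in> snd ` Q" by (metis imageI snd_conv)
      qed
      ultimately show "\<exists>T. openin Y T \<and> y \<in> T \<and> T \<subseteq> snd ` Q" by blast
    qed
  qed
  fix p assume "p \<in> topspace ?P"
  then obtain x y where p: "p = (x, y)" "x \<in> topspace X" "y \<in> topspace Y" "f x = g y"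
    by (auto simp: topspace_fibre_product)
  then obtain U where U: "openin X U" "x \<in> U" "inj_on f U" using F by blast
  let ?U = "(U \<times> topspace Y) \<inter> {(x, y). f x = g y}"
  have "openin (prod_topology X Y) (U \<times> topspace Y)"
    using U(1) by (simp add: openin_prod_Times_iff)
  then have "openin ?P ?U"
    unfolding fibre_product_def openin_subtopology by blast
  moreover have "inj_on snd ?U"
  proof (rule inj_onI)
    fix a b assume ab: "a \<in> ?U" "b \<in> ?U" "snd a = snd b"
    then have "fst a \<in> U" "fst b \<in> U" "f (fst a) = f (fst b)" by auto
    then show "a = b" using inj_onD[OF U(3)] ab(3) by (intro prod_eqI) auto
  qed
  moreover have "p \<in> ?U"
    using p U(2) by simp
  ultimately show "\<exists>U. openin ?P U \<and> p \<in> U \<and> inj_on snd U"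
    by blast
qed

section \<open>Disjoint sums of spaces\<close>

lemma openin_component_image:
  "i \<in> I \<Longrightarrow> openin (X i) U \<Longrightarrow> openin (sum_topology X I) (Pair i ` U)"
  using open_map_component_injection[of i I X] by (simp add: open_map_def)

lemma continuous_map_from_sum_topology:
  "continuous_map (sum_topology X I) Y f \<longleftrightarrow> (\<forall>i\<in>I. continuous_map (X i) Y (\<lambda>x. f (i, x)))"
proof
  assume f: "continuous_map (sum_topology X I) Y f"
  show "\<forall>i\<in>I. continuous_map (X i) Y (\<lambda>x. f (i, x))"
  proof
    fix i assume "i \<in> I"
    then show "continuous_map (X i) Y (\<lambda>x. f (i, x))"
      using continuous_map_compose[OF continuous_map_component_injection f] by (simp add: o_def)
  qed
next
  assume f: "\<forall>i\<in>I. continuous_map (X i) Y (\<lambda>x. f (i, x))"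
  show "continuous_map (sum_topology X I) Y f"
    unfolding continuous_map_def
  proof (intro conjI allI impI)
    show "f \<in> topspace (sum_topology X I) \<rightarrow> topspace Y"
      using f by (fastforce simp: continuous_map_def Pi_iff)
    fix V assume V: "openin Y V"
    have "{x \<in> topspace (sum_topology X I). f x \<in> V} = Sigma I (\<lambda>i. {x \<in> topspace (X i). f (i, x) \<in> V})"
      by auto
    then show "openin (sum_topology X I) {x \<in> topspace (sum_topology X I). f x \<in> V}"
      using f V openin_continuous_map_preimage by (simp add: openin_disjoint_union) blast
  qed
qed

lemma open_map_from_sum_topology:
  "open_map (sum_topology X I) Y f \<longleftrightarrow> (\<forall>i\<in>I. open_map (X i) Y (\<lambda>x. f (i, x)))"
proof
  assume f: "open_map (sum_topology X I) Y f"
  show "\<forall>i\<in>I. open_map (X i) Y (\<lambda>x. f (i, x))"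
  proof
    fix i assume "i \<in> I"
    then show "open_map (X i) Y (\<lambda>x. f (i, x))"
      using open_map_compose[OF open_map_component_injection f] by (simp add: o_def)
  qed
next
  assume f: "\<forall>i\<in>I. open_map (X i) Y (\<lambda>x. f (i, x))"
  show "open_map (sum_topology X I) Y f"
    unfolding open_map_def
  proof (intro allI impI)
    fix U assume "openin (sum_topology X I) U"
    then obtain T where T: "U = Sigma I T" "\<forall>i\<in>I. openin (X i) (T i)"
      by (auto simp: openin_sum_topology_alt)
    have "f ` U = (\<Union>i\<in>I. (\<lambda>x. f (i, x)) ` T i)"
      unfolding T(1) by force
    moreover have "openin Y \<dots>"
      using f T(2) by (intro openin_Union) (auto simp: open_map_def)
    ultimately show "openin Y (f ` U)" by simp
  qed
qed

lemma local_homeomorphism_map_from_sum_topology: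
  assumes "\<And>i. i \<in> I \<Longrightarrow> local_homeomorphism_map (X i) Y (\<lambda>x. f (i, x))"
  shows "local_homeomorphism_map (sum_topology X I) Y f"
  unfolding local_homeomorphism_map_iff continuous_map_from_sum_topology open_map_from_sum_topology
proof (intro conjI ballI)
  fix p assume "p \<in> topspace (sum_topology X I)"
  then obtain i x where p: "p = (i, x)" "i \<in> I" "x \<in> topspace (X i)" by auto
  then obtain U where U: "openin (X i) U" "x \<in> U" "inj_on (\<lambda>x. f (i, x)) U"
    using assms[OF p(2)] unfolding local_homeomorphism_map_iff by blast
  have "openin (sum_topology X I) (Pair i ` U)"
    by (rule openin_component_image[of _ I X, OF p(2) U(1)])
  then show "\<exists>U. openin (sum_topology X I) U \<and> p \<in> U \<and> inj_on f U"
    using U p by (intro exI[of _ "Pair i ` U"]) (auto simp: inj_on_def)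
qed (use assms in \<open>auto simp: local_homeomorphism_map_iff\<close>)

lemma Hausdorff_space_sum_topology:
  assumes "\<And>i. i \<in> I \<Longrightarrow> Hausdorff_space (X i)"
  shows "Hausdorff_space (sum_topology X I)"
  unfolding Hausdorff_space_def
proof (intro allI impI)
  fix p q assume pq: "p \<in> topspace (sum_topology X I) \<and> q \<in> topspace (sum_topology X I) \<and> p \<noteq> q"
  obtain i x where p: "p = (i, x)" by (cases p)
  obtain j y where q: "q = (j, y)" by (cases q)
  have *: "p = (i, x)" "q = (j, y)" "i \<in> I" "x \<in> topspace (X i)" "j \<in> I" "y \<in> topspace (X j)"
    using pq by (auto simp: p q)
  note op = openin_component_image[of _ I X]
  show "\<exists>U V. openin (sum_topology X I) U \<and> openin (sum_topology X I) V \<and> p \<in> U \<and> q \<in> V \<and> disjnt U V"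
  proof (cases "i = j")
    case True
    then have "x \<noteq> y" using pq * by simp
    then obtain U V where "openin (X i) U" "openin (X i) V" "x \<in> U" "y \<in> V" "disjnt U V"
      using assms[OF *(3)] * True unfolding Hausdorff_space_def by metis
    then show ?thesis
      using op[OF *(3)] * True
      by (intro exI[of _ "Pair i ` U"] exI[of _ "Pair i ` V"]) (auto simp: disjnt_def)
  next
    case False
    then show ?thesis
      using op[OF *(3) openin_topspace] op[OF *(5) openin_topspace] *
      by (intro exI[of _ "Pair i ` topspace (X i)"] exI[of _ "Pair j ` topspace (X j)"]) (auto simp: disjnt_def)
  qed
qed

lemma compactin_component_injection:
  assumes "i \<in> I" "compactin (X i) K"
  shows "compactin (sum_topology X I) (Pair i ` K)"
  using image_compactin[OF assms(2) continuous_map_component_injection[of i I X, OF assms(1)]] by simp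

text \<open>Each summand is open in the sum and compact, hence a compact open neighbourhood of all
  its points.\<close>

lemma locally_compact_space_sum_topology:
  assumes "\<And>i. i \<in> I \<Longrightarrow> compact_space (X i)"
  shows "locally_compact_space (sum_topology X I)"
  unfolding locally_compact_space_def
proof
  fix p assume "p \<in> topspace (sum_topology X I)"
  then obtain i x where p: "p = (i, x)" "i \<in> I" "x \<in> topspace (X i)" by auto
  have "openin (sum_topology X I) (Pair i ` topspace (X i))"
    by (rule openin_component_image[of _ I X, OF p(2) openin_topspace])
  moreover have "compactin (sum_topology X I) (Pair i ` topspace (X i))"
    using compactin_component_injection[OF p(2)] assms[OF p(2)] by (simp add: compact_space_def)
  ultimately show "\<exists>U K. openin (sum_topology X I) U \<and> compactin (sum_topology X I) K \<and> p \<in> U \<and> U \<subseteq> K"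
    using p by blast
qed

text \<open>The power map is a covering of the punctured plane by itself, and the circle is the full
  preimage of the circle. Hence the image of the circle intersected with an open \<open>W\<close> is
  the circle intersected with the image of \<open>W\<close>, and openness passes to the circle;
  local injectivity restricts anyway.\<close>

lemma local_homeomorphism_map_circle_power:
  assumes "n > 0"
  shows "local_homeomorphism_map circle circle (\<lambda>z. z ^ n)"
proof -
  let ?S = "{z::complex. cmod z = 1}"
  have cov: "covering_space (- {0}) (\<lambda>z::complex. z ^ n) (- {0})"
    using covering_space_power_punctured_plane[of n] assms by simp
  have op: "openin (top_of_set (- {0})) V \<longleftrightarrow> open V \<and> V \<subseteq> - {0}" for V :: "complex set"
    by (rule openin_open_eq) (simp add: open_Compl)
  have n1: "cmod (z ^ n) = 1" if "cmod z = 1" for z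
    by (simp only: norm_power that power_one)
  have abs1: "cmod z = 1" if "cmod (z ^ n) = 1" for z
    by (rule power_eq_imp_eq_base[of _ n]) (use that assms in \<open>simp_all only: norm_power power_one norm_ge_zero zero_le_one\<close>)
  show ?thesis
    unfolding local_homeomorphism_map_iff
  proof (intro conjI ballI)
    show "continuous_map circle circle (\<lambda>z. z ^ n)"
      using n1 by (auto simp: continuous_map_in_subtopology intro!: continuous_intros)
    show "open_map circle circle (\<lambda>z. z ^ n)"
      unfolding open_map_def
    proof (intro allI impI)
      fix U assume "openin circle U"
      then obtain W where W: "open W" "U = ?S \<inter> W"
        by (auto simp: openin_open)
      have "openin (top_of_set (- {0})) ((\<lambda>z. z ^ n) ` (W - {0}))"
        by (rule covering_space_open_map[OF cov]) (use W(1) in \<open>auto simp: op open_Diff\<close>)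
      then have "open ((\<lambda>z. z ^ n) ` (W - {0}))"
        by (simp add: op)
      moreover have "(\<lambda>z. z ^ n) ` U = ?S \<inter> (\<lambda>z. z ^ n) ` (W - {0})"
      proof
        show "(\<lambda>z. z ^ n) ` U \<subseteq> ?S \<inter> (\<lambda>z. z ^ n) ` (W - {0})"
        proof (intro image_subsetI)
          fix w assume "w \<in> U"
          then have w: "cmod w = 1" "w \<in> W - {0}" unfolding W(2) by auto
          then show "w ^ n \<in> ?S \<inter> (\<lambda>z. z ^ n) ` (W - {0})"
            using n1 by blast
        qed
        show "?S \<inter> (\<lambda>z. z ^ n) ` (W - {0}) \<subseteq> (\<lambda>z. z ^ n) ` U"
        proof
          fix x assume "x \<in> ?S \<inter> (\<lambda>z. z ^ n) ` (W - {0})"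
          then obtain w where w: "cmod x = 1" "x = w ^ n" "w \<in> W" by blast
          then show "x \<in> (\<lambda>z. z ^ n) ` U"
            unfolding W(2) using abs1[of w] by (intro image_eqI[of _ _ w]) simp_all
        qed
      qed
      ultimately show "openin circle ((\<lambda>z. z ^ n) ` U)"
        unfolding openin_open by blast
    qed
    fix z :: complex assume z: "z \<in> topspace circle"
    then have "z \<in> - {0}" by auto
    then obtain T u q where T: "z \<in> T" "openin (top_of_set (- {0})) T" "homeomorphism T u (\<lambda>z. z ^ n) q"
      by (rule covering_space_local_homeomorphism[OF cov])
    have "inj_on (\<lambda>z. z ^ n) T"
      by (rule inj_on_inverseI[of _ q]) (rule homeomorphism_apply1[OF T(3)])
    moreover have "open T" using T(2) by (simp add: op)
    ultimately have "openin circle (?S \<inter> T)" "inj_on (\<lambda>z. z ^ n) (?S \<inter> T)"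
      by (simp_all add: openin_open_Int inj_on_Int)
    then show "\<exists>U. openin circle U \<and> z \<in> U \<and> inj_on (\<lambda>z. z ^ n) U"
      using z T(1) by (intro exI[of _ "?S \<inter> T"]) simp
  qed
qed

section \<open>Degrees, edges and squares\<close>

text \<open>The number of edges in any factorization of a path of degree \<open>p\<close> into
  edges; inductions on paths run over it.\<close>

definition total_degree :: "('a \<Rightarrow>\<^sub>0 nat) \<Rightarrow> nat" where
  "total_degree p = (\<Sum>i\<in>Poly_Mapping.keys p. Poly_Mapping.lookup p i)"

lemma total_degree_superset:
  assumes "finite A" and "Poly_Mapping.keys p \<subseteq> A"
  shows "total_degree p = (\<Sum>i\<in>A. Poly_Mapping.lookup p i)"
  unfolding total_degree_def using assms
  by (intro sum.mono_neutral_left) (auto simp: in_keys_iff)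

lemma total_degree_add: "total_degree (p + q) = total_degree p + total_degree q"
proof -
  let ?A = "Poly_Mapping.keys p \<union> Poly_Mapping.keys q"
  have "total_degree (p + q) = (\<Sum>i\<in>?A. Poly_Mapping.lookup (p + q) i)"
    by (rule total_degree_superset) (auto simp: in_keys_iff lookup_add)
  moreover have "total_degree p = (\<Sum>i\<in>?A. Poly_Mapping.lookup p i)"
    and "total_degree q = (\<Sum>i\<in>?A. Poly_Mapping.lookup q i)"
    by (rule total_degree_superset; auto)+
  ultimately show ?thesis
    by (simp add: lookup_add sum.distrib)
qed

lemma total_degree_generator [simp]: "total_degree (generator i) = 1"
  by (simp add: total_degree_def)

lemma generator_eq_iff [simp]: "generator i = generator j \<longleftrightarrow> i = j"
  by (metis lookup_single_eq lookup_single_not_eq zero_neq_one)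

lemma generator_nonzero [simp]: "generator i \<noteq> 0" "0 \<noteq> generator i"
  by (metis lookup_single_eq lookup_zero zero_neq_one)+

lemma generator_in_degrees [simp]: "generator i \<in> degrees k \<longleftrightarrow> i \<in> indices k"
  by (simp add: degrees_def)

lemma keys_add_nat: "Poly_Mapping.keys (p + q :: 'a \<Rightarrow>\<^sub>0 nat) = Poly_Mapping.keys p \<union> Poly_Mapping.keys q"
  by (auto simp: in_keys_iff lookup_add)

lemma add_in_degrees [simp]: "p + q \<in> degrees k \<longleftrightarrow> p \<in> degrees k \<and> q \<in> degrees k"
  by (auto simp: degrees_def keys_add_nat)

lemma split_generator:
  assumes "Poly_Mapping.lookup p i > 0"
  obtains q where "p = generator i + q"
proof
  show "p = generator i + (p - generator i)"
    using assms by (intro poly_mapping_eqI) (auto simp: lookup_add lookup_minus lookup_single when_def)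
qed

lemma keys_nonempty_split:
  assumes "p \<noteq> 0"
  obtains i q where "p = generator i + q"
  using assms split_generator
  by (metis gr0I lookup_zero poly_mapping_eqI)

section \<open>Unique factorization, vertices and edges\<close>

context topological_kgraph
begin

abbreviation arrows :: "'e set" where
  "arrows \<equiv> topspace (Mor \<Lambda>)"

abbreviation comp_infix :: "'e \<Rightarrow> 'e \<Rightarrow> 'e" (infixl "\<cdot>" 70) where
  "x \<cdot> y \<equiv> cat_comp \<Lambda> x y"

definition cpb :: "'e \<Rightarrow> 'e \<Rightarrow> bool" where
  "cpb x y \<longleftrightarrow> x \<in> arrows \<and> y \<in> arrows \<and> source \<Lambda> x = rng \<Lambda> y"

lemma topspace_composable: "topspace (composable \<Lambda>) = {(x, y). cpb x y}"
  by (auto simp: composable_def fibre_product_def cpb_def)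

lemma composable_iff [simp]: "(x, y) \<in> topspace (composable \<Lambda>) \<longleftrightarrow> cpb x y"
  by (simp add: topspace_composable)

lemma cpb_arrow: "cpb x y \<Longrightarrow> x \<in> arrows" "cpb x y \<Longrightarrow> y \<in> arrows"
  by (auto simp: cpb_def)

lemma cpb_comp [simp]: "cpb x y \<Longrightarrow> x \<cdot> y \<in> arrows"
  "cpb x y \<Longrightarrow> rng \<Lambda> (x \<cdot> y) = rng \<Lambda> x" "cpb x y \<Longrightarrow> source \<Lambda> (x \<cdot> y) = source \<Lambda> y"
  "cpb x y \<Longrightarrow> deg \<Lambda> (x \<cdot> y) = deg \<Lambda> x + deg \<Lambda> y"
  using comp_mor rng_comp source_comp deg_comp by auto

lemma cpb_comp_left [simp]: "cpb x y \<Longrightarrow> cpb (x \<cdot> y) z \<longleftrightarrow> cpb y z"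
  using cpb_comp(1,3) cpb_arrow(2) unfolding cpb_def by metis

lemma cpb_comp_right [simp]: "cpb y z \<Longrightarrow> cpb x (y \<cdot> z) \<longleftrightarrow> cpb x y"
  using cpb_comp(1,2) cpb_arrow(1) unfolding cpb_def by metis

lemma assoc: "cpb x y \<Longrightarrow> cpb y z \<Longrightarrow> x \<cdot> y \<cdot> z = x \<cdot> (y \<cdot> z)"
  using comp_assoc by simp

lemma factorization:
  assumes "x \<in> arrows" and "deg \<Lambda> x = p + q"
  obtains y z where "cpb y z" "x = y \<cdot> z" "deg \<Lambda> y = p" "deg \<Lambda> z = q"
proof -
  have "p + q \<in> degrees k"
    using deg_degrees assms by metis
  then obtain yz where "yz \<in> topspace (composable \<Lambda>)" "x = fst yz \<cdot> snd yz"
      "deg \<Lambda> (fst yz) = p" "deg \<Lambda> (snd yz) = q"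
    using unique_factorization[OF assms(1) _ _ assms(2)] unfolding add_in_degrees by metis
  then show thesis
    by (intro that[of "fst yz" "snd yz"]) (auto simp: topspace_composable)
qed

text \<open>Only the degrees of the first factors are compared: degrees add and can be cancelled, so
  those of the second factors agree as well.\<close>

lemma factor_unique:
  assumes "cpb x y" "cpb x' y'" "x \<cdot> y = x' \<cdot> y'" "deg \<Lambda> x = deg \<Lambda> x'"
  shows "x = x' \<and> y = y'"
proof -
  have dy: "deg \<Lambda> y = deg \<Lambda> y'"
    using cpb_comp(4)[OF assms(1)] cpb_comp(4)[OF assms(2)] assms by simp
  have "\<exists>!yz. yz \<in> topspace (composable \<Lambda>) \<and> x \<cdot> y = fst yz \<cdot> snd yz \<and>
          deg \<Lambda> (fst yz) = deg \<Lambda> x \<and> deg \<Lambda> (snd yz) = deg \<Lambda> y"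
    by (rule unique_factorization) (use assms(1) deg_degrees cpb_arrow in simp_all)
  then have "(x, y) = (x', y')"
    by (rule ex1E) (use assms dy in \<open>metis composable_iff fst_conv snd_conv\<close>)
  then show ?thesis by simp
qed

lemma comp_left_cancel: "cpb x y \<Longrightarrow> cpb x y' \<Longrightarrow> x \<cdot> y = x \<cdot> y' \<longleftrightarrow> y = y'"
  using factor_unique by blast

definition vertex :: "'e \<Rightarrow> bool" where
  "vertex x \<longleftrightarrow> (\<exists>v\<in>topspace (Obj \<Lambda>). x = ident \<Lambda> v)"

lemma cpb_ident [simp]: "x \<in> arrows \<Longrightarrow> cpb x (ident \<Lambda> (source \<Lambda> x))"
  "x \<in> arrows \<Longrightarrow> cpb (ident \<Lambda> (rng \<Lambda> x)) x"
  by (simp_all add: cpb_def ident_mor source_obj rng_ident rng_obj source_ident)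

lemma comp_ident [simp]: "x \<in> arrows \<Longrightarrow> x \<cdot> ident \<Lambda> (source \<Lambda> x) = x"
  "x \<in> arrows \<Longrightarrow> ident \<Lambda> (rng \<Lambda> x) \<cdot> x = x"
  by (simp_all add: comp_ident_left comp_ident_right)

text \<open>An arrow of degree 0 has two factorizations into factors of degree 0, one with an
  identity on the left and one with an identity on the right. Uniqueness makes the arrow equal to
  that identity.\<close>

lemma vertex_iff_degree_0: "vertex x \<longleftrightarrow> x \<in> arrows \<and> deg \<Lambda> x = 0"
proof
  assume *: "x \<in> arrows \<and> deg \<Lambda> x = 0"
  have "x = ident \<Lambda> (rng \<Lambda> x) \<and> ident \<Lambda> (source \<Lambda> x) = x"
    by (rule factor_unique) (use * in \<open>auto simp: deg_ident rng_obj\<close>)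
  then show "vertex x"
    using * rng_obj by (metis vertex_def)
qed (auto simp: vertex_def ident_mor deg_ident)

lemma vertex_arrow [simp]: "vertex x \<Longrightarrow> x \<in> arrows"
  by (simp add: vertex_iff_degree_0)

lemma vertexD:
  assumes "vertex x"
  shows "x = ident \<Lambda> (rng \<Lambda> x)" "source \<Lambda> x = rng \<Lambda> x"
  using assms by (auto simp: vertex_def rng_ident source_ident)

lemma vertex_ident [simp]: "v \<in> topspace (Obj \<Lambda>) \<Longrightarrow> vertex (ident \<Lambda> v)"
  by (auto simp: vertex_def)

lemma cpb_vertex:
  assumes "vertex v"
  shows "cpb v x \<Longrightarrow> v = ident \<Lambda> (rng \<Lambda> x)" "cpb x v \<Longrightarrow> v = ident \<Lambda> (source \<Lambda> x)"
  using vertexD[OF assms] by (simp_all add: cpb_def)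

lemma comp_vertex:
  assumes "vertex v"
  shows "cpb v x \<Longrightarrow> v \<cdot> x = x" "cpb x v \<Longrightarrow> x \<cdot> v = x"
  using cpb_vertex[OF assms] cpb_arrow comp_ident by blast+

definition edge :: "'e \<Rightarrow> bool" where
  "edge e \<longleftrightarrow> e \<in> arrows \<and> (\<exists>i\<in>indices k. deg \<Lambda> e = generator i)"

lemma edge_arrow [simp]: "edge e \<Longrightarrow> e \<in> arrows"
  by (simp add: edge_def)

lemma edge_not_vertex: "edge e \<Longrightarrow> \<not> vertex e"
  unfolding edge_def vertex_iff_degree_0 by (metis generator_nonzero(1))

lemma edgeI: "e \<in> arrows \<Longrightarrow> deg \<Lambda> e = generator i \<Longrightarrow> edge e"
  unfolding edge_def using deg_degrees generator_in_degrees by metis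

lemma arrow_cases:
  assumes "x \<in> arrows"
  obtains "vertex x" | e y where "edge e" "cpb e y" "x = e \<cdot> y"
proof (cases "deg \<Lambda> x = 0")
  case True
  then show thesis using assms that(1) vertex_iff_degree_0 by blast
next
  case False
  then obtain i q where *: "deg \<Lambda> x = generator i + q"
    using keys_nonempty_split by blast
  obtain e y where e: "cpb e y" "x = e \<cdot> y" "deg \<Lambda> e = generator i"
    by (rule factorization[OF assms *])
  show thesis
    by (rule that(2)[OF edgeI[OF cpb_arrow(1)[OF e(1)] e(3)] e(1,2)])
qed

lemma edge_degree:
  assumes "edge e"
  obtains i where "i \<in> indices k" "deg \<Lambda> e = generator i"
  using assms unfolding edge_def by blast

lemma total_degree_edge_comp:
  assumes "edge e" "cpb e y"
  shows "total_degree (deg \<Lambda> (e \<cdot> y)) = Suc (total_degree (deg \<Lambda> y))"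
proof -
  obtain i where "deg \<Lambda> e = generator i"
    using assms(1) by (rule edge_degree)
  then show ?thesis
    using assms(2) by (simp only: cpb_comp(4) total_degree_add total_degree_generator)
qed

text \<open>Edges are peeled off at the range end. The first edge of a path is in general not
  unique, so this rule proves properties of paths but does not define functions on them.\<close>

lemma arrow_induct [consumes 1, case_names vertex edge]:
  assumes "x \<in> arrows"
    and "\<And>v. vertex v \<Longrightarrow> P v"
    and "\<And>e y. edge e \<Longrightarrow> cpb e y \<Longrightarrow> P y \<Longrightarrow> P (e \<cdot> y)"
  shows "P x"
  using assms(1)
proof (induction "total_degree (deg \<Lambda> x)" arbitrary: x rule: less_induct)
  case less
  from less.prems show ?case
  proof (cases rule: arrow_cases)
    case 1
    then show ?thesis by (rule assms(2))
  next
    case (2 e y)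
    have "P y"
      by (rule less.hyps) (use 2 total_degree_edge_comp[OF 2(1,2)] cpb_arrow(2)[OF 2(2)] in simp_all)
    then show ?thesis
      using assms(3) 2 by blast
  qed
qed

text \<open>The edges are listed in the order of the two factorizations, so a primed edge is
  parallel to the unprimed one. Pairs of equal degree are excluded, in accordance with the
  hypotheses of the theorem, which concern two different colours.\<close>

definition square :: "'e \<Rightarrow> 'e \<Rightarrow> 'e \<Rightarrow> 'e \<Rightarrow> bool" where
  "square e f f' e' \<longleftrightarrow> edge e \<and> edge f \<and> edge f' \<and> edge e' \<and> cpb e f \<and> cpb f' e' \<and>
     e \<cdot> f = f' \<cdot> e' \<and> deg \<Lambda> e = deg \<Lambda> e' \<and> deg \<Lambda> f = deg \<Lambda> f' \<and> deg \<Lambda> e \<noteq> deg \<Lambda> f"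

lemma square_sym: "square e f f' e' \<Longrightarrow> square f' e' e f"
  by (auto simp: square_def)

lemma squareD:
  assumes "square e f f' e'"
  shows "edge e" "edge f" "edge f'" "edge e'" "cpb e f" "cpb f' e'" "e \<cdot> f = f' \<cdot> e'"
    "deg \<Lambda> e' = deg \<Lambda> e" "deg \<Lambda> f' = deg \<Lambda> f" "deg \<Lambda> e \<noteq> deg \<Lambda> f"
  using assms unfolding square_def by (blast intro: sym)+

lemma square_ends:
  assumes "square e f f' e'"
  shows "rng \<Lambda> f' = rng \<Lambda> e" "source \<Lambda> e' = source \<Lambda> f"
  using cpb_comp(2,3)[OF squareD(5)[OF assms]] cpb_comp(2,3)[OF squareD(6)[OF assms]]
    squareD(7)[OF assms] by simp_all

lemma edge_unique:
  assumes "cpb e x" "cpb f y" "e \<cdot> x = f \<cdot> y" "deg \<Lambda> e = deg \<Lambda> f"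
  shows "e = f" "x = y"
  using factor_unique[OF assms] by auto

lemma square_exists:
  assumes "edge e" "edge f" "cpb e f" "deg \<Lambda> e \<noteq> deg \<Lambda> f"
  obtains f' e' where "square e f f' e'"
proof -
  have d: "deg \<Lambda> (e \<cdot> f) = deg \<Lambda> f + deg \<Lambda> e"
    using assms by (simp add: add.commute)
  obtain f' e' where *: "cpb f' e'" "e \<cdot> f = f' \<cdot> e'" "deg \<Lambda> f' = deg \<Lambda> f" "deg \<Lambda> e' = deg \<Lambda> e"
    using factorization[OF cpb_comp(1)[OF assms(3)] d] by blast
  have "edge f'" "edge e'"
    using assms(1,2) * cpb_arrow edgeI edge_degree by metis+
  then show thesis
    using * assms that unfolding square_def by metis
qed

text \<open>Comparing degrees, x must contain an edge of the colour of f, which can be moved to its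
  front as g. Flipping e past g gives a first edge of the colour of f, and by unique factorization
  this is f.\<close>

lemma square_of_two_prefixes:
  assumes "edge e" "edge f" "cpb e x" "cpb f y" "e \<cdot> x = f \<cdot> y" "deg \<Lambda> e \<noteq> deg \<Lambda> f"
  obtains g h z where "square e g f h" "cpb g z" "cpb h z" "x = g \<cdot> z" "y = h \<cdot> z"
proof -
  obtain i where i: "deg \<Lambda> e = generator i" "i \<in> indices k"
    using assms(1) edge_degree by blast
  obtain j where j: "deg \<Lambda> f = generator j" "j \<in> indices k"
    using assms(2) edge_degree by blast
  have dd: "generator i + deg \<Lambda> x = generator j + deg \<Lambda> y"
    using assms(5) cpb_comp(4)[OF assms(3)] cpb_comp(4)[OF assms(4)] i j by simp
  have "i \<noteq> j" using i j assms(6) by auto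
  then have "Poly_Mapping.lookup (deg \<Lambda> x) j > 0"
    using arg_cong[OF dd, of "\<lambda>p. Poly_Mapping.lookup p j"]
    by (simp add: lookup_add lookup_single)
  then obtain q where q: "deg \<Lambda> x = generator j + q"
    using split_generator by blast
  obtain g z where g: "cpb g z" "x = g \<cdot> z" "deg \<Lambda> g = generator j" "deg \<Lambda> z = q"
    using factorization[OF cpb_arrow(2)[OF assms(3)] q] by blast
  have eg: "cpb e g"
    using assms(3) cpb_comp_right[OF g(1)] g(2) by simp
  have "edge g"
    using g(1,3) cpb_arrow edgeI by blast
  moreover have "deg \<Lambda> e \<noteq> deg \<Lambda> g"
    using \<open>i \<noteq> j\<close> i g by (metis generator_eq_iff)
  ultimately obtain f' h where sq: "square e g f' h"
    using square_exists[OF assms(1) _ eg] by blast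
  note sqD = squareD[OF sq]
  have hz: "cpb h z"
    using square_ends(2)[OF sq] g(1) edge_arrow[OF sqD(4)] unfolding cpb_def by simp
  have f'hz: "cpb f' (h \<cdot> z)"
    using sqD(6) hz by simp
  have "f' \<cdot> (h \<cdot> z) = (f' \<cdot> h) \<cdot> z"
    using assoc[OF sqD(6) hz] by simp
  also have "\<dots> = (e \<cdot> g) \<cdot> z"
    using sqD(7) by simp
  also have "\<dots> = f \<cdot> y"
    using assoc[OF eg g(1)] g(2) assms(5) by simp
  finally have eq: "f' \<cdot> (h \<cdot> z) = f \<cdot> y" .
  have "deg \<Lambda> f' = deg \<Lambda> f"
    using sqD(9) g j by simp
  from edge_unique[OF f'hz assms(4) eq this] show thesis
    using that sq g hz by blast
qed

section \<open>Labellings of paths\<close>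

abbreviation rid :: "'e \<Rightarrow> 'e" where "rid x \<equiv> ident \<Lambda> (rng \<Lambda> x)"
abbreviation sid :: "'e \<Rightarrow> 'e" where "sid x \<equiv> ident \<Lambda> (source \<Lambda> x)"

definition prefix :: "'e \<Rightarrow> 'e \<Rightarrow> bool" where
  "prefix x w \<longleftrightarrow> (\<exists>y. cpb x y \<and> w = x \<cdot> y)"

text \<open>A pair \<open>(x, e)\<close> stands for the occurrence of \<open>e\<close> after the initial segment \<open>x\<close>; a vertex
  occurs as its identity.\<close>

definition cells :: "'e \<Rightarrow> ('e \<times> 'e) set" where
  "cells w = {(x, e). (vertex e \<or> edge e) \<and> cpb x e \<and> prefix (x \<cdot> e) w}"

lemma cpb_rid_sid: "cpb x y \<Longrightarrow> sid x = rid y"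
  by (simp add: cpb_def)

lemma vertex_rid [simp]: "x \<in> arrows \<Longrightarrow> vertex (rid x)"
  and vertex_sid [simp]: "x \<in> arrows \<Longrightarrow> vertex (sid x)"
  by (simp_all add: rng_obj source_obj)

lemma rid_comp [simp]: "cpb x y \<Longrightarrow> rid (x \<cdot> y) = rid x"
  and sid_comp [simp]: "cpb x y \<Longrightarrow> sid (x \<cdot> y) = sid y"
  by simp_all

lemma rid_vertex: "vertex x \<Longrightarrow> rid x = x" and sid_vertex: "vertex x \<Longrightarrow> sid x = x"
  using vertexD by simp_all

lemma rid_rid [simp]: "x \<in> arrows \<Longrightarrow> rng \<Lambda> (rid x) = rng \<Lambda> x"
  and sid_rid [simp]: "x \<in> arrows \<Longrightarrow> source \<Lambda> (rid x) = rng \<Lambda> x"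
  and rid_sid [simp]: "x \<in> arrows \<Longrightarrow> rng \<Lambda> (sid x) = source \<Lambda> x"
  and sid_sid [simp]: "x \<in> arrows \<Longrightarrow> source \<Lambda> (sid x) = source \<Lambda> x"
  by (simp_all add: rng_ident source_ident rng_obj source_obj)

lemma vertex_prefix_factor: "cpb x y \<Longrightarrow> vertex (x \<cdot> y) \<Longrightarrow> vertex x"
  using cpb_arrow by (metis add_is_0 lookup_add lookup_zero poly_mapping_eqI cpb_comp(4) vertex_iff_degree_0)

lemma edge_comp_not_vertex: "edge e \<Longrightarrow> cpb e y \<Longrightarrow> \<not> vertex (e \<cdot> y)"
  using vertex_prefix_factor edge_not_vertex by blast

text \<open>Cancellation of the common initial segment x. It lets labels on a remainder be read as
  labels on the whole path.\<close>

lemma cells_shift: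
  assumes "cpb x y" "cpb x u"
  shows "(x \<cdot> u, e) \<in> cells (x \<cdot> y) \<longleftrightarrow> (u, e) \<in> cells y"
proof
  assume "(x \<cdot> u, e) \<in> cells (x \<cdot> y)"
  then obtain t where t: "vertex e \<or> edge e" "cpb (x \<cdot> u) e" "cpb ((x \<cdot> u) \<cdot> e) t" "x \<cdot> y = ((x \<cdot> u) \<cdot> e) \<cdot> t"
    unfolding cells_def prefix_def by auto
  have ue: "cpb u e" using t(2) assms(2) by simp
  have et: "cpb e t" using t(3) cpb_comp_left[OF t(2)] by simp
  have "x \<cdot> y = x \<cdot> (u \<cdot> (e \<cdot> t))"
    using t(4) assoc[OF t(2) et] assoc[of x u "e \<cdot> t"] assms(2) ue et by simp
  moreover have "cpb x (u \<cdot> (e \<cdot> t))"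
    using assms(2) ue et by simp
  ultimately have "y = u \<cdot> (e \<cdot> t)"
    using comp_left_cancel assms(1) by blast
  then have "y = (u \<cdot> e) \<cdot> t" "cpb (u \<cdot> e) t"
    using assoc ue et by simp_all
  then show "(u, e) \<in> cells y"
    unfolding cells_def prefix_def using t(1) ue by blast
next
  assume "(u, e) \<in> cells y"
  then obtain t where t: "vertex e \<or> edge e" "cpb u e" "cpb (u \<cdot> e) t" "y = (u \<cdot> e) \<cdot> t"
    unfolding cells_def prefix_def by auto
  have xue: "cpb (x \<cdot> u) e" "cpb e t" using t(2,3) assms(2) by simp_all
  have "x \<cdot> y = ((x \<cdot> u) \<cdot> e) \<cdot> t"
    using t(4) assoc[of x u e] assoc[of x "u \<cdot> e" t] t(2,3) assms(2) by simp
  moreover have "cpb ((x \<cdot> u) \<cdot> e) t"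
    using xue by simp
  ultimately show "(x \<cdot> u, e) \<in> cells (x \<cdot> y)"
    unfolding cells_def prefix_def using t(1) xue by blast
qed

lemma cells_prefix:
  assumes "cpb x y" "p \<in> cells x"
  shows "p \<in> cells (x \<cdot> y)"
proof -
  obtain u e t where t: "p = (u, e)" "vertex e \<or> edge e" "cpb u e" "cpb (u \<cdot> e) t" "x = (u \<cdot> e) \<cdot> t"
    using assms(2) unfolding cells_def prefix_def by auto
  have ty: "cpb t y" using assms(1) t(4,5) by simp
  then have "x \<cdot> y = (u \<cdot> e) \<cdot> (t \<cdot> y)" "cpb (u \<cdot> e) (t \<cdot> y)"
    using t(4,5) assoc by simp_all
  then show ?thesis
    unfolding cells_def prefix_def using t(1-3) by blast
qed

lemma prefix_refl: "w \<in> arrows \<Longrightarrow> prefix w w"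
  unfolding prefix_def using comp_ident(1) cpb_ident(1) by metis

lemma cells_ends:
  assumes "w \<in> arrows"
  shows "(rid w, rid w) \<in> cells w" "(w, sid w) \<in> cells w"
proof -
  have "cpb (rid w) (rid w)" "cpb (rid w) w"
    using assms cpb_def by simp_all
  then show "(rid w, rid w) \<in> cells w"
    unfolding cells_def prefix_def using assms by (auto simp: comp_vertex intro!: exI[of _ w])
  show "(w, sid w) \<in> cells w"
    unfolding cells_def using assms prefix_refl by simp
qed

lemma cells_first_edge:
  assumes "edge e" "cpb e y"
  shows "(rid e, e) \<in> cells (e \<cdot> y)"
  unfolding cells_def prefix_def using assms by auto

lemma cells_arrow: "(x, e) \<in> cells w \<Longrightarrow> cpb x e \<and> w \<in> arrows"
  unfolding cells_def prefix_def by auto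

lemma cells_edge_ends:
  assumes "(x, e) \<in> cells w"
  shows "(x, rid e) \<in> cells w" "(x \<cdot> e, sid e) \<in> cells w"
proof -
  obtain t where t: "vertex e \<or> edge e" "cpb x e" "cpb (x \<cdot> e) t" "w = (x \<cdot> e) \<cdot> t"
    using assms unfolding cells_def prefix_def by auto
  have et: "cpb e t" using t by simp
  note [simp] = cpb_arrow[OF t(2)] cpb_arrow[OF et]
  have x: "cpb x (rid e)" "x \<cdot> rid e = x"
    using t(2) comp_ident(1)[of x] by (simp_all add: cpb_def)
  moreover have "w = x \<cdot> (e \<cdot> t)" "cpb x (e \<cdot> t)"
    using assoc t et by simp_all
  ultimately show "(x, rid e) \<in> cells w"
    unfolding cells_def prefix_def by auto
  have "cpb (x \<cdot> e) (sid e)" "(x \<cdot> e) \<cdot> sid e = x \<cdot> e"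
    using t(2) comp_ident(1)[of "x \<cdot> e"] by simp_all
  then show "(x \<cdot> e, sid e) \<in> cells w"
    unfolding cells_def prefix_def using t by auto
qed

lemma cells_of_square:
  assumes "square e f f' e'" "cpb x e" "prefix (x \<cdot> (e \<cdot> f)) w"
  shows "(x, e) \<in> cells w" "(x \<cdot> e, f) \<in> cells w" "(x, f') \<in> cells w" "(x \<cdot> f', e') \<in> cells w"
proof -
  have gen: "(x, e) \<in> cells w \<and> (x \<cdot> e, f) \<in> cells w"
    if H: "square e f f' e'" "cpb x e" "prefix (x \<cdot> (e \<cdot> f)) w" for e f f' e'
  proof -
    note sqD = squareD[OF H(1)]
    obtain t where t: "cpb (x \<cdot> (e \<cdot> f)) t" "w = (x \<cdot> (e \<cdot> f)) \<cdot> t"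
      using H(3) unfolding prefix_def by blast
    have xef: "cpb x (e \<cdot> f)" and ft: "cpb f t"
      using H(2) sqD(5) t(1) by simp_all
    have 1: "w = (x \<cdot> e) \<cdot> (f \<cdot> t)" "cpb (x \<cdot> e) (f \<cdot> t)"
      using t(2) assoc[OF H(2) sqD(5)] assoc[of "x \<cdot> e" f t] H(2) sqD(5) ft by simp_all
    have 2: "w = ((x \<cdot> e) \<cdot> f) \<cdot> t" "cpb ((x \<cdot> e) \<cdot> f) t" "cpb (x \<cdot> e) f"
      using t(2) assoc[OF H(2) sqD(5)] H(2) sqD(5) ft by simp_all
    show ?thesis
      using 1 2 H(2) sqD(1,2) unfolding cells_def prefix_def by blast
  qed
  show "(x, e) \<in> cells w" "(x \<cdot> e, f) \<in> cells w"
    using gen[OF assms] by auto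
  note sqD = squareD[OF assms(1)]
  have "cpb x f'"
    using assms(2) square_ends[OF assms(1)] sqD(3) by (simp add: cpb_def)
  then show "(x, f') \<in> cells w" "(x \<cdot> f', e') \<in> cells w"
    using gen[OF square_sym[OF assms(1)]] assms(3) sqD(7) by simp_all
qed

text \<open>Apart from the vertex at the range, a cell is a first edge or lies behind one. A
  labelling is therefore known once the range label, the labels of all first edges and the
  labellings behind them are known.\<close>

lemma cells_cases:
  assumes "(x, e) \<in> cells w"
  obtains (vertex) "x = rid w" "e = rid w"
  | (edge) y where "x = rid w" "edge e" "cpb e y" "w = e \<cdot> y"
  | (step) f u y where "edge f" "cpb f u" "x = f \<cdot> u" "cpb f y" "w = f \<cdot> y" "(u, e) \<in> cells y"
proof -
  obtain t where t: "vertex e \<or> edge e" "cpb x e" "cpb (x \<cdot> e) t" "w = (x \<cdot> e) \<cdot> t"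
    using assms unfolding cells_def prefix_def by auto
  have et: "cpb e t" using t by simp
  have "x \<in> arrows" using t(2) cpb_arrow by blast
  then show thesis
  proof (cases rule: arrow_cases)
    case 1
    have xe: "x \<cdot> e = e" using comp_vertex(1)[OF 1 t(2)] .
    have w: "w = e \<cdot> t" using t xe by simp
    have x: "x = rid w" using cpb_vertex(1)[OF 1 t(2)] w et by simp
    from t(1) show thesis
    proof
      assume "vertex e"
      then have "e = rid w"
        using w et by (metis rid_comp rid_vertex)
      then show thesis using x that(1) by simp
    next
      assume "edge e"
      then show thesis using that(2)[OF x _ et w] by simp
    qed
  next
    case (2 f u)
    have ue: "cpb u e" using t(2) 2 by simp
    have "w = f \<cdot> (u \<cdot> e \<cdot> t)" "cpb f (u \<cdot> e \<cdot> t)"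
      using t(3,4) 2 ue et assoc by simp_all
    moreover have "(u, e) \<in> cells (u \<cdot> e \<cdot> t)"
      unfolding cells_def prefix_def using ue t(1) et by auto
    ultimately show thesis
      using that(3) 2 by blast
  qed
qed

text \<open>Two different first edges always span an initial square, so data given separately for
  each first edge can be patched by checking compatibility along squares.\<close>

lemma two_first_edges:
  assumes "edge e" "edge f" "cpb e x" "cpb f y" "e \<cdot> x = f \<cdot> y"
  obtains (same) "e = f" "x = y"
  | (square) g h z where "square e g f h" "cpb g z" "cpb h z" "x = g \<cdot> z" "y = h \<cdot> z"
  using assms square_of_two_prefixes edge_unique by metis

end

text \<open>\<open>sq e f f' e' a b b' a'\<close> is meant for a commuting square \<open>e \<cdot> f = f' \<cdot> e'\<close>; the labels come in the
  order of the edges.\<close>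

locale labelled_kgraph = topological_kgraph k \<Gamma> for k and \<Gamma> :: "('v, 'e) kgraph_data" +
  fixes Z :: "'z set" and lr ls :: "'e \<Rightarrow> 'z \<Rightarrow> 'z"
    and sq :: "'e \<Rightarrow> 'e \<Rightarrow> 'e \<Rightarrow> 'e \<Rightarrow> 'z \<Rightarrow> 'z \<Rightarrow> 'z \<Rightarrow> 'z \<Rightarrow> bool"
  assumes lr_closed: "edge e \<Longrightarrow> a \<in> Z \<Longrightarrow> lr e a \<in> Z"
    and ls_closed: "edge e \<Longrightarrow> a \<in> Z \<Longrightarrow> ls e a \<in> Z"
    and sq_closed: "square e f f' e' \<Longrightarrow> sq e f f' e' a b b' a' \<Longrightarrow> a \<in> Z \<and> b \<in> Z \<and> b' \<in> Z \<and> a' \<in> Z"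
    and sq_ends: "square e f f' e' \<Longrightarrow> sq e f f' e' a b b' a' \<Longrightarrow>
      ls e a = lr f b \<and> lr f' b' = lr e a \<and> ls e' a' = ls f b"
    and sq_sym: "square e f f' e' \<Longrightarrow> sq e f f' e' a b b' a' \<Longrightarrow> sq f' e' e f b' a' a b"
    and sq_exists: "square e f f' e' \<Longrightarrow> a \<in> Z \<Longrightarrow> b \<in> Z \<Longrightarrow> ls e a = lr f b \<Longrightarrow> \<exists>b' a'. sq e f f' e' a b b' a'"
    and sq_unique: "square e f f' e' \<Longrightarrow> sq e f f' e' a b b1 a1 \<Longrightarrow> sq e f f' e' a b b2 a2 \<Longrightarrow> b1 = b2 \<and> a1 = a2"
    and hexagon:
      "square e g f e1 \<Longrightarrow> square g p q g1 \<Longrightarrow> square e q f2 e2 \<Longrightarrow> square e1 p h e3 \<Longrightarrow>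
       square e2 g1 h2 e3 \<Longrightarrow> square f h f2 h2 \<Longrightarrow>
       sq e g f e1 a x b a1 \<Longrightarrow> sq g p q g1 x y v x1 \<Longrightarrow> sq e q f2 e2 a v b2 a2 \<Longrightarrow>
       sq e1 p h e3 a1 y c a3 \<Longrightarrow> sq e2 g1 h2 e3 a2 x1 c2 a4 \<Longrightarrow>
       a3 = a4 \<and> sq f h f2 h2 b c b2 c2"
begin

notation comp_infix (infixl "\<cdot>" 70)

text \<open>The value \<open>undefined\<close> off the cells makes equality of labellings an
  equality of functions. Vertices carry labels too: these are the only labels of a trivial path and
  the data on which composable labellings are matched.\<close>

definition labelling :: "'e \<Rightarrow> ('e \<times> 'e \<Rightarrow> 'z) \<Rightarrow> bool" where
  "labelling w z \<longleftrightarrow>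
     (\<forall>p. p \<notin> cells w \<longrightarrow> z p = undefined) \<and> (\<forall>p\<in>cells w. z p \<in> Z) \<and>
     (\<forall>x e. edge e \<longrightarrow> (x, e) \<in> cells w \<longrightarrow>
        lr e (z (x, e)) = z (x, rid e) \<and> ls e (z (x, e)) = z (x \<cdot> e, sid e)) \<and>
     (\<forall>x e f f' e'. square e f f' e' \<longrightarrow> cpb x e \<longrightarrow> prefix (x \<cdot> (e \<cdot> f)) w \<longrightarrow>
        sq e f f' e' (z (x, e)) (z (x \<cdot> e, f)) (z (x, f')) (z (x \<cdot> f', e')))"

section \<open>Restriction of labellings to initial segments and remainders\<close>

definition front :: "'e \<Rightarrow> ('e \<times> 'e \<Rightarrow> 'z) \<Rightarrow> 'e \<times> 'e \<Rightarrow> 'z" where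
  "front x z = (\<lambda>p. if p \<in> cells x then z p else undefined)"

definition rear :: "'e \<Rightarrow> 'e \<Rightarrow> ('e \<times> 'e \<Rightarrow> 'z) \<Rightarrow> 'e \<times> 'e \<Rightarrow> 'z" where
  "rear x y z = (\<lambda>(u, e). if (u, e) \<in> cells y then z (x \<cdot> u, e) else undefined)"

lemma labellingD:
  assumes "labelling w z"
  shows "p \<notin> cells w \<Longrightarrow> z p = undefined" "p \<in> cells w \<Longrightarrow> z p \<in> Z"
    "edge e \<Longrightarrow> (x, e) \<in> cells w \<Longrightarrow> lr e (z (x, e)) = z (x, rid e)"
    "edge e \<Longrightarrow> (x, e) \<in> cells w \<Longrightarrow> ls e (z (x, e)) = z (x \<cdot> e, sid e)"
    "square e f f' e' \<Longrightarrow> cpb x e \<Longrightarrow> prefix (x \<cdot> (e \<cdot> f)) w \<Longrightarrow>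
        sq e f f' e' (z (x, e)) (z (x \<cdot> e, f)) (z (x, f')) (z (x \<cdot> f', e'))"
  using assms unfolding labelling_def by blast+

lemma labelling_first_square:
  assumes "labelling w z" "square e f f' e'" "cpb (e \<cdot> f) y" "w = (e \<cdot> f) \<cdot> y"
  shows "sq e f f' e' (z (rid e, e)) (z (e, f)) (z (rid f', f')) (z (f', e'))"
proof -
  note sqD = squareD[OF assms(2)]
  have [simp]: "rng \<Gamma> f' = rng \<Gamma> e" using square_ends[OF assms(2)] by simp
  have "cpb (rid e) (e \<cdot> f)"
    using sqD(1,5) by simp
  then have "prefix (rid e \<cdot> (e \<cdot> f)) w"
    using comp_vertex(1)[of "rid e" "e \<cdot> f"] assms(3,4) edge_arrow[OF sqD(1)] vertex_rid
    unfolding prefix_def by metis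
  then show ?thesis
    using labellingD(5)[OF assms(1,2), of "rid e"] comp_ident(2)[of f'] sqD by simp
qed

lemma labelling_front:
  assumes "cpb x y" "labelling (x \<cdot> y) z"
  shows "labelling x (front x z)"
proof -
  have eq: "front x z p = z p" if "p \<in> cells x" for p
    using that by (simp add: front_def)
  note D = labellingD[OF assms(2)] and C = cells_prefix[OF assms(1)]
  have pre: "prefix u (x \<cdot> y)" if "prefix u x" for u
    using that assms(1) unfolding prefix_def by (metis assoc cpb_comp_left cpb_comp_right)
  show ?thesis
    unfolding labelling_def
  proof (intro conjI allI ballI impI)
    fix p assume "p \<notin> cells x" then show "front x z p = undefined" by (simp add: front_def)
  next
    fix p assume "p \<in> cells x" then show "front x z p \<in> Z" using eq D(2) C by simp
  next
    fix u e assume *: "edge e" "(u, e) \<in> cells x"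
    note ** = cells_edge_ends[OF *(2)]
    show "lr e (front x z (u, e)) = front x z (u, rid e)"
      using eq[OF *(2)] eq[OF **(1)] D(3)[OF *(1) C[OF *(2)]] by simp
    show "ls e (front x z (u, e)) = front x z (u \<cdot> e, sid e)"
      using eq[OF *(2)] eq[OF **(2)] D(4)[OF *(1) C[OF *(2)]] by simp
  next
    fix u e f f' e' assume *: "square e f f' e'" "cpb u e" "prefix (u \<cdot> (e \<cdot> f)) x"
    note cs = cells_of_square[OF *]
    show "sq e f f' e' (front x z (u, e)) (front x z (u \<cdot> e, f)) (front x z (u, f')) (front x z (u \<cdot> f', e'))"
      using D(5)[OF *(1,2) pre[OF *(3)]] eq[OF cs(1)] eq[OF cs(2)] eq[OF cs(3)] eq[OF cs(4)] by simp
  qed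
qed

lemma labelling_rear:
  assumes "cpb x y" "labelling (x \<cdot> y) z"
  shows "labelling y (rear x y z)"
proof -
  have eq: "rear x y z (u, e) = z (x \<cdot> u, e)" if "(u, e) \<in> cells y" for u e
    using that by (simp add: rear_def)
  note D = labellingD[OF assms(2)]
  have xu: "cpb x u" if "prefix u y" for u
    using that assms(1) unfolding prefix_def by (auto simp: cpb_def)
  have xu': "cpb x u" if "(u, e) \<in> cells y" for u e
    using that assms(1) xu unfolding cells_def by (auto simp: cpb_def)
  have C: "(x \<cdot> u, e) \<in> cells (x \<cdot> y)" if "(u, e) \<in> cells y" for u e
    using that cells_shift[OF assms(1) xu'[OF that]] by simp
  show ?thesis
    unfolding labelling_def
  proof (intro conjI allI ballI impI)
    fix p assume "p \<notin> cells y" then show "rear x y z p = undefined" by (auto simp: rear_def split: prod.splits)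
  next
    fix p assume "p \<in> cells y" then show "rear x y z p \<in> Z" using eq D(2) C by (cases p) simp
  next
    fix u e assume *: "edge e" "(u, e) \<in> cells y"
    note ** = cells_edge_ends[OF *(2)]
    have ue: "cpb u e" using *(2) cells_arrow by blast
    show "lr e (rear x y z (u, e)) = rear x y z (u, rid e)"
      using eq[OF *(2)] eq[OF **(1)] D(3)[OF *(1) C[OF *(2)]] by simp
    show "ls e (rear x y z (u, e)) = rear x y z (u \<cdot> e, sid e)"
      using eq[OF *(2)] eq[OF **(2)] D(4)[OF *(1) C[OF *(2)]] assoc[OF xu'[OF *(2)] ue] by simp
  next
    fix u e f f' e' assume *: "square e f f' e'" "cpb u e" "prefix (u \<cdot> (e \<cdot> f)) y"
    note cs = cells_of_square[OF *] and sqD = squareD[OF *(1)]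
    have u: "cpb x u" using xu' cs(1) by blast
    have uf': "cpb u f'" using *(2) square_ends[OF *(1)] sqD(3) by (simp add: cpb_def)
    have "prefix ((x \<cdot> u) \<cdot> (e \<cdot> f)) (x \<cdot> y)"
    proof -
      obtain t where t: "cpb (u \<cdot> (e \<cdot> f)) t" "y = (u \<cdot> (e \<cdot> f)) \<cdot> t"
        using *(3) unfolding prefix_def by blast
      have eft: "cpb u (e \<cdot> f)" using *(2) sqD(5) by simp
      have "x \<cdot> y = ((x \<cdot> u) \<cdot> (e \<cdot> f)) \<cdot> t"
        using t assoc[of x "u \<cdot> (e \<cdot> f)" t] assoc[OF u eft] u eft by simp
      moreover have "cpb ((x \<cdot> u) \<cdot> (e \<cdot> f)) t"
        using t(1) cpb_comp_left[OF eft] cpb_comp_left[of "x \<cdot> u" "e \<cdot> f"] u eft by simp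
      ultimately show ?thesis unfolding prefix_def by blast
    qed
    from D(5)[OF *(1) _ this]
    show "sq e f f' e' (rear x y z (u, e)) (rear x y z (u \<cdot> e, f)) (rear x y z (u, f')) (rear x y z (u \<cdot> f', e'))"
      using eq[OF cs(1)] eq[OF cs(2)] eq[OF cs(3)] eq[OF cs(4)] u *(2) assoc[OF u *(2)] assoc[OF u uf'] by simp
  qed
qed

lemma rear_rear:
  assumes "cpb x y" "cpb y v"
  shows "rear y v (rear x (y \<cdot> v) z) = rear (x \<cdot> y) v z"
proof (intro ext)
  fix p :: "'e \<times> 'e"
  obtain u e where p: "p = (u, e)" by (cases p)
  show "rear y v (rear x (y \<cdot> v) z) p = rear (x \<cdot> y) v z p"
  proof (cases "(u, e) \<in> cells v")
    case True
    then have yu: "cpb y u"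
      using assms(2) unfolding cells_def prefix_def by (auto simp: cpb_def)
    then show ?thesis
      using True cells_shift[OF assms(2) yu] assoc[OF assms(1) yu] p by (simp add: rear_def)
  qed (simp add: rear_def p)
qed

lemma rear_apply:
  assumes "(u, e) \<in> cells y"
  shows "rear x y z (u, e) = z (x \<cdot> u, e)"
  using assms by (simp add: rear_def)

lemma rear_first:
  assumes "cpb x y" "edge e" "cpb e t" "y = e \<cdot> t"
  shows "rear x y z (rid e, e) = z (x, e)"
proof -
  have "x \<cdot> rid e = x"
    using comp_ident(1)[of x] cpb_rid_sid[OF assms(1)] assms by (simp add: cpb_def)
  then show ?thesis
    using rear_apply[of "rid e" e y] cells_first_edge[OF assms(2,3)] assms(4) by simp
qed

lemma rear_range:
  assumes "cpb x y"
  shows "rear x y z (rid y, rid y) = z (x, sid x)"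
proof -
  have "x \<cdot> rid y = x"
    using comp_ident(1)[of x] cpb_rid_sid[OF assms(1)] assms by (simp add: cpb_def)
  then show ?thesis
    using rear_apply[of "rid y" "rid y" y] cells_ends(1)[of y] assms
    by (simp add: cpb_arrow cpb_rid_sid[OF assms])
qed

lemma rear_source:
  assumes "cpb x y"
  shows "rear x y z (y, sid y) = z (x \<cdot> y, sid y)"
  using assms by (simp add: rear_apply cells_ends(2) cpb_arrow)

section \<open>Putting one edge in front of a labelled path\<close>

lemma labelling_ext:
  assumes "labelling w z" "labelling w z'" "\<And>x e. (x, e) \<in> cells w \<Longrightarrow> z (x, e) = z' (x, e)"
  shows "z = z'"
proof
  fix p :: "'e \<times> 'e"
  show "z p = z' p"
    using assms(3) labellingD(1)[OF assms(1)] labellingD(1)[OF assms(2)] by (cases p) metis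
qed

text \<open>A first edge f other than l spans a square with l. Two adjacent labels of this square
  are known, so \<open>sq_unique\<close> fixes the labels of f and of the edge h behind it; what
  lies behind f then follows by induction on the length of x.\<close>

lemma edge_fill_unique:
  assumes "edge l" "cpb l x" "labelling (l \<cdot> x) z" "labelling (l \<cdot> x) z'"
    and "z (rid l, l) = z' (rid l, l)" "rear l x z = rear l x z'"
  shows "z = z'"
  using assms
proof (induction "total_degree (deg \<Gamma> x)" arbitrary: l x z z' rule: less_induct)
  case less
  note l = less.prems(1) and lx = less.prems(2) and z = less.prems(3) and z' = less.prems(4)
    and eqf = less.prems(5) and eqr = less.prems(6)
  note D = labellingD[OF z] and D' = labellingD[OF z']
  \<comment> \<open>Comparing the labellings at every first edge and behind it reaches every cell
    except the range vertex, whose label is determined by that of l.\<close>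
  have key: "z (rid f, f) = z' (rid f, f) \<and> rear f y z = rear f y z'"
    if f: "edge f" "cpb f y" "l \<cdot> x = f \<cdot> y" for f y
    using l f(1) lx f(2,3)
  proof (cases rule: two_first_edges)
    case same
    then show ?thesis using eqf eqr by simp
  next
    case (square g h t)
    note s = squareD[OF square(1)]
    have w: "l \<cdot> x = (l \<cdot> g) \<cdot> t" "cpb (l \<cdot> g) t"
      using assoc[OF s(5) square(2)] square s by simp_all
    have lg: "z (l, g) = z' (l, g)"
      using rear_first[OF lx s(2) square(2,4)] eqr by metis
    have "sq l g f h (z (rid l, l)) (z (l, g)) (z (rid f, f)) (z (f, h))"
      by (rule labelling_first_square[OF z square(1) w(2,1)])
    moreover have "sq l g f h (z (rid l, l)) (z (l, g)) (z' (rid f, f)) (z' (f, h))"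
      using labelling_first_square[OF z' square(1) w(2,1)] eqf lg by simp
    ultimately have eq: "z (rid f, f) = z' (rid f, f)" "z (f, h) = z' (f, h)"
      using sq_unique[OF square(1)] by blast+
    have "rear f y z = rear f y z'"
    proof -
      \<comment> \<open>The remainder behind f is \<open>h \<cdot> t\<close>, and t is shorter than
        x.\<close>
      have smaller: "total_degree (deg \<Gamma> t) < total_degree (deg \<Gamma> x)"
        using total_degree_edge_comp[OF s(2) square(2)] square(4) by simp
      have lab: "labelling (h \<cdot> t) (rear f y z)" "labelling (h \<cdot> t) (rear f y z')"
        using labelling_rear[OF f(2)] z z' f(3) square(5) by simp_all
      have 1: "rear f y z (rid h, h) = rear f y z' (rid h, h)"
        using rear_first[OF f(2) s(4) square(3,5)] eq(2) by simp
      \<comment> \<open>Since \<open>f \<cdot> h\<close> and \<open>l \<cdot> g\<close> are the same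
        initial segment, the labels behind h are those behind g in the given labelling of x.\<close>
      have 2: "rear h t (rear f y u) = rear g t (rear l x u)" for u
        using rear_rear[OF s(6) square(3)] rear_rear[OF s(5) square(2)] square(4,5) s(7) by simp
      show ?thesis
        using less.hyps[OF smaller s(4) square(3) lab 1] 2 eqr by simp
    qed
    then show ?thesis using eq by simp
  qed
  show "z = z'"
  proof (rule labelling_ext[OF z z'])
    fix u e assume c: "(u, e) \<in> cells (l \<cdot> x)"
    then show "z (u, e) = z' (u, e)"
    proof (cases rule: cells_cases)
      case vertex
      have "(rid l, l) \<in> cells (l \<cdot> x)" by (rule cells_first_edge[OF l lx])
      then have "z (rid l, rid l) = z' (rid l, rid l)"
        using D(3)[OF l] D'(3)[OF l] eqf by metis
      then show ?thesis
        using vertex lx by simp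
    next
      case (edge y)
      then have "rng \<Gamma> (l \<cdot> x) = rng \<Gamma> e" by simp
      then show ?thesis
        using key[OF edge(2,3,4)] edge(1) by simp
    next
      case (step f v y)
      then show ?thesis
        using key[OF step(1,4,5)] rear_apply[OF step(6)] by metis
    qed
  qed
qed

text \<open>A labelling of \<open>l \<cdot> x\<close> amounts to a label for every first edge f and
  a labelling behind it, compatible wherever two first edges overlap. For f = l these are a and z;
  otherwise l is flipped across the square it spans with f, and induction supplies the labels behind
  the flipped edge. Compatibility of two such choices concerns the cube spanned by l and both first
  edges, and this is where \<open>hexagon\<close> enters.\<close>

lemma edge_fill_exists:
  assumes "edge l" "cpb l x" "labelling x z" "a \<in> Z" "ls l a = z (rid x, rid x)"
  shows "\<exists>y. labelling (l \<cdot> x) y \<and> y (rid l, l) = a \<and> rear l x y = z"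
  using assms
proof (induction "total_degree (deg \<Gamma> x)" arbitrary: l x z a rule: less_induct)
  case less
  note l = less.prems(1) and lx = less.prems(2) and z = less.prems(3) and a = less.prems(4,5)
  note D = labellingD[OF z]
  define w where "w = l \<cdot> x"
  have w [simp]: "w \<in> arrows" "rid w = rid l" "sid w = sid x"
    using lx by (simp_all add: w_def)
  define first where "first f y \<longleftrightarrow> edge f \<and> cpb f y \<and> w = f \<cdot> y" for f y
  have firstD: "edge f" "cpb f y" "w = f \<cdot> y" "rid f = rid l" "rng \<Gamma> f = rng \<Gamma> l" if "first f y" for f y
    using that cpb_comp(2)[OF lx] cpb_comp(2)[of f y] unfolding first_def w_def by auto
  (* b is the label of the first edge f of w obtained by flipping l past an edge of x,
     and u is the labelling of the remaining path y given by the induction hypothesis *)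
  define G where "G f y b u \<longleftrightarrow> f = l \<and> y = x \<and> b = a \<and> u = z \<or>
    (\<exists>g h t a'. square l g f h \<and> cpb g t \<and> cpb h t \<and> x = g \<cdot> t \<and> y = h \<cdot> t \<and>
       sq l g f h a (z (rid g, g)) b a' \<and> labelling y u \<and> u (rid h, h) = a' \<and> rear h t u = rear g t z)"
    for f y b u
  have "\<exists>b u. G f y b u" if "first f y" for f y
    using l firstD(1)[OF that] lx firstD(2,3)[OF that, unfolded w_def]
  proof (cases rule: two_first_edges)
    case same
    then show ?thesis unfolding G_def by blast
  next
    case (square g h t)
    note s = squareD[OF square(1)]
    have c: "(rid g, g) \<in> cells x"
      using cells_first_edge s(2) square(2,4) by simp
    have "ls l a = lr g (z (rid g, g))"
      using a(2) D(3)[OF s(2) c] square(2,4) by simp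
    then obtain b a' where sq: "sq l g f h a (z (rid g, g)) b a'"
      using sq_exists[OF square(1) a(1) D(2)[OF c]] by blast
    have "ls g (z (rid g, g)) = z (g, sid g)"
      using D(4)[OF s(2) c] edge_arrow[OF s(2)] by simp
    then have "ls h a' = rear g t z (rid t, rid t)"
      using sq_ends[OF square(1) sq] rear_range[OF square(2)] by simp
    moreover have "total_degree (deg \<Gamma> t) < total_degree (deg \<Gamma> x)"
      using total_degree_edge_comp[OF s(2) square(2)] square(4) by simp
    moreover have "labelling t (rear g t z)"
      using labelling_rear[OF square(2)] z square(4) by simp
    moreover have "a' \<in> Z"
      using sq_closed[OF square(1) sq] by simp
    ultimately obtain u where "labelling (h \<cdot> t) u" "u (rid h, h) = a'" "rear h t u = rear g t z"
      using less.hyps[OF _ s(4) square(3)] by blast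
    then show ?thesis
      unfolding G_def using square sq by blast
  qed
  then obtain B U where BU: "\<And>f y. first f y \<Longrightarrow> G f y (B f y) (U f y)"
    by metis
  have labU: "labelling y (U f y)" and B: "B f y \<in> Z" and lsB: "ls f (B f y) = U f y (rid y, rid y)"
    and lrB: "lr f (B f y) = lr l a" if fy: "first f y" for f y
  proof -
    have "labelling y (U f y) \<and> B f y \<in> Z \<and> ls f (B f y) = U f y (rid y, rid y) \<and> lr f (B f y) = lr l a"
      using BU[OF fy] unfolding G_def
    proof (elim disjE exE conjE)
      fix g h t a' assume *: "square l g f h" "cpb g t" "cpb h t" "x = g \<cdot> t" "y = h \<cdot> t"
        "sq l g f h a (z (rid g, g)) (B f y) a'" "labelling y (U f y)" "U f y (rid h, h) = a'"
      note s = squareD[OF *(1)]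
      have c: "(rid h, h) \<in> cells y"
        using cells_first_edge[OF s(4) *(3)] *(5) by simp
      have "ls f (B f y) = lr h a'"
        using sq_ends[OF square_sym[OF *(1)] sq_sym[OF *(1) *(6)]] by simp
      also have "\<dots> = U f y (rid y, rid y)"
        using labellingD(3)[OF *(7) s(4) c] *(3,5,8) by simp
      finally show ?thesis
        using *(7) sq_closed[OF *(1,6)] sq_ends[OF *(1,6)] by simp
    qed (use z a in simp)
    then show "labelling y (U f y)" "B f y \<in> Z" "ls f (B f y) = U f y (rid y, rid y)" "lr f (B f y) = lr l a"
      by auto
  qed
  have firstl: "first l x"
    using l lx by (simp add: first_def w_def)
  \<comment> \<open>For f = l only the first alternative of \<open>G\<close> is possible, because
    the two first edges of a square have different degrees.\<close>
  have Gl: "B l y = a \<and> U l y = z \<and> y = x" if "first l y" for y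
  proof -
    have False if "square l g l h" for g h
      using squareD(9,10)[OF that] by simp
    then show ?thesis
      using BU[OF that] unfolding G_def by blast
  qed
  \<comment> \<open>Overlap with l itself: the labels for f were defined by this very square, up to
    identifying its edges by unique factorization.\<close>
  have keyl: "rear h t (U l x) = rear h2 t (U f y) \<and>
      sq l h f h2 (B l x) (U l x (rid h, h)) (B f y) (U f y (rid h2, h2))"
    if fy: "first f y" and sqr: "square l h f h2" and t: "cpb h t" "cpb h2 t" "x = h \<cdot> t" "y = h2 \<cdot> t" for f y h h2 t
    using BU[OF fy] unfolding G_def
  proof (elim disjE exE conjE)
    assume "f = l" then show ?thesis using squareD(9,10)[OF sqr] by simp
  next
    fix g h' t' a' assume *: "square l g f h'" "cpb g t'" "cpb h' t'" "x = g \<cdot> t'" "y = h' \<cdot> t'"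
        "sq l g f h' a (z (rid g, g)) (B f y) a'" "labelling y (U f y)" "U f y (rid h', h') = a'"
        "rear h' t' (U f y) = rear g t' z"
    have gt: "g \<cdot> t' = h \<cdot> t" and ht: "h' \<cdot> t' = h2 \<cdot> t"
      using *(4,5) t(3,4) by simp_all
    have "deg \<Gamma> g = deg \<Gamma> h" "deg \<Gamma> h' = deg \<Gamma> h2"
      using squareD(8,9)[OF *(1)] squareD(8,9)[OF sqr] by simp_all
    then have "g = h" "t' = t" "h' = h2"
      using edge_unique[OF *(2) t(1) gt] edge_unique[OF *(3) t(2) ht] by blast+
    then show ?thesis
      using *(6,8,9) Gl[OF firstl] by simp
  qed
  \<comment> \<open>Compatibility for any two first edges f and f2: their labels and those of the
    edges behind them fit into the square, and the labellings agree beyond it.\<close>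
  have key: "rear h t (U f y) = rear h2 t (U f2 y2) \<and>
      sq f h f2 h2 (B f y) (U f y (rid h, h)) (B f2 y2) (U f2 y2 (rid h2, h2))"
    if fy: "first f y" and fy2: "first f2 y2" and sqr: "square f h f2 h2"
      and t: "cpb h t" "cpb h2 t" "y = h \<cdot> t" "y2 = h2 \<cdot> t" for f y f2 y2 h h2 t
  proof (cases "f = l \<or> f2 = l")
    case True
    then show ?thesis
    proof
      assume "f = l"
      then show ?thesis using keyl[OF fy2 _ t(1,2) _ t(4)] sqr t(3) Gl fy by auto
    next
      assume f2: "f2 = l"
      then have y2: "y2 = x" using Gl fy2 by auto
      note sqr' = square_sym[OF sqr[unfolded f2]]
      note kl = keyl[OF fy sqr' t(2,1) t(4)[unfolded y2] t(3)]
      show ?thesis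
        using kl sq_sym[OF sqr' conjunct2[OF kl]] f2 y2 by simp
    qed
  next
    case False
    obtain g e1 s a1 where F: "square l g f e1" "cpb g s" "cpb e1 s" "x = g \<cdot> s" "y = e1 \<cdot> s"
        "sq l g f e1 a (z (rid g, g)) (B f y) a1" "labelling y (U f y)" "U f y (rid e1, e1) = a1"
        "rear e1 s (U f y) = rear g s z"
      using BU[OF fy] False unfolding G_def by auto
    obtain q e2 s2 a2 where F2: "square l q f2 e2" "cpb q s2" "cpb e2 s2" "x = q \<cdot> s2" "y2 = e2 \<cdot> s2"
        "sq l q f2 e2 a (z (rid q, q)) (B f2 y2) a2" "labelling y2 (U f2 y2)" "U f2 y2 (rid e2, e2) = a2"
        "rear e2 s2 (U f2 y2) = rear q s2 z"
      using BU[OF fy2] False unfolding G_def by auto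
    note S = squareD[OF F(1)] and S2 = squareD[OF F2(1)] and Sr = squareD[OF sqr]
    have "deg \<Gamma> g \<noteq> deg \<Gamma> q"
      using S(9) S2(9) Sr(9,10) by simp
    \<comment> \<open>The edges g and q, which follow l in its squares with f and f2, have different
      degrees and span a square of their own. Together with l they give the cube of the path
      \<open>l \<cdot> g \<cdot> p\<close>.\<close>
    then obtain p g1 r where P: "square g p q g1" "cpb p r" "cpb g1 r" "s = p \<cdot> r" "s2 = g1 \<cdot> r"
      using square_of_two_prefixes[OF S(2) S2(2) F(2) F2(2)] F(4) F2(4) by metis
    note SP = squareD[OF P(1)]
    have e1p: "cpb e1 p" and e2g1: "cpb e2 g1"
      using F(3) F2(3) P by simp_all
    have "deg \<Gamma> e1 \<noteq> deg \<Gamma> p"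
      using S(8) S2(9,10) SP(9) by simp
    then obtain h' e3 where H: "square e1 p h' e3"
      using square_exists[OF S(4) SP(2) e1p] by blast
    have "deg \<Gamma> e2 \<noteq> deg \<Gamma> g1"
      using S2(8) S(9,10) SP(8) by simp
    then obtain h2' e3' where H2: "square e2 g1 h2' e3'"
      using square_exists[OF S2(4) SP(4) e2g1] by blast
    note SH = squareD[OF H] and SH2 = squareD[OF H2]
    have e3r: "cpb e3 r" and e3r': "cpb e3' r"
      using square_ends(2)[OF H] square_ends(2)[OF H2] P(2,3) edge_arrow[OF SH(4)] edge_arrow[OF SH2(4)]
      unfolding cpb_def by simp_all
    have y: "y = h' \<cdot> (e3 \<cdot> r)" "cpb h' (e3 \<cdot> r)"
      using F(5) P(4) assoc[OF e1p P(2)] assoc[OF SH(6) e3r] SH(7) cpb_comp_right[OF e3r] SH(6) by metis+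
    have y2: "y2 = h2' \<cdot> (e3' \<cdot> r)" "cpb h2' (e3' \<cdot> r)"
      using F2(5) P(5) assoc[OF e2g1 P(3)] assoc[OF SH2(6) e3r'] SH2(7) cpb_comp_right[OF e3r'] SH2(6) by metis+
    have "deg \<Gamma> h = deg \<Gamma> h'" "deg \<Gamma> h2 = deg \<Gamma> h2'"
      using S(8,9) S2(9) Sr(8,9) SH(9) SP(8,9) SH2(9) by simp_all
    \<comment> \<open>Flipping e1 past p and e2 past g1 produces h' and h2'. Unique factorization
      identifies them with the edges h and h2 of the given square and so closes the cube.\<close>
    then have eq: "h = h'" "t = e3 \<cdot> r" "h2 = h2'" "t = e3' \<cdot> r"
      using edge_unique[OF t(1) y(2)] edge_unique[OF t(2) y2(2)] t(3,4) y(1) y2(1) by metis+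
    have "deg \<Gamma> e3 = deg \<Gamma> e3'"
      using S(8) S2(8) SH(8) SH2(8) by simp
    then have e33: "e3 = e3'"
      using edge_unique[OF e3r e3r'] eq(2,4) by metis
    have zsq: "sq g p q g1 (z (rid g, g)) (z (g, p)) (z (rid q, q)) (z (q, g1))"
      by (rule labelling_first_square[OF z P(1), of r])
        (use F(4) P(2,4) SP(5) assoc[OF SP(5) P(2)] in simp_all)
    have "U f y (e1, p) = rear e1 s (U f y) (rid p, p)"
      using rear_first[OF F(3) SP(2) P(2,4)] by simp
    also have "\<dots> = z (g, p)"
      using F(9) rear_first[OF F(2) SP(2) P(2,4)] by simp
    finally have Uf: "U f y (e1, p) = z (g, p)" .
    have "U f2 y2 (e2, g1) = rear e2 s2 (U f2 y2) (rid g1, g1)"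
      using rear_first[OF F2(3) SP(4) P(3,5)] by simp
    also have "\<dots> = z (q, g1)"
      using F2(9) rear_first[OF F2(2) SP(4) P(3,5)] by simp
    finally have Uf2: "U f2 y2 (e2, g1) = z (q, g1)" .
    have s4: "sq e1 p h' e3 a1 (z (g, p)) (U f y (rid h', h')) (U f y (h', e3))"
      using labelling_first_square[OF F(7) H, of r] F(8) Uf F(5) P(2,4) SH(5) assoc[OF SH(5) P(2)] by simp
    have s5: "sq e2 g1 h2' e3' a2 (z (q, g1)) (U f2 y2 (rid h2', h2')) (U f2 y2 (h2', e3'))"
      using labelling_first_square[OF F2(7) H2, of r] F2(8) Uf2 F2(5) P(3,5) SH2(5) assoc[OF SH2(5) P(3)] by simp
    have hex: "U f y (h, e3) = U f2 y2 (h2, e3) \<and>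
        sq f h f2 h2 (B f y) (U f y (rid h, h)) (B f2 y2) (U f2 y2 (rid h2, h2))"
      using hexagon[OF F(1) P(1) F2(1) _ _ sqr F(6) zsq F2(6), of e3] H H2 s4 s5 eq e33 by simp
    \<comment> \<open>Both remainders start with e3, which now has the same label in both, and
      beyond e3 both restrict to the given labelling z.\<close>
    have "rear h t (U f y) = rear h2 t (U f2 y2)"
    proof (rule edge_fill_unique[OF SH(4) e3r])
      show "labelling (e3 \<cdot> r) (rear h t (U f y))" "labelling (e3 \<cdot> r) (rear h2 t (U f2 y2))"
        using labelling_rear[OF t(1)] labelling_rear[OF t(2)] F(7) F2(7) t(3,4) eq(2) by simp_all
      show "rear h t (U f y) (rid e3, e3) = rear h2 t (U f2 y2) (rid e3, e3)"
        using rear_first[OF t(1) SH(4) e3r eq(2)] rear_first[OF t(2) SH(4) e3r eq(2)] hex by simp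
      have "rear e3 r (rear h t (U f y)) = rear (h \<cdot> e3) r (U f y)"
        using rear_rear[OF SH(6) e3r] eq by simp
      also have "\<dots> = rear p r (rear e1 s (U f y))"
        using rear_rear[OF e1p P(2)] P(4) SH(7) eq by simp
      also have "\<dots> = rear (g \<cdot> p) r z"
        using F(9) rear_rear[OF SP(5) P(2)] P(4) by simp
      also have "\<dots> = rear (q \<cdot> g1) r z"
        using SP(7) by simp
      also have "\<dots> = rear g1 r (rear e2 s2 (U f2 y2))"
        using F2(9) rear_rear[OF SP(6) P(3)] P(5) by simp
      also have "\<dots> = rear (h2 \<cdot> e3) r (U f2 y2)"
        using rear_rear[OF e2g1 P(3)] P(5) SH2(7) eq e33 by simp
      also have "\<dots> = rear e3 r (rear h2 t (U f2 y2))"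
        using rear_rear[OF SH2(6) e3r'] eq e33 by simp
      finally show "rear e3 r (rear h t (U f y)) = rear e3 r (rear h2 t (U f2 y2))" .
    qed
    then show ?thesis using hex by simp
  qed
  \<comment> \<open>If one initial segment factors through two first edges, the cell lies beyond the
    square they span. Both labels are then read from the common remainder r, on which
    \<open>key\<close> gives agreement.\<close>
  have agree: "U f y (u, e) = U f2 y2 (u2, e)"
    if H: "first f y" "first f2 y2" "cpb f u" "cpb f2 u2" "f \<cdot> u = f2 \<cdot> u2" "(u, e) \<in> cells y" for f y f2 y2 u u2 e
    using firstD(1)[OF H(1)] firstD(1)[OF H(2)] H(3-5)
  proof (cases rule: two_first_edges)
    case same
    have "y = y2"
      using edge_unique(2)[OF firstD(2)[OF H(1)] firstD(2)[OF H(2)]]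
        firstD(3)[OF H(1)] firstD(3)[OF H(2)] same by metis
    then show ?thesis using same by simp
  next
    case (square h h2 v)
    obtain t where t: "cpb (u \<cdot> e) t" "y = (u \<cdot> e) \<cdot> t" "cpb u e"
      using H(6) unfolding cells_def prefix_def by blast
    note s = squareD[OF square(1)]
    have ve: "cpb v e" and vet: "cpb (v \<cdot> e) t" "cpb e t"
      using t(1,3) square(2,4) by simp_all
    define r where "r = v \<cdot> e \<cdot> t"
    have y: "y = h \<cdot> r" "cpb h r"
      using t(2) square(2,4) assoc[OF square(2) ve] assoc[of h "v \<cdot> e" t] ve vet by (simp_all add: r_def)
    have h2r: "cpb h2 r"
      using square(3) ve vet by (simp add: r_def)
    have w1: "w = (f \<cdot> h) \<cdot> r"
      using firstD(3)[OF H(1)] y assoc[OF s(5) y(2)] by simp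
    then have "f2 \<cdot> (h2 \<cdot> r) = f2 \<cdot> y2"
      using firstD(3)[OF H(2)] s(7) assoc[OF s(6) h2r] by simp
    then have y2: "y2 = h2 \<cdot> r"
      using comp_left_cancel[of f2 "h2 \<cdot> r" y2] firstD(2)[OF H(2)] s(6) h2r by simp
    have c: "(v, e) \<in> cells r"
      using cells_shift[OF y(2) square(2), of e] H(6) y(1) square(4) by simp
    show ?thesis
      using key[OF H(1,2) square(1) y(2) h2r y(1) y2] rear_apply[OF c, of h "U f y"]
        rear_apply[OF c, of h2 "U f2 y2"] square(4,5) by simp
  qed
  \<comment> \<open>Cells at the range get the range label or the label of a first edge, where
    cancellation makes the remainder y unique. A cell further on is labelled through any first edge
    in front of it; the choice does not matter by \<open>agree\<close>.\<close>
  define Y where "Y = (\<lambda>(v, e). if (v, e) \<notin> cells w then undefined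
    else if vertex v then if vertex e then lr l a else B e (THE y. first e y)
    else (SOME t. \<exists>f y u. first f y \<and> cpb f u \<and> v = f \<cdot> u \<and> t = U f y (u, e)))"
  have Y0: "Y (rid l, rid l) = lr l a"
    using cells_ends(1)[OF w(1)] l by (simp add: Y_def)
  have YB: "Y (rid l, f) = B f y" if "first f y" for f y
  proof -
    have "(THE y. first f y) = y"
      by (rule the_equality[where P="first f"]) (use that comp_left_cancel in \<open>auto simp: first_def\<close>)
    moreover have "(rid f, f) \<in> cells w"
      using cells_first_edge[OF firstD(1,2)[OF that]] firstD(3)[OF that] by simp
    ultimately show ?thesis
      using edge_not_vertex[OF firstD(1)[OF that]] firstD(4)[OF that] l by (simp add: Y_def)
  qed
  have YU: "Y (f \<cdot> u, e) = U f y (u, e)" if fy: "first f y" and fu: "cpb f u" and c: "(u, e) \<in> cells y" for f y u e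
  proof -
    have "(f \<cdot> u, e) \<in> cells w"
      using cells_shift[OF firstD(2)[OF fy] fu] c firstD(3)[OF fy] by simp
    moreover have "\<not> vertex (f \<cdot> u)"
      using edge_comp_not_vertex firstD(1)[OF fy] fu by blast
    moreover have "(SOME t. \<exists>f' y u'. first f' y \<and> cpb f' u' \<and> f \<cdot> u = f' \<cdot> u' \<and> t = U f' y (u', e)) = U f y (u, e)"
    proof (rule some_equality)
      fix t assume "\<exists>f' y u'. first f' y \<and> cpb f' u' \<and> f \<cdot> u = f' \<cdot> u' \<and> t = U f' y (u', e)"
      then obtain f' y' u' where *: "first f' y'" "cpb f' u'" "f \<cdot> u = f' \<cdot> u'" "t = U f' y' (u', e)"
        by blast
      show "t = U f y (u, e)"
        using agree[OF fy *(1) fu *(2,3) c] *(4) by simp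
    qed (use fy fu in blast)
    ultimately show ?thesis
      by (simp add: Y_def)
  qed
  have rearY: "rear f y Y = U f y" if fy: "first f y" for f y
  proof
    fix p :: "'e \<times> 'e"
    obtain u e where p: "p = (u, e)" by (cases p)
    show "rear f y Y p = U f y p"
    proof (cases "(u, e) \<in> cells y")
      case True
      then have "cpb f u"
        using firstD(2)[OF fy] unfolding cells_def prefix_def by (auto simp: cpb_def)
      then show ?thesis
        using YU[OF fy _ True] rear_apply[OF True] p by simp
    next
      case False
      then show ?thesis
        using labellingD(1)[OF labU[OF fy]] p by (simp add: rear_def)
    qed
  qed
  have firstI: "first f y" if "edge f" "cpb f y" "w = f \<cdot> y" for f y
    using that by (simp add: first_def)
  have "labelling w Y"
    unfolding labelling_def
  proof (intro conjI allI ballI impI)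
    fix p assume "p \<notin> cells w" then show "Y p = undefined"
      by (cases p) (simp add: Y_def)
  next
    fix p assume c: "p \<in> cells w"
    obtain x e where p: "p = (x, e)" by (cases p)
    from c[unfolded p] have "Y (x, e) \<in> Z"
    proof (cases rule: cells_cases)
      case vertex
      then show ?thesis using Y0 lr_closed[OF l a(1)] by simp
    next
      case (edge y)
      then show ?thesis using YB[OF firstI[OF edge(2-4)]] B[OF firstI[OF edge(2-4)]] w(2) by simp
    next
      case (step f u y)
      note fy = firstI[OF step(1,4,5)]
      show ?thesis
        using YU[OF fy step(2,6)] labellingD(2)[OF labU[OF fy] step(6)] step(3) by simp
    qed
    then show "Y p \<in> Z" by (simp add: p)
  next
    fix x e assume e: "edge e" and c: "(x, e) \<in> cells w"
    from c have "lr e (Y (x, e)) = Y (x, rid e) \<and> ls e (Y (x, e)) = Y (x \<cdot> e, sid e)"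
    proof (cases rule: cells_cases)
      case vertex
      then show ?thesis using e edge_not_vertex vertex_rid[OF w(1)] by metis
    next
      case (edge y)
      note ey = firstI[OF edge(2,3,4)]
      have x: "x = rid l" "rid e = rid l" "x \<cdot> e = e"
        using edge(1) w(2) firstD(4)[OF ey] comp_ident(2)[of e] e by simp_all
      have yr: "y \<in> arrows" "cpb e (rid y)" "sid e = rid y" "e \<cdot> rid y = e"
        using edge(3) cpb_rid_sid[OF edge(3)] comp_ident(1)[of e] e by (simp_all add: cpb_def)
      have "Y (e, rid y) = U e y (rid y, rid y)"
        using YU[OF ey yr(2) cells_ends(1)[OF yr(1)]] yr(4) by simp
      then show ?thesis
        using x yr YB[OF ey] Y0 lsB[OF ey] lrB[OF ey] by simp
    next
      case (step f u y)
      note fy = firstI[OF step(1,4,5)]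
      have ue: "cpb u e" using cells_arrow[OF step(6)] by simp
      note ce = cells_edge_ends[OF step(6)]
      have "Y (x, rid e) = U f y (u, rid e)" "Y (x, e) = U f y (u, e)" "Y (x \<cdot> e, sid e) = U f y (u \<cdot> e, sid e)"
        using YU[OF fy step(2) ce(1)] YU[OF fy step(2,6)] YU[OF fy _ ce(2)] step(2,3) ue assoc[OF step(2) ue]
        by simp_all
      then show ?thesis
        using labellingD(3,4)[OF labU[OF fy] e step(6)] by simp
    qed
    then show "lr e (Y (x, e)) = Y (x, rid e)" "ls e (Y (x, e)) = Y (x \<cdot> e, sid e)"
      by simp_all
  next
    fix x e f f' e' assume s: "square e f f' e'" and xe: "cpb x e" and pre: "prefix (x \<cdot> (e \<cdot> f)) w"
    note sD = squareD[OF s]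
    obtain t where t: "cpb (x \<cdot> (e \<cdot> f)) t" "w = (x \<cdot> (e \<cdot> f)) \<cdot> t"
      using pre unfolding prefix_def by blast
    have xef: "cpb x (e \<cdot> f)" using xe sD(5) by simp
    have ft: "cpb f t" using t(1) cpb_comp_left[OF xef] sD(5) by simp
    have e't: "cpb e' t"
      using ft square_ends(2)[OF s] sD(4) by (simp add: cpb_def)
    have "x \<in> arrows" using xe cpb_arrow by blast
    then show "sq e f f' e' (Y (x, e)) (Y (x \<cdot> e, f)) (Y (x, f')) (Y (x \<cdot> f', e'))"
    proof (cases rule: arrow_cases)
      \<comment> \<open>A square at the range begins with two first edges, so its condition is
        \<open>key\<close>. Any other square lies behind a first edge g, where \<open>U g y\<close>
        is already a labelling.\<close>
      case 1
      have xx: "x \<cdot> e = e" "x \<cdot> (e \<cdot> f) = e \<cdot> f" "x = rid e"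
        using comp_vertex(1)[OF 1 xe] comp_vertex(1)[OF 1 xef] cpb_vertex(1)[OF 1 xe] by simp_all
      have e1: "first e (f \<cdot> t)" and f1: "first f' (e' \<cdot> t)"
        using t(2) xx(2) assoc[OF sD(5) ft] assoc[OF sD(6) e't] sD ft e't by (auto intro!: firstI)
      have x: "x = rid l" using xx(3) firstD(4)[OF e1] by simp
      have "rng \<Gamma> f' = rng \<Gamma> e" using square_ends(1)[OF s] .
      then have xf': "x \<cdot> f' = f'" using xx(3) comp_ident(2)[of f'] sD(3) by simp
      have "Y (e, f) = rear e (f \<cdot> t) Y (rid f, f)" "Y (f', e') = rear f' (e' \<cdot> t) Y (rid e', e')"
        using rear_first[OF firstD(2)[OF e1] sD(2) ft] rear_first[OF firstD(2)[OF f1] sD(4) e't] by simp_all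
      then have "Y (e, f) = U e (f \<cdot> t) (rid f, f)" "Y (f', e') = U f' (e' \<cdot> t) (rid e', e')"
        using rearY e1 f1 by simp_all
      then show ?thesis
        using key[OF e1 f1 s ft e't] YB[OF e1] YB[OF f1] x xx(1) xf' by simp
    next
      case (2 g u)
      have ue: "cpb u e" using xe 2 by simp
      have uef: "cpb u (e \<cdot> f)" using ue sD(5) by simp
      define y where "y = (u \<cdot> (e \<cdot> f)) \<cdot> t"
      have uft: "cpb (u \<cdot> (e \<cdot> f)) t" using uef sD(5) ft by simp
      have gy: "first g y"
        using t(2) 2 assoc[of g "u \<cdot> (e \<cdot> f)" t] assoc[OF 2(2) uef] uef uft
        by (auto intro!: firstI simp: y_def)
      have pre': "prefix (u \<cdot> (e \<cdot> f)) y"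
        unfolding prefix_def y_def using uft by blast
      note c = cells_of_square[OF s ue pre']
      have uf': "cpb u f'" using ue square_ends(1)[OF s] sD(3) by (simp add: cpb_def)
      have "Y (x, e) = U g y (u, e)" "Y (x \<cdot> e, f) = U g y (u \<cdot> e, f)" "Y (x, f') = U g y (u, f')"
        "Y (x \<cdot> f', e') = U g y (u \<cdot> f', e')"
        using YU[OF gy _ c(1)] YU[OF gy _ c(2)] YU[OF gy _ c(3)] YU[OF gy _ c(4)] 2 ue uf'
          assoc[OF 2(2) ue] assoc[OF 2(2) uf'] by simp_all
      then show ?thesis
        using labellingD(5)[OF labU[OF gy] s ue pre'] by simp
    qed
  qed
  then show ?case
    using YB[OF firstl] rearY[OF firstl] Gl[OF firstl] unfolding w_def by auto
qed

section \<open>Labellings of a composite path\<close>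

lemma front_apply: "p \<in> cells x \<Longrightarrow> front x z p = z p"
  by (simp add: front_def)

lemma front_rear:
  assumes "cpb x y" "cpb y v"
  shows "front y (rear x (y \<cdot> v) z) = rear x y (front (x \<cdot> y) z)"
proof
  fix p :: "'e \<times> 'e"
  obtain u e where p: "p = (u, e)" by (cases p)
  show "front y (rear x (y \<cdot> v) z) p = rear x y (front (x \<cdot> y) z) p"
  proof (cases "(u, e) \<in> cells y")
    case True
    then have "cpb x u"
      using assms unfolding cells_def prefix_def by (auto simp: cpb_def)
    then show ?thesis
      using True cells_prefix[OF assms(2) True] cells_shift[OF assms(1), of u e] p
      by (simp add: front_def rear_def)
  qed (simp add: p front_def rear_def)
qed

lemma cells_vertex:
  assumes "vertex x"
  shows "cells x = {(x, x)}"
proof -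
  have "(u, e) \<in> cells x \<Longrightarrow> u = x \<and> e = x" for u e
    by (erule cells_cases) (use assms edge_comp_not_vertex rid_vertex in auto)
  moreover have "(x, x) \<in> cells x"
    using cells_ends(1)[of x] assms rid_vertex by simp
  ultimately show ?thesis by auto
qed

text \<open>Induction on x: with first edge l, the labelling of the rest of x is extended over y,
  then l is put in front. The result agrees with z on l and behind it, hence on all of this initial
  segment by \<open>edge_fill_unique\<close>.\<close>

theorem labelling_fill:
  assumes "cpb x y" "labelling x z" "labelling y z'" "z (x, sid x) = z' (rid y, rid y)"
  shows "\<exists>!w. labelling (x \<cdot> y) w \<and> front x w = z \<and> rear x y w = z'"
proof -
  have "x \<in> arrows" using assms(1) cpb_arrow by blast
  then show ?thesis
    using assms
  proof (induction x arbitrary: z rule: arrow_induct)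
    case (vertex x)
    note xy = comp_vertex(1)[OF vertex(1,2)] and x = cpb_vertex(1)[OF vertex(1,2)]
    have xu: "x \<cdot> u = u" if "(u, e) \<in> cells y" for u e
      using that comp_vertex(1)[OF vertex(1), of u] vertex(2) unfolding cells_def prefix_def
      by (auto simp: cpb_def)
    have rear: "rear x y w = w" if "labelling y w" for w
      using xu labellingD(1)[OF that] by (auto simp: rear_def fun_eq_iff)
    have "z p = front x z' p" for p
      using vertex(5) labellingD(1)[OF vertex(3)] x sid_vertex[OF vertex(1)] cells_vertex[OF vertex(1)]
      by (cases "p = (x, x)") (auto simp: front_def)
    then show ?case
      using vertex(4) rear xy by (intro ex1I[of _ z']) (auto simp: fun_eq_iff)
  next
    case (edge l x)
    have xy: "cpb x y" using edge(2,4) by simp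
    have lxy: "cpb l (x \<cdot> y)" using edge(2) xy by simp
    note asc = assoc[OF edge(2) xy]
    have c: "(rid l, l) \<in> cells (l \<cdot> x)" by (rule cells_first_edge[OF edge(1,2)])
    have "rear l x z (x, sid x) = z' (rid y, rid y)"
      using edge(7) rear_source[OF edge(2)] edge(2) by simp
    then obtain w' where w': "labelling (x \<cdot> y) w'" "front x w' = rear l x z" "rear x y w' = z'"
      and w'u: "\<And>v. labelling (x \<cdot> y) v \<and> front x v = rear l x z \<and> rear x y v = z' \<Longrightarrow> v = w'"
      using edge(3)[OF xy labelling_rear[OF edge(2,5)] edge(6)] by blast
    have "(rid x, rid x) \<in> cells x" using cells_ends(1) cpb_arrow(1)[OF xy] by blast
    then have "w' (rid (x \<cdot> y), rid (x \<cdot> y)) = rear l x z (rid x, rid x)"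
      using w'(2) front_apply[of "(rid x, rid x)" x w'] xy by simp
    also have "\<dots> = ls l (z (rid l, l))"
      using rear_range[OF edge(2)] labellingD(4)[OF edge(5,1) c] edge(1) by simp
    finally obtain w where w: "labelling (l \<cdot> (x \<cdot> y)) w" "w (rid l, l) = z (rid l, l)" "rear l (x \<cdot> y) w = w'"
      using edge_fill_exists[OF edge(1) lxy w'(1) labellingD(2)[OF edge(5) c]] by metis
    show ?case
    proof (rule ex1I[of _ w])
      have "front (l \<cdot> x) w = z"
      proof (rule edge_fill_unique[OF edge(1,2) labelling_front[OF edge(4)] edge(5)])
        show "labelling (l \<cdot> x \<cdot> y) w"
          using w(1) asc by metis
      qed (use w w' front_apply[OF c] front_rear[OF edge(2) xy, of w] in simp_all)
      moreover have "rear (l \<cdot> x) y w = z'"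
        using rear_rear[OF edge(2) xy, of w] w w' by simp
      ultimately show "labelling (l \<cdot> x \<cdot> y) w \<and> front (l \<cdot> x) w = z \<and> rear (l \<cdot> x) y w = z'"
        using w(1) asc by metis
    next
      fix v assume v: "labelling (l \<cdot> x \<cdot> y) v \<and> front (l \<cdot> x) v = z \<and> rear (l \<cdot> x) y v = z'"
      have lv: "labelling (l \<cdot> (x \<cdot> y)) v" using v asc by metis
      have "rear l (x \<cdot> y) v = w'"
        by (rule w'u) (use labelling_rear[OF lxy lv] front_rear[OF edge(2) xy, of v]
          rear_rear[OF edge(2) xy, of v] v in simp)
      moreover have "v (rid l, l) = z (rid l, l)"
        using front_apply[OF c, of v] v by simp
      ultimately show "v = w"
        using edge_fill_unique[OF edge(1) lxy lv w(1)] w(2,3) by simp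
    qed
  qed
qed

end

section \<open>The hexagonal condition for power maps\<close>

lemma powi_commute: "(x powi a) powi b = (x powi b) powi (a :: int)" for x :: complex
  by (metis mult.commute power_int_mult)

text \<open>With c a + d b = 1 by Bezout, every nonzero z is recovered as (z^a)^c (z^b)^d.\<close>

lemma powi_eq_coprime:
  fixes x y :: complex
  assumes "x \<noteq> 0" "y \<noteq> 0" "coprime a b" "x powi a = y powi a" "x powi b = y powi b"
  shows "x = y"
proof -
  obtain c d where "c * a + d * b = 1"
    using bezout_int[of a b] assms(3) by auto
  then have "(z powi a) powi c * (z powi b) powi d = z" if "z \<noteq> 0" for z :: complex
    using that by (simp flip: power_int_mult power_int_add add: mult.commute)
  then show ?thesis
    using assms by metis
qed

text \<open>With c a + d b = 1, the product u = x^c y^d satisfies u^a = x^(c a) (y^a)^d = x^(c a + d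
  b) = x, and similarly u^b = y. The root is displayed as a monomial in x and y so that its modulus
  can be read off.\<close>

lemma powi_common_root:
  fixes x y :: complex
  assumes "x \<noteq> 0" "y \<noteq> 0" "coprime a b" "x powi b = y powi a"
  obtains c d where "x = (x powi c * y powi d) powi a" "y = (x powi c * y powi d) powi b"
proof -
  obtain c d where cd: "c * a + d * b = 1"
    using bezout_int[of a b] assms(3) by auto
  have "(x powi c * y powi d) powi a = (x powi a) powi c * (y powi a) powi d"
    by (simp add: power_int_mult_distrib powi_commute)
  also have "\<dots> = x powi (c * a + d * b)"
    using assms(1,4) by (simp add: power_int_add power_int_mult mult.commute flip: powi_commute)
  finally have 1: "(x powi c * y powi d) powi a = x" using cd by simp
  have "(x powi c * y powi d) powi b = (x powi b) powi c * (y powi b) powi d"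
    by (simp add: power_int_mult_distrib powi_commute)
  also have "\<dots> = y powi (c * a + d * b)"
    using assms(2,4) by (simp add: power_int_add power_int_mult mult.commute flip: powi_commute)
  finally show thesis using that[of c d] 1 cd by simp
qed

lemma powi_coprime_cancel:
  fixes x y :: complex
  assumes "x \<noteq> 0" "y \<noteq> 0" "coprime a b" "x powi (a * c) = y powi (a * c)" "x powi (b * c) = y powi (b * c)"
  shows "x powi c = y powi c"
  by (rule powi_eq_coprime[of _ _ a b]) (use assms in \<open>simp_all flip: power_int_mult add: mult.commute\<close>)

text \<open>The families indexed by colours become functions of single edges, since an edge
  determines its colour. Both are integer valued, so one power operation serves for them, and the
  conditions cover squares in either orientation.\<close>

locale twisted_kgraph = topological_kgraph k \<Gamma> for k and \<Gamma> :: "('v, 'e) kgraph_data" +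
  fixes M N :: "'e \<Rightarrow> int"
  assumes M_nonzero: "edge e \<Longrightarrow> M e \<noteq> 0" and N_positive: "edge e \<Longrightarrow> N e > 0"
    and coprime_square: "square e f f' e' \<Longrightarrow> coprime (M e * M f) (N e * N f)"
    and M_square: "square e f f' e' \<Longrightarrow> M e * M f = M f' * M e'"
    and N_square: "square e f f' e' \<Longrightarrow> N e * N f = N f' * N e'"
begin

notation comp_infix (infixl "\<cdot>" 70)

text \<open>In either factorization the first edge receives the \<open>M\<close> of the second as
  exponent and the second edge the \<open>N\<close> of the first. So the labels match at the middle
  vertex, and \<open>M_square\<close> and \<open>N_square\<close> make them agree at both
  ends.\<close>

definition root_square :: "'e \<Rightarrow> 'e \<Rightarrow> 'e \<Rightarrow> 'e \<Rightarrow> complex \<Rightarrow> complex \<Rightarrow> complex \<Rightarrow> complex \<Rightarrow> bool" where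
  "root_square e f f' e' a b b' a' \<longleftrightarrow> (\<exists>u. cmod u = 1 \<and>
     a = u powi M f \<and> b = u powi N e \<and> b' = u powi M e' \<and> a' = u powi N f')"

text \<open>By the product rules \<open>M f'\<close> and \<open>M e'\<close> divide M e M f, and
  \<open>N e'\<close> divides N e N f, so coprimality of one pair of products spreads over the
  square.\<close>

lemma coprimes:
  assumes "square e f f' e'"
  shows "coprime (M f) (N e)" "coprime (M f) (N e')" "coprime (M f') (N e)" "coprime (M e') (N e')"
  using coprime_square[OF assms] coprime_square[OF square_sym[OF assms]] M_square[OF assms] N_square[OF assms]
  by (auto simp: coprime_mult_left_iff coprime_mult_right_iff) (metis coprime_mult_left_iff coprime_mult_right_iff)+

text \<open>The six squares are the faces of the cube of the path e g p, with labels a, x, y along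
  it; \<open>u1\<close> to \<open>u5\<close> are the roots of the five labelled faces. From x one
  gets u1^(N e) = u2^(M p), but e and p are not adjacent and coprimality of these exponents is not
  at hand, so u1 and u2 have no evident common root. Equalities are proved for powers first.\<close>

lemma root_square_hexagon:
  assumes S1: "square e g f e1" and S2: "square g p q g1" and S3: "square e q f2 e2"
    and S4: "square e1 p h e3" and S5: "square e2 g1 h2 e3" and S6: "square f h f2 h2"
    and R1: "root_square e g f e1 a x b a1" and R2: "root_square g p q g1 x y v x1"
    and R3: "root_square e q f2 e2 a v b2 a2" and R4: "root_square e1 p h e3 a1 y c a3"
    and R5: "root_square e2 g1 h2 e3 a2 x1 c2 a4"
  shows "a3 = a4 \<and> root_square f h f2 h2 b c b2 c2"
proof -
  note MS = M_square[OF S1] M_square[OF S2] M_square[OF S3] M_square[OF S4] M_square[OF S5] M_square[OF S6]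
  note NS = N_square[OF S1] N_square[OF S2] N_square[OF S3] N_square[OF S4] N_square[OF S5] N_square[OF S6]
  obtain u1 where u1: "cmod u1 = 1" "a = u1 powi M g" "x = u1 powi N e" "b = u1 powi M e1" "a1 = u1 powi N f"
    using R1 unfolding root_square_def by blast
  obtain u2 where u2: "cmod u2 = 1" "x = u2 powi M p" "y = u2 powi N g" "v = u2 powi M g1" "x1 = u2 powi N q"
    using R2 unfolding root_square_def by blast
  obtain u3 where u3: "cmod u3 = 1" "a = u3 powi M q" "v = u3 powi N e" "b2 = u3 powi M e2" "a2 = u3 powi N f2"
    using R3 unfolding root_square_def by blast
  obtain u4 where u4: "cmod u4 = 1" "a1 = u4 powi M p" "y = u4 powi N e1" "c = u4 powi M e3" "a3 = u4 powi N h"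
    using R4 unfolding root_square_def by blast
  obtain u5 where u5: "cmod u5 = 1" "a2 = u5 powi M g1" "x1 = u5 powi N e2" "c2 = u5 powi M e3" "a4 = u5 powi N h2"
    using R5 unfolding root_square_def by blast
  have nz: "u1 \<noteq> 0" "u2 \<noteq> 0" "u3 \<noteq> 0" "u4 \<noteq> 0" "u5 \<noteq> 0" "b \<noteq> 0" "c \<noteq> 0" "b2 \<noteq> 0" "c2 \<noteq> 0" "a3 \<noteq> 0" "a4 \<noteq> 0"
    using u1 u2 u3 u4 u5 by (auto simp: power_int_eq_0_iff)
  \<comment> \<open>The labels b and c match at the vertex between f and h, so the sixth face also
    has a root, \<open>u6\<close>.\<close>
  have "b powi N f = a1 powi M e1"
    using u1 by (simp add: powi_commute)
  also have "\<dots> = u4 powi (M e1 * M p)"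
    using u4 by (simp add: mult.commute flip: power_int_mult)
  also have "\<dots> = c powi M h"
    using u4 MS(4) by (simp add: mult.commute flip: power_int_mult)
  finally have bc: "b powi N f = c powi M h" .
  obtain s t where st: "b = (b powi s * c powi t) powi M h" "c = (b powi s * c powi t) powi N f"
    using powi_common_root[OF nz(6,7) coprimes(1)[OF S6] bc] by blast
  define u6 where "u6 = b powi s * c powi t"
  have u6: "b = u6 powi M h" "c = u6 powi N f" "cmod u6 = 1"
    using st u1 u4 by (simp_all add: u6_def norm_mult norm_power_int)
  then have nz6: "u6 \<noteq> 0" by auto
  \<comment> \<open>The labels that the sixth face prescribes opposite to b and c. They are to be
    compared with b2 and c2, which come from the other way around the cube.\<close>
  define b3 c3 where "b3 = u6 powi M h2" and "c3 = u6 powi N f2"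
  have nz3: "b3 \<noteq> 0" "c3 \<noteq> 0" using nz6 by (simp_all add: b3_def c3_def power_int_eq_0_iff)
  (* If the K-th powers of a, x, y are t^(m2 m3), t^(n1 m3), t^(n1 n2), then the K-th powers of all other
     labels are monomials in t as well, and the two ways around the cube visibly agree. *)
  have eqK: "a3 powi K = a4 powi K \<and> b3 powi K = b2 powi K \<and> c3 powi K = c2 powi K"
    if t1: "u1 powi K = t powi M p" and t2: "u2 powi K = t powi N e" and t0: "t \<noteq> 0" for K t
  proof -
    have K: "(u powi i) powi K = (t powi j) powi i" if "u powi K = t powi j" for u i j
      using that by (metis powi_commute)
    have sw: "(t powi i) powi j = t powi (i * j)" for i j by (simp add: power_int_mult)
    have tnz: "t powi i \<noteq> 0" for i using t0 by (simp add: power_int_eq_0_iff)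
    have knz: "u powi K \<noteq> 0" if "u \<noteq> 0" for u :: complex using that by (simp add: power_int_eq_0_iff)
    have t3: "u3 powi K = t powi M g1"
    proof (rule powi_eq_coprime[OF knz[OF nz(3)] tnz coprimes(1)[OF S3]])
      have "(u3 powi K) powi M q = a powi K" using u3 by (metis powi_commute)
      also have "\<dots> = t powi (M p * M g)" using u1 K[OF t1] sw by simp
      also have "\<dots> = (t powi M g1) powi M q" using MS(2) sw by (simp add: mult.commute)
      finally show "(u3 powi K) powi M q = (t powi M g1) powi M q" .
      have "(u3 powi K) powi N e = v powi K" using u3 by (metis powi_commute)
      also have "\<dots> = (t powi M g1) powi N e" using u2 K[OF t2] by (metis powi_commute)
      finally show "(u3 powi K) powi N e = (t powi M g1) powi N e" .
    qed
    have t4: "u4 powi K = t powi N f"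
    proof (rule powi_eq_coprime[OF knz[OF nz(4)] tnz coprimes(1)[OF S4]])
      have "(u4 powi K) powi M p = a1 powi K" using u4 by (metis powi_commute)
      also have "\<dots> = (t powi N f) powi M p" using u1 K[OF t1] by (metis powi_commute)
      finally show "(u4 powi K) powi M p = (t powi N f) powi M p" .
      have "(u4 powi K) powi N e1 = y powi K" using u4 by (metis powi_commute)
      also have "\<dots> = t powi (N e * N g)" using u2 K[OF t2] sw by simp
      also have "\<dots> = (t powi N f) powi N e1" using NS(1) sw by simp
      finally show "(u4 powi K) powi N e1 = (t powi N f) powi N e1" .
    qed
    have t5: "u5 powi K = t powi N f2"
    proof (rule powi_eq_coprime[OF knz[OF nz(5)] tnz coprimes(1)[OF S5]])
      have "(u5 powi K) powi M g1 = a2 powi K" using u5 by (metis powi_commute)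
      also have "\<dots> = (t powi N f2) powi M g1" using u3 K[OF t3] by (metis powi_commute)
      finally show "(u5 powi K) powi M g1 = (t powi N f2) powi M g1" .
      have "(u5 powi K) powi N e2 = x1 powi K" using u5 by (metis powi_commute)
      also have "\<dots> = t powi (N e * N q)" using u2 K[OF t2] sw by simp
      also have "\<dots> = (t powi N f2) powi N e2" using NS(3) sw by simp
      finally show "(u5 powi K) powi N e2 = (t powi N f2) powi N e2" .
    qed
    have t6: "u6 powi K = t powi M e3"
    proof (rule powi_eq_coprime[OF knz[OF nz6] tnz coprimes(1)[OF S6]])
      have "(u6 powi K) powi M h = b powi K" using u6 by (metis powi_commute)
      also have "\<dots> = t powi (M p * M e1)" using u1 K[OF t1] sw by simp
      also have "\<dots> = (t powi M e3) powi M h" using MS(4) sw by (simp add: mult.commute)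
      finally show "(u6 powi K) powi M h = (t powi M e3) powi M h" .
      have "(u6 powi K) powi N f = c powi K" using u6 by (metis powi_commute)
      also have "\<dots> = (t powi M e3) powi N f" using u4 K[OF t4] by (metis powi_commute)
      finally show "(u6 powi K) powi N f = (t powi M e3) powi N f" .
    qed
    have "a3 powi K = a4 powi K"
      using u4 u5 K[OF t4] K[OF t5] sw NS(6) by simp
    moreover have "b3 powi K = b2 powi K"
      using u3 K[OF t6] K[OF t3] sw MS(5) by (simp add: b3_def mult.commute)
    moreover have "c3 powi K = c2 powi K"
      using u5 K[OF t6] K[OF t5] sw by (simp add: c3_def mult.commute)
    ultimately show ?thesis by blast
  qed
  have xnz: "a \<noteq> 0" "x \<noteq> 0" "y \<noteq> 0" using u1 u2 nz by (auto simp: power_int_eq_0_iff)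
  \<comment> \<open>Since a = u1^(M g), x = u1^(N e) = u2^(M p) and y = u2^(N g), each of a, x, y
    can play the role of t for its own exponent K.\<close>
  have K1: "u1 powi (M g * M p) = a powi M p" "u2 powi (M g * M p) = a powi N e"
    using u1 u2 by (simp_all add: power_int_mult) (metis powi_commute)+
  have K2: "u1 powi (N e * M p) = x powi M p" "u2 powi (N e * M p) = x powi N e"
    using u1 u2 by (simp_all add: power_int_mult) (metis powi_commute)+
  have K3: "u1 powi (N e * N g) = y powi M p" "u2 powi (N e * N g) = y powi N e"
    using u1 u2 by (simp_all add: power_int_mult) (metis powi_commute)+
  note e1 = eqK[OF K1 xnz(1)] and e2 = eqK[OF K2 xnz(2)] and e3 = eqK[OF K3 xnz(3)]
  \<comment> \<open>Coprimality of \<open>M g\<close> and \<open>N e\<close> leaves the exponent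
    \<open>M p\<close>; that of \<open>M p\<close> and \<open>N g\<close> leaves
    \<open>N e\<close>.\<close>
  have kill: "z powi M p = z' powi M p \<and> z powi N e = z' powi N e"
    if "z \<noteq> 0" "z' \<noteq> 0" "z powi (M g * M p) = z' powi (M g * M p)" "z powi (N e * M p) = z' powi (N e * M p)"
      "z powi (N e * N g) = z' powi (N e * N g)" for z z' :: complex
    using powi_coprime_cancel[OF that(1,2) coprimes(1)[OF S1] that(3,4)]
      powi_coprime_cancel[OF that(1,2) coprimes(1)[OF S2], of "N e"] that(4,5) by (simp add: mult.commute)
  have ka: "a3 powi M p = a4 powi M p" "a3 powi N e = a4 powi N e"
    using kill[OF nz(10,11)] e1 e2 e3 by blast+
  have kb: "b3 powi M p = b2 powi M p" "b3 powi N e = b2 powi N e"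
    using kill[OF nz3(1) nz(8)] e1 e2 e3 by blast+
  have kc: "c3 powi M p = c2 powi M p" "c3 powi N e = c2 powi N e"
    using kill[OF nz3(2) nz(9)] e1 e2 e3 by blast+
  \<comment> \<open>The label at the source of the whole path is y^(N p) both ways. This gives
    equality at the exponent \<open>N e3\<close>, which is coprime to \<open>M p\<close>.\<close>
  have "a3 powi N e3 = y powi N p"
    using u4 NS(4) by (simp flip: power_int_mult)
  also have "\<dots> = x1 powi N g1"
    using u2 NS(2) by (simp flip: power_int_mult)
  also have "\<dots> = a4 powi N e3"
    using u5 NS(5) by (simp flip: power_int_mult)
  finally have a34: "a3 = a4"
    using powi_eq_coprime[OF nz(10,11) coprimes(2)[OF S4] ka(1)] by blast
  \<comment> \<open>Here the label a^(M e) at the range gives equality at the exponent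
    \<open>M f2\<close>, which is coprime to \<open>N e\<close>.\<close>
  have "b3 powi M f2 = b powi M f"
    using u6 MS(6) by (simp add: b3_def mult.commute flip: power_int_mult)
  also have "\<dots> = a powi M e"
    using u1 MS(1) by (simp add: mult.commute flip: power_int_mult)
  also have "\<dots> = b2 powi M f2"
    using u3 MS(3) by (simp add: mult.commute flip: power_int_mult)
  finally have b23: "b3 = b2"
    using powi_eq_coprime[OF nz3(1) nz(8) coprimes(3)[OF S3]] kb(2) by blast
  \<comment> \<open>For c3 and c2 the labels induced at both ends of \<open>h2\<close> agree, by the
    two equalities just proved, and the two exponents at \<open>h2\<close> are coprime.\<close>
  have "c3 powi N h2 = c powi N h"
    using u6 NS(6) by (simp add: c3_def flip: power_int_mult)
  also have "\<dots> = a3 powi M e3"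
    using u4 by (simp add: powi_commute)
  also have "\<dots> = c2 powi N h2"
    using a34 u5 by (simp add: powi_commute)
  finally have c1: "c3 powi N h2 = c2 powi N h2" .
  have "c3 powi M h2 = b3 powi N f2"
    by (simp add: c3_def b3_def powi_commute)
  also have "\<dots> = a2 powi M e2"
    using b23 u3 by (simp add: powi_commute)
  also have "\<dots> = c2 powi M h2"
    using u5 MS(5) by (simp add: mult.commute flip: power_int_mult)
  finally have "c3 = c2"
    using powi_eq_coprime[OF nz3(2) nz(9) coprimes(4)[OF S6]] c1 by blast
  then show ?thesis
    using a34 b23 u6 unfolding root_square_def b3_def c3_def by auto
qed

sublocale labelled_kgraph k \<Gamma> "{z. cmod z = 1}" "\<lambda>e a. a powi M e" "\<lambda>e a. a powi N e" root_square
proof unfold_locales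
  fix e f f' e' a b b' a'
  assume s: "square e f f' e'" and r: "root_square e f f' e' a b b' a'"
  then obtain u where u: "cmod u = 1" "a = u powi M f" "b = u powi N e" "b' = u powi M e'" "a' = u powi N f'"
    unfolding root_square_def by blast
  show "a \<in> {z. cmod z = 1} \<and> b \<in> {z. cmod z = 1} \<and> b' \<in> {z. cmod z = 1} \<and> a' \<in> {z. cmod z = 1}"
    using u by (simp add: norm_power_int)
  show "a powi N e = b powi M f \<and> b' powi M f' = a powi M e \<and> a' powi N e' = b powi N f"
    using u M_square[OF s] N_square[OF s] by (simp add: mult.commute flip: power_int_mult)
  show "root_square f' e' e f b' a' a b"
    unfolding root_square_def using u by blast
next
  fix e f f' e' a b
  assume s: "square e f f' e'" and ab: "a \<in> {z. cmod z = 1}" "b \<in> {z. cmod z = 1}" "a powi N e = b powi M f"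
  then have "a \<noteq> 0" "b \<noteq> 0" by auto
  from powi_common_root[OF this coprimes(1)[OF s] ab(3)] obtain c d
    where "a = (a powi c * b powi d) powi M f" "b = (a powi c * b powi d) powi N e" by blast
  moreover have "cmod (a powi c * b powi d) = 1"
    using ab by (simp add: norm_mult norm_power_int)
  ultimately show "\<exists>b' a'. root_square e f f' e' a b b' a'"
    unfolding root_square_def by blast
next
  fix e f f' e' a b b1 a1 b2 a2
  assume s: "square e f f' e'" and r: "root_square e f f' e' a b b1 a1" "root_square e f f' e' a b b2 a2"
  obtain u where u: "cmod u = 1" "a = u powi M f" "b = u powi N e" "b1 = u powi M e'" "a1 = u powi N f'"
    using r unfolding root_square_def by blast
  obtain v where v: "cmod v = 1" "a = v powi M f" "b = v powi N e" "b2 = v powi M e'" "a2 = v powi N f'"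
    using r unfolding root_square_def by blast
  have "u \<noteq> 0" "v \<noteq> 0" using u v by auto
  from powi_eq_coprime[OF this coprimes(1)[OF s]] have "u = v" using u v by simp
  then show "b1 = b2 \<and> a1 = a2" using u v by simp
next
  fix e g f e1 p q g1 f2 e2 h e3 h2 a x b a1 y v x1 b2 a2 c a3 c2 a4
  assume "square e g f e1" "square g p q g1" "square e q f2 e2" "square e1 p h e3" "square e2 g1 h2 e3" "square f h f2 h2"
    "root_square e g f e1 a x b a1" "root_square g p q g1 x y v x1" "root_square e q f2 e2 a v b2 a2"
    "root_square e1 p h e3 a1 y c a3" "root_square e2 g1 h2 e3 a2 x1 c2 a4"
  then show "a3 = a4 \<and> root_square f h f2 h2 b c b2 c2"
    by (rule root_square_hexagon)
qed (simp_all add: norm_power_int)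

end

section \<open>The topological graph of labellings\<close>

lemma closedin_Collect_all:
  assumes "\<And>i. P i \<Longrightarrow> closedin X {x \<in> topspace X. Q i x}"
  shows "closedin X {x \<in> topspace X. \<forall>i. P i \<longrightarrow> Q i x}"
proof -
  have "{x \<in> topspace X. \<forall>i. P i \<longrightarrow> Q i x} = \<Inter> (insert (topspace X) {{x \<in> topspace X. Q i x} | i. P i})"
    by blast
  moreover have "closedin X \<dots>"
    using assms by (intro closedin_Inter) auto
  ultimately show ?thesis by simp
qed

lemma Hausdorff_space_euclidean_fun: "Hausdorff_space (euclidean :: ('a \<Rightarrow> 'b::metric_space) topology)"
proof -
  have "Hausdorff_space (product_topology (\<lambda>_::'a. euclidean :: 'b topology) UNIV)"
    by (simp add: Hausdorff_space_product_topology)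
  then show ?thesis
    by (simp only: euclidean_product_topology)
qed

lemma continuous_map_euclidean_fun:
  "continuous_map X (euclidean :: ('a \<Rightarrow> 'b::topological_space) topology) f \<longleftrightarrow>
     (\<forall>p. continuous_map X euclidean (\<lambda>x. f x p))"
  by (metis continuous_map_componentwise_UNIV euclidean_product_topology)

text \<open>Compactness of Z and closedness of the square relation make the spaces of labellings
  compact. The assumption on \<open>ls\<close> yields the source map, and surjectivity of
  \<open>lr\<close> the absence of sources.\<close>

locale topological_labelled_kgraph =
  labelled_kgraph k \<Gamma> Z lr ls sq for k and \<Gamma> :: "('v, 'e) kgraph_data"
    and Z :: "'z::metric_space set" and lr ls :: "'e \<Rightarrow> 'z \<Rightarrow> 'z" and sq +
  assumes discrete_Obj: "Obj \<Gamma> = discrete_topology (topspace (Obj \<Gamma>))"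
    and discrete_Mor: "Mor \<Gamma> = discrete_topology (topspace (Mor \<Gamma>))"
    and compact_Z: "compact Z"
    and continuous_lr: "edge e \<Longrightarrow> continuous_on Z (lr e)"
    and local_homeo_ls: "edge e \<Longrightarrow> local_homeomorphism_map (top_of_set Z) (top_of_set Z) (ls e)"
    and closed_sq: "square e f f' e' \<Longrightarrow> closed {(a, b, b', a'). sq e f f' e' a b b' a'}"
    and lr_surj: "edge e \<Longrightarrow> a \<in> Z \<Longrightarrow> \<exists>b\<in>Z. lr e b = a"
begin

notation comp_infix (infixl "\<cdot>" 70)

text \<open>The topology of the function type is the product topology, so this is pointwise
  convergence of labels.\<close>

definition labels :: "'e \<Rightarrow> ('e \<times> 'e \<Rightarrow> 'z) topology" where
  "labels w = top_of_set {z. labelling w z}"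

lemma topspace_labels [simp]: "topspace (labels w) = {z. labelling w z}"
  by (simp add: labels_def)

lemma continuous_map_into_labels:
  "continuous_map X (labels w) f \<longleftrightarrow>
     (\<forall>p. continuous_map X euclidean (\<lambda>x. f x p)) \<and> (\<forall>x\<in>topspace X. labelling w (f x))"
  unfolding labels_def continuous_map_in_subtopology continuous_map_euclidean_fun by auto

lemma continuous_map_coordinate: "continuous_map (labels w) euclidean (\<lambda>z. z p)"
proof -
  have "continuous_map (labels w) euclidean (\<lambda>z. z)"
    unfolding labels_def by (simp add: continuous_map_from_subtopology)
  then show ?thesis
    unfolding continuous_map_euclidean_fun by blast
qed

lemma continuous_map_coordinate_Z:
  "p \<in> cells w \<Longrightarrow> continuous_map (labels w) (top_of_set Z) (\<lambda>z. z p)"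
  using continuous_map_coordinate labellingD(2) by (auto simp: continuous_map_in_subtopology)

lemma Hausdorff_space_labels: "Hausdorff_space (labels w)"
  unfolding labels_def by (intro Hausdorff_space_subtopology Hausdorff_space_euclidean_fun)

lemma continuous_ls: "edge e \<Longrightarrow> continuous_on Z (ls e)"
  using local_homeo_ls[of e] unfolding local_homeomorphism_map_iff
  by (metis continuous_map_in_subtopology continuous_map_iff_continuous)

text \<open>By Tychonoff a product of copies of Z and of points is compact; the conditions at edge
  ends and on squares are closed and cut out the labellings.\<close>

lemma compact_space_labels: "compact_space (labels w)"
proof -
  \<comment> \<open>Off the cells the factor is the single point \<open>undefined\<close>, so that
    the whole box is compact.\<close>
  define K where "K p = (if p \<in> cells w then Z else {undefined})" for p
  define X where "X = top_of_set {z :: 'e \<times> 'e \<Rightarrow> 'z. \<forall>p. z p \<in> K p}"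
  have tX: "topspace X = {z. \<forall>p. z p \<in> K p}" by (simp add: X_def)
  have "compactin (product_topology (\<lambda>i. euclidean) UNIV) (PiE UNIV K)"
    unfolding compactin_PiE by (auto simp: K_def compact_Z)
  moreover have "PiE UNIV K = {z. \<forall>p. z p \<in> K p}"
    by auto
  ultimately have "compact {z. \<forall>p. z p \<in> K p}"
    unfolding euclidean_product_topology by simp
  then have X: "compact_space X"
    unfolding X_def by (simp add: compact_space_subtopology)
  have coord: "continuous_map X euclidean (\<lambda>z. z p)" for p
  proof -
    have "continuous_map X euclidean (\<lambda>z. z)"
      unfolding X_def by (simp add: continuous_map_from_subtopology)
    then show ?thesis unfolding continuous_map_euclidean_fun by blast
  qed
  have coordZ: "continuous_map X (top_of_set Z) (\<lambda>z. z p)" if p: "p \<in> cells w" for p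
  proof -
    have "z p \<in> Z" if "z \<in> topspace X" for z
    proof -
      have "z p \<in> K p" using that tX by blast
      then show ?thesis using p by (simp add: K_def)
    qed
    then show ?thesis
      unfolding continuous_map_in_subtopology using coord by blast
  qed
  have comp: "continuous_map X euclidean (\<lambda>z. g (z p))" if "p \<in> cells w" "continuous_on Z g" for p and g :: "'z \<Rightarrow> 'z"
    using continuous_map_compose[OF coordZ[OF that(1)], of euclidean g] that(2) by (simp add: o_def)
  have closed_eq: "closedin X {z \<in> topspace X. lr e (z (x, e)) = z (x, rid e) \<and> ls e (z (x, e)) = z (x \<cdot> e, sid e)}"
    if "edge e" "(x, e) \<in> cells w" for x e
  proof -
    have "closedin X {z \<in> topspace X. lr e (z (x, e)) = z (x, rid e)}"
      "closedin X {z \<in> topspace X. ls e (z (x, e)) = z (x \<cdot> e, sid e)}"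
      using comp[OF that(2) continuous_lr[OF that(1)]] comp[OF that(2) continuous_ls[OF that(1)]] coord
      by (intro closedin_continuous_maps_eq[OF Hausdorff_space_euclidean]; blast)+
    then have "closedin X ({z \<in> topspace X. lr e (z (x, e)) = z (x, rid e)} \<inter>
        {z \<in> topspace X. ls e (z (x, e)) = z (x \<cdot> e, sid e)})"
      by (rule closedin_Int)
    then show ?thesis
      by (rule back_subst[where P = "closedin X"]) blast
  qed
  have closed_sq': "closedin X {z \<in> topspace X. sq e f f' e' (z (x, e)) (z (x \<cdot> e, f)) (z (x, f')) (z (x \<cdot> f', e'))}"
    if "square e f f' e'" for x e f f' e'
  proof -
    have "continuous_map X euclidean (\<lambda>z. (z (x, e), z (x \<cdot> e, f), z (x, f'), z (x \<cdot> f', e')))"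
      unfolding prod_topology_euclidean[symmetric] continuous_map_pairwise o_def using coord by simp
    moreover have "closedin euclidean {(a, b, b', a'). sq e f f' e' a b b' a'}"
      using closed_sq[OF that] by simp
    ultimately have "closedin X {z \<in> topspace X. (z (x, e), z (x \<cdot> e, f), z (x, f'), z (x \<cdot> f', e'))
        \<in> {(a, b, b', a'). sq e f f' e' a b b' a'}}"
      by (rule closedin_continuous_map_preimage)
    then show ?thesis by simp
  qed
  define P where "P = (\<lambda>(x, e). edge e \<and> (x, e) \<in> cells w)"
  define Q where "Q = (\<lambda>(x, e) z. lr e (z (x, e)) = z (x, rid e) \<and> ls e (z (x, e)) = z (x \<cdot> e, sid e))"
  define P' where "P' = (\<lambda>(x, e, f, f', e'). square e f f' e' \<and> cpb x e \<and> prefix (x \<cdot> (e \<cdot> f)) w)"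
  define Q' where "Q' = (\<lambda>(x, e, f, f', e') z. sq e f f' e' (z (x, e)) (z (x \<cdot> e, f)) (z (x, f')) (z (x \<cdot> f', e')))"
  have "(\<forall>p. z p \<in> K p) \<longleftrightarrow> (\<forall>p. p \<notin> cells w \<longrightarrow> z p = undefined) \<and> (\<forall>p\<in>cells w. z p \<in> Z)" for z
    unfolding K_def by (metis singleton_iff)
  then have "{z. labelling w z} = {z \<in> topspace X. \<forall>i. P i \<longrightarrow> Q i z} \<inter> {z \<in> topspace X. \<forall>i. P' i \<longrightarrow> Q' i z}"
    unfolding labelling_def P_def Q_def P'_def Q'_def tX by simp blast
  moreover have "closedin X {z \<in> topspace X. \<forall>i. P i \<longrightarrow> Q i z}"
    using closed_eq by (intro closedin_Collect_all) (clarsimp simp: P_def Q_def)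
  moreover have "closedin X {z \<in> topspace X. \<forall>i. P' i \<longrightarrow> Q' i z}"
    using closed_sq' by (intro closedin_Collect_all) (clarsimp simp: P'_def Q'_def)
  ultimately have "closedin X {z. labelling w z}"
    by (simp add: closedin_Int)
  then have "compactin X {z. labelling w z}"
    using X closedin_compact_space by blast
  then have "compact {z. labelling w z}"
    unfolding X_def by (simp add: compactin_subtopology)
  then show ?thesis
    unfolding labels_def by (simp add: compact_space_subtopology)
qed

end

section \<open>Gluing, and the labellings of vertices and single edges\<close>

context labelled_kgraph
begin

definition glue :: "'e \<Rightarrow> 'e \<Rightarrow> ('e \<times> 'e \<Rightarrow> 'z) \<Rightarrow> ('e \<times> 'e \<Rightarrow> 'z) \<Rightarrow> 'e \<times> 'e \<Rightarrow> 'z" where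
  "glue x y z z' = (THE w. labelling (x \<cdot> y) w \<and> front x w = z \<and> rear x y w = z')"

lemma glue:
  assumes "cpb x y" "labelling x z" "labelling y z'" "z (x, sid x) = z' (rid y, rid y)"
  shows "labelling (x \<cdot> y) (glue x y z z')" "front x (glue x y z z') = z" "rear x y (glue x y z z') = z'"
  using theI'[OF labelling_fill[OF assms]] unfolding glue_def by blast+

lemma labelling_glueable:
  assumes "cpb x y"
  shows "front x w (x, sid x) = rear x y w (rid y, rid y)"
  using front_apply[OF cells_ends(2)] rear_range[OF assms] assms cpb_arrow by metis

lemma glue_front_rear:
  assumes "cpb x y" "labelling (x \<cdot> y) w"
  shows "glue x y (front x w) (rear x y w) = w"
  unfolding glue_def
  by (rule the1_equality[OF labelling_fill[OF assms(1) labelling_front[OF assms] labelling_rear[OF assms]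
    labelling_glueable[OF assms(1)]]]) (use assms in blast)

lemma front_front:
  assumes "cpb x y"
  shows "front x (front (x \<cdot> y) w) = front x w"
  using cells_prefix[OF assms] by (auto simp: front_def)

lemma front_self: "labelling x z \<Longrightarrow> front x z = z"
  using labellingD(1) by (fastforce simp: front_def)

lemma rear_vertex:
  assumes "vertex x" "cpb x y" "labelling y w"
  shows "rear x y w = w"
proof
  fix p :: "'e \<times> 'e"
  obtain u e where p: "p = (u, e)" by (cases p)
  show "rear x y w p = w p"
  proof (cases "(u, e) \<in> cells y")
    case True
    then have "cpb x u"
      using assms(2) unfolding cells_def prefix_def by (auto simp: cpb_def)
    then show ?thesis
      using comp_vertex(1)[OF assms(1)] rear_apply[OF True] p by simp
  next
    case False
    then show ?thesis
      using labellingD(1)[OF assms(3)] p by (simp add: rear_def)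
  qed
qed

definition const_label :: "'e \<Rightarrow> 'z \<Rightarrow> 'e \<times> 'e \<Rightarrow> 'z" where
  "const_label x a = (\<lambda>p. if p = (x, x) then a else undefined)"

lemma labelling_vertex_iff:
  assumes "vertex x"
  shows "labelling x z \<longleftrightarrow> (\<exists>a\<in>Z. z = const_label x a)"
proof
  assume z: "labelling x z"
  have "z = const_label x (z (x, x))"
    using labellingD(1)[OF z] cells_vertex[OF assms] by (auto simp: const_label_def)
  moreover have "z (x, x) \<in> Z"
    using labellingD(2)[OF z] cells_vertex[OF assms] by simp
  ultimately show "\<exists>a\<in>Z. z = const_label x a" by blast
next
  assume "\<exists>a\<in>Z. z = const_label x a"
  then obtain a where a: "a \<in> Z" "z = const_label x a" by blast
  have no_edge: False if "edge e" "(u, e) \<in> cells x" for u e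
    using that cells_vertex[OF assms] edge_not_vertex assms by auto
  show "labelling x z"
    unfolding labelling_def
  proof (intro conjI allI ballI impI)
    fix u e f f' e' assume "square e f f' e'" "cpb u e" "prefix (u \<cdot> (e \<cdot> f)) x"
    then show "sq e f f' e' (z (u, e)) (z (u \<cdot> e, f)) (z (u, f')) (z (u \<cdot> f', e'))"
      using cells_of_square(1) squareD(1) no_edge by blast
  qed (use a no_edge cells_vertex[OF assms] in \<open>auto simp: const_label_def\<close>)
qed

lemma inj_on_vertex_label:
  assumes "vertex v"
  shows "inj_on (\<lambda>z. z (v, v)) {z. labelling v z}"
  by (rule inj_onI) (auto simp: labelling_vertex_iff[OF assms] const_label_def)

lemma labelling_edge_exists:
  assumes "edge e" "a \<in> Z"
  shows "\<exists>z. labelling e z \<and> z (rid e, e) = a"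
proof -
  have v: "vertex (sid e)" "cpb e (sid e)" "e \<cdot> sid e = e"
    using assms(1) by simp_all
  have r: "rid (sid e) = sid e"
    using assms(1) by simp
  have "labelling (sid e) (const_label (sid e) (ls e a))"
    using labelling_vertex_iff[OF v(1)] ls_closed[OF assms] by blast
  then show ?thesis
    using edge_fill_exists[OF assms(1) v(2) _ assms(2)] v(3) r by (metis const_label_def)
qed

lemma labelling_edge_unique:
  assumes "edge e" "labelling e z" "labelling e z'" "z (rid e, e) = z' (rid e, e)"
  shows "z = z'"
proof -
  have v: "vertex (sid e)" "cpb e (sid e)" "e \<cdot> sid e = e"
    using assms(1) by simp_all
  have c: "(rid e, e) \<in> cells e"
    using cells_first_edge[OF assms(1) v(2)] v(3) by simp
  have "rear e (sid e) z = rear e (sid e) z'"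
  proof -
    obtain a where a: "rear e (sid e) z = const_label (sid e) a"
      using labelling_rear[OF v(2), of z] assms(2) v(1,3) labelling_vertex_iff by metis
    obtain b where b: "rear e (sid e) z' = const_label (sid e) b"
      using labelling_rear[OF v(2), of z'] assms(3) v(1,3) labelling_vertex_iff by metis
    have "z (e, sid e) = z' (e, sid e)"
      using labellingD(4)[OF assms(2,1) c] labellingD(4)[OF assms(3,1) c] assms(1,4) by simp
    then have "rear e (sid e) z (rid (sid e), rid (sid e)) = rear e (sid e) z' (rid (sid e), rid (sid e))"
      using rear_range[OF v(2)] by simp
    moreover have "rid (sid e) = sid e" using assms(1) by simp
    ultimately show ?thesis
      using a b by (simp add: const_label_def)
  qed
  then show ?thesis
    using edge_fill_unique[OF assms(1) v(2)] v(3) assms by metis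
qed

lemma inj_on_edge_label: "edge e \<Longrightarrow> inj_on (\<lambda>z. z (rid e, e)) {z. labelling e z}"
  using labelling_edge_unique by (auto intro!: inj_onI)

end

section \<open>The source map on spaces of labellings\<close>

context topological_labelled_kgraph
begin

lemma continuous_map_front: "cpb x y \<Longrightarrow> continuous_map (labels (x \<cdot> y)) (labels x) (front x)"
  unfolding continuous_map_into_labels front_def
  using labelling_front continuous_map_coordinate by (auto simp: front_def)

lemma continuous_map_rear: "cpb x y \<Longrightarrow> continuous_map (labels (x \<cdot> y)) (labels y) (rear x y)"
  unfolding continuous_map_into_labels
  using labelling_rear continuous_map_coordinate by (auto simp: rear_def)

text \<open>By unique filling, a labelling of \<open>e \<cdot> y\<close> is a label of e together
  with a labelling of y that match at the vertex between them. This bijection onto the fibre product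
  is continuous from a compact to a Hausdorff space, hence a homeomorphism, and it turns
  \<open>rear e y\<close> into the pullback of \<open>ls e\<close>.\<close>

lemma rear_local_homeo:
  assumes "edge e" "cpb e y"
  shows "local_homeomorphism_map (labels (e \<cdot> y)) (labels y) (rear e y)"
proof -
  have y: "(rid y, rid y) \<in> cells y" using cells_ends(1) assms(2) cpb_arrow by blast
  have c: "(rid e, e) \<in> cells (e \<cdot> y)" by (rule cells_first_edge[OF assms])
  let ?P = "fibre_product (top_of_set Z) (ls e) (labels y) (\<lambda>z. z (rid y, rid y))"
  let ?h = "\<lambda>z. (z (rid e, e), rear e y z)"
  have compat: "ls e (z (rid e, e)) = rear e y z (rid y, rid y)" if "labelling (e \<cdot> y) z" for z
    using labellingD(4)[OF that assms(1) c] rear_range[OF assms(2)] assms(1) by simp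
  have "homeomorphic_map (labels (e \<cdot> y)) ?P ?h"
  proof (rule continuous_imp_homeomorphic_map)
    show "continuous_map (labels (e \<cdot> y)) ?P ?h"
      unfolding continuous_map_fibre_product
      using continuous_map_coordinate_Z[OF c] continuous_map_rear[OF assms(2)] compat by simp
    show "compact_space (labels (e \<cdot> y))" by (rule compact_space_labels)
    show "Hausdorff_space ?P"
      unfolding fibre_product_def using Hausdorff_space_labels
      by (intro Hausdorff_space_subtopology) (simp add: Hausdorff_space_prod_topology Hausdorff_space_subtopology Hausdorff_space_euclidean)
    show "?h ` topspace (labels (e \<cdot> y)) = topspace ?P"
    proof
      show "?h ` topspace (labels (e \<cdot> y)) \<subseteq> topspace ?P"
        using compat labellingD(2)[OF _ c] labelling_rear[OF assms(2)] by (auto simp: topspace_fibre_product)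
      show "topspace ?P \<subseteq> ?h ` topspace (labels (e \<cdot> y))"
      proof
        fix p assume "p \<in> topspace ?P"
        then obtain a z where p: "p = (a, z)" "a \<in> Z" "labelling y z" "ls e a = z (rid y, rid y)"
          by (auto simp: topspace_fibre_product)
        obtain w where "labelling (e \<cdot> y) w" "w (rid e, e) = a" "rear e y w = z"
          using edge_fill_exists[OF assms p(3,2,4)] by blast
        then show "p \<in> ?h ` topspace (labels (e \<cdot> y))"
          using p(1) by (intro image_eqI[of _ _ w]) simp_all
      qed
    qed
    show "inj_on ?h (topspace (labels (e \<cdot> y)))"
      using edge_fill_unique[OF assms] by (auto intro!: inj_onI)
  qed
  from local_homeomorphism_map_compose[OF local_homeomorphism_map_homeomorphic[OF this]
    local_homeomorphism_map_pullback[OF local_homeo_ls[OF assms(1)] continuous_map_coordinate_Z[OF y]]]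
  show ?thesis by simp
qed

lemma source_local_homeo:
  assumes "w \<in> arrows"
  shows "local_homeomorphism_map (labels w) (top_of_set Z) (\<lambda>z. z (w, sid w))"
  using assms
proof (induction rule: arrow_induct)
  case (vertex v)
  have "homeomorphic_map (labels v) (top_of_set Z) (\<lambda>z. z (v, v))"
  proof (rule continuous_imp_homeomorphic_map)
    show "continuous_map (labels v) (top_of_set Z) (\<lambda>z. z (v, v))"
      by (rule continuous_map_coordinate_Z) (simp add: cells_vertex[OF vertex])
    show "Hausdorff_space (top_of_set Z)"
      by (simp add: Hausdorff_space_subtopology Hausdorff_space_euclidean)
    show "(\<lambda>z. z (v, v)) ` topspace (labels v) = topspace (top_of_set Z)"
    proof
      show "(\<lambda>z. z (v, v)) ` topspace (labels v) \<subseteq> topspace (top_of_set Z)"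
        using labellingD(2) cells_vertex[OF vertex] by auto
      show "topspace (top_of_set Z) \<subseteq> (\<lambda>z. z (v, v)) ` topspace (labels v)"
      proof
        fix a assume "a \<in> topspace (top_of_set Z)"
        then have "labelling v (const_label v a)"
          using labelling_vertex_iff[OF vertex] by auto
        then show "a \<in> (\<lambda>z. z (v, v)) ` topspace (labels v)"
          by (intro image_eqI[of _ _ "const_label v a"]) (simp_all add: const_label_def)
      qed
    qed
    show "inj_on (\<lambda>z. z (v, v)) (topspace (labels v))"
      using inj_on_vertex_label[OF vertex] by simp
  qed (rule compact_space_labels)
  then show ?case
    using local_homeomorphism_map_homeomorphic sid_vertex[OF vertex] by simp
next
  case (edge e y)
  have "local_homeomorphism_map (labels (e \<cdot> y)) (top_of_set Z) (\<lambda>z. rear e y z (y, sid y))"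
    using local_homeomorphism_map_compose[OF rear_local_homeo[OF edge(1,2)] edge(3)] .
  then show ?case
    using rear_source[OF edge(2)] edge(2) by simp
qed

end

lemma open_map_Pair_discrete:
  assumes "v \<in> V"
  shows "open_map X (prod_topology (discrete_topology V) X) (Pair v)"
  unfolding open_map_def
proof (intro allI impI)
  fix U assume "openin X U"
  then have "openin (prod_topology (discrete_topology V) X) ({v} \<times> U)"
    using assms by (simp add: openin_prod_Times_iff)
  moreover have "Pair v ` U = {v} \<times> U"
    by auto
  ultimately show "openin (prod_topology (discrete_topology V) X) (Pair v ` U)"
    by (simp only:)
qed

section \<open>The topological graph of labelled paths\<close>

context topological_labelled_kgraph
begin

definition labelled_graph :: "('v \<times> 'z, 'e \<times> ('e \<times> 'e \<Rightarrow> 'z)) kgraph_data" where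
  "labelled_graph = \<lparr>Obj = prod_topology (Obj \<Gamma>) (top_of_set Z), Mor = sum_topology labels arrows,
     rng = \<lambda>(w, z). (rng \<Gamma> w, z (rid w, rid w)), source = \<lambda>(w, z). (source \<Gamma> w, z (w, sid w)),
     ident = \<lambda>(v, a). (ident \<Gamma> v, const_label (ident \<Gamma> v) a),
     cat_comp = \<lambda>(x, z) (y, z'). (x \<cdot> y, glue x y z z'), deg = \<lambda>(w, z). deg \<Gamma> w\<rparr>"

abbreviation "G \<equiv> labelled_graph"

lemma G_simps [simp]:
  "Obj G = prod_topology (Obj \<Gamma>) (top_of_set Z)" "Mor G = sum_topology labels arrows"
  "rng G (w, z) = (rng \<Gamma> w, z (rid w, rid w))" "source G (w, z) = (source \<Gamma> w, z (w, sid w))"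
  "ident G (v, a) = (ident \<Gamma> v, const_label (ident \<Gamma> v) a)"
  "cat_comp G (x, z) (y, z') = (x \<cdot> y, glue x y z z')" "deg G (w, z) = deg \<Gamma> w"
  by (simp_all add: labelled_graph_def)

lemma G_composable_iff:
  "((x, z), (y, z')) \<in> topspace (composable G) \<longleftrightarrow>
     cpb x y \<and> labelling x z \<and> labelling y z' \<and> z (x, sid x) = z' (rid y, rid y)"
  unfolding composable_def topspace_fibre_product by (auto simp: cpb_def)

lemma glue_ends:
  assumes "cpb x y" "labelling x z" "labelling y z'" "z (x, sid x) = z' (rid y, rid y)"
  shows "glue x y z z' (rid x, rid x) = z (rid x, rid x)"
    and "glue x y z z' (x \<cdot> y, sid y) = z' (y, sid y)"
  using front_apply[OF cells_ends(1)[OF cpb_arrow(1)[OF assms(1)]], of "glue x y z z'"]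
    rear_source[OF assms(1), of "glue x y z z'"] glue[OF assms] by simp_all

text \<open>The labelling on the right restricts to a, b and c on the three segments. Its
  restriction to the first two is therefore \<open>glue x y a b\<close>, and uniqueness of gluing
  identifies it with the left-hand side.\<close>

lemma glue_assoc:
  assumes "cpb x y" "cpb y v" "labelling x a" "labelling y b" "labelling v c"
    and "a (x, sid x) = b (rid y, rid y)" "b (y, sid y) = c (rid v, rid v)"
  shows "glue (x \<cdot> y) v (glue x y a b) c = glue x (y \<cdot> v) a (glue y v b c)"
proof -
  let ?g = "glue y v b c"
  let ?w = "glue x (y \<cdot> v) a ?g"
  note g = glue[OF assms(2,4,5,7)]
  have xyv: "cpb x (y \<cdot> v)" "cpb (x \<cdot> y) v" using assms(1,2) by simp_all
  have "a (x, sid x) = ?g (rid (y \<cdot> v), rid (y \<cdot> v))"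
    using glue_ends(1)[OF assms(2,4,5,7)] assms(2,6) by simp
  note w = glue[OF xyv(1) assms(3) g(1) this]
  have lw: "labelling ((x \<cdot> y) \<cdot> v) ?w"
    using w(1) assoc[OF assms(1,2)] by metis
  have "front x (front (x \<cdot> y) ?w) = a"
    using front_front[OF assms(1)] w(2) by metis
  moreover have "rear x y (front (x \<cdot> y) ?w) = b"
    using front_rear[OF assms(1,2), of ?w] w(3) g(2) by metis
  ultimately have "front (x \<cdot> y) ?w = glue x y a b"
    using glue_front_rear[OF assms(1) labelling_front[OF xyv(2) lw]] by metis
  moreover have "rear (x \<cdot> y) v ?w = c"
    using rear_rear[OF assms(1,2), of ?w] w(3) g(3) by metis
  ultimately show ?thesis
    using glue_front_rear[OF xyv(2) lw] by metis
qed

lemma glue_rid: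
  assumes "x \<in> arrows" "labelling x z"
  shows "glue (rid x) x (const_label (rid x) (z (rid x, rid x))) z = z"
proof -
  have v: "vertex (rid x)" "cpb (rid x) x" "rid x \<cdot> x = x" using assms(1) by simp_all
  have "front (rid x) z = const_label (rid x) (z (rid x, rid x))"
    using cells_vertex[OF v(1)] by (auto simp: front_def const_label_def)
  then show ?thesis
    using glue_front_rear[OF v(2), of z] rear_vertex[OF v(1,2) assms(2)] assms(2) v(3) by metis
qed

lemma glue_sid:
  assumes "x \<in> arrows" "labelling x z"
  shows "glue x (sid x) z (const_label (sid x) (z (x, sid x))) = z"
proof -
  have v: "vertex (sid x)" "cpb x (sid x)" "x \<cdot> sid x = x" using assms(1) by simp_all
  have "rear x (sid x) z = const_label (sid x) (z (x, sid x))"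
    using cells_vertex[OF v(1)] v(3) by (auto simp: rear_def const_label_def)
  then show ?thesis
    using glue_front_rear[OF v(2), of z] front_self[OF assms(2)] assms(2) v(3) by metis
qed

lemma labels_ends:
  assumes "w \<in> arrows" "labelling w z"
  shows "z (rid w, rid w) \<in> Z" "z (w, sid w) \<in> Z"
  using labellingD(2)[OF assms(2)] cells_ends[OF assms(1)] by blast+

lemma labelling_const_label: "vertex x \<Longrightarrow> a \<in> Z \<Longrightarrow> labelling x (const_label x a)"
  using labelling_vertex_iff by blast

lemma small_category_G: "small_category G"
proof unfold_locales
  fix x assume "x \<in> topspace (Mor G)"
  then obtain w z where x: "x = (w, z)" "w \<in> arrows" "labelling w z" by auto
  note e = labels_ends[OF x(2,3)]
  show "rng G x \<in> topspace (Obj G)" "source G x \<in> topspace (Obj G)"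
    using x e rng_obj source_obj by simp_all
  show "cat_comp G (ident G (rng G x)) x = x" "cat_comp G x (ident G (source G x)) = x"
    using x glue_rid glue_sid by simp_all
next
  fix v assume "v \<in> topspace (Obj G)"
  then obtain u a where v: "v = (u, a)" "u \<in> topspace (Obj \<Gamma>)" "a \<in> Z" by auto
  then show "ident G v \<in> topspace (Mor G)" "rng G (ident G v) = v" "source G (ident G v) = v"
    using labelling_const_label[of "ident \<Gamma> u" a]
    by (simp_all add: ident_mor rng_ident source_ident const_label_def)
next
  fix x y assume xy: "(x, y) \<in> topspace (composable G)"
  obtain w z where x: "x = (w, z)" by (cases x)
  obtain w' z' where y: "y = (w', z')" by (cases y)
  note c = xy[unfolded x y G_composable_iff]
  have c': "cpb w w'" "labelling w z" "labelling w' z'" "z (w, sid w) = z' (rid w', rid w')"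
    using c by blast+
  show "cat_comp G x y \<in> topspace (Mor G)" "rng G (cat_comp G x y) = rng G x"
    "source G (cat_comp G x y) = source G y"
    using x y c'(1) glue(1)[OF c'] glue_ends[OF c'] by simp_all
next
  fix x y t assume xy: "(x, y) \<in> topspace (composable G)" "(y, t) \<in> topspace (composable G)"
  obtain w z where x: "x = (w, z)" by (cases x)
  obtain w' z' where y: "y = (w', z')" by (cases y)
  obtain v a where t: "t = (v, a)" by (cases t)
  note c = xy[unfolded x y t G_composable_iff]
  show "cat_comp G (cat_comp G x y) t = cat_comp G x (cat_comp G y t)"
    using x y t glue_assoc assoc c by simp
qed

text \<open>The pairs lying over fixed paths x and y form an open set, and splitting maps the
  compact space of labellings bijectively onto it. Locally composition is thus the inverse of a
  homeomorphism.\<close>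

lemma split_homeo:
  assumes "cpb x y"
  shows "continuous_map (labels (x \<cdot> y)) (composable G) (\<lambda>w. ((x, front x w), (y, rear x y w)))" (is "continuous_map _ _ ?s")
    and "open_map (labels (x \<cdot> y)) (composable G) (\<lambda>w. ((x, front x w), (y, rear x y w)))"
proof -
  note xa = cpb_arrow[OF assms]
  have inC: "?s w \<in> topspace (composable G)" if "labelling (x \<cdot> y) w" for w
    unfolding G_composable_iff
    using assms labelling_front[OF assms that] labelling_rear[OF assms that] labelling_glueable[OF assms] by blast
  have cx: "continuous_map (labels (x \<cdot> y)) (sum_topology labels arrows) (\<lambda>w. (x, front x w))"
    using continuous_map_compose[OF continuous_map_front[OF assms] continuous_map_component_injection[of x arrows labels, OF xa(1)]]
    by (simp add: o_def)
  have cy: "continuous_map (labels (x \<cdot> y)) (sum_topology labels arrows) (\<lambda>w. (y, rear x y w))"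
    using continuous_map_compose[OF continuous_map_rear[OF assms] continuous_map_component_injection[of y arrows labels, OF xa(2)]]
    by (simp add: o_def)
  show cont: "continuous_map (labels (x \<cdot> y)) (composable G) ?s"
  proof -
    have "source G (fst (?s w)) = rng G (snd (?s w))" if "w \<in> topspace (labels (x \<cdot> y))" for w
      using inC[of w] that unfolding composable_def topspace_fibre_product
      by (simp only: topspace_labels mem_Collect_eq prod.case fst_conv snd_conv)
    then show ?thesis
      unfolding composable_def continuous_map_fibre_product using cx cy
      by (auto simp only: fst_conv snd_conv G_simps(2))
  qed
  \<comment> \<open>The composable pairs lying over the paths x and y; this set is open because the
    summands of the morphism space are.\<close>
  define P where "P = (Pair x ` topspace (labels x) \<times> Pair y ` topspace (labels y)) \<inter> {(p, q). source G p = rng G q}"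
  have "openin (prod_topology (sum_topology labels arrows) (sum_topology labels arrows))
      (Pair x ` topspace (labels x) \<times> Pair y ` topspace (labels y))"
    using openin_component_image[of x arrows labels, OF xa(1) openin_topspace]
      openin_component_image[of y arrows labels, OF xa(2) openin_topspace] by (simp only: openin_prod_Times_iff simp_thms)
  then have P: "openin (composable G) P"
    unfolding composable_def fibre_product_def openin_subtopology P_def by auto
  have tP: "topspace (subtopology (composable G) P) = P"
    using openin_subset[OF P] by auto
  have surj: "p \<in> ?s ` topspace (labels (x \<cdot> y))" if pP: "p \<in> P" for p
  proof -
    obtain z z' where p: "p = ((x, z), (y, z'))"
      using pP unfolding P_def by (elim IntE SigmaE imageE) simp
    then have "((x, z), (y, z')) \<in> topspace (composable G)"
      using pP openin_subset[OF P] by blast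
    then have c: "cpb x y" "labelling x z" "labelling y z'" "z (x, sid x) = z' (rid y, rid y)"
      unfolding G_composable_iff by blast+
    show ?thesis
      using glue[OF c] p by (intro image_eqI[of _ _ "glue x y z z'"]) simp_all
  qed
  have sP: "?s w \<in> P" if "labelling (x \<cdot> y) w" for w
    using inC[OF that] unfolding P_def composable_def topspace_fibre_product by auto
  have "homeomorphic_map (labels (x \<cdot> y)) (subtopology (composable G) P) ?s"
  proof (rule continuous_imp_homeomorphic_map)
    show "continuous_map (labels (x \<cdot> y)) (subtopology (composable G) P) ?s"
      unfolding continuous_map_in_subtopology using cont sP by auto
    show "Hausdorff_space (subtopology (composable G) P)"
      unfolding composable_def fibre_product_def
      by (intro Hausdorff_space_subtopology) (simp add: Hausdorff_space_prod_topology Hausdorff_space_sum_topology Hausdorff_space_labels)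
    show "?s ` topspace (labels (x \<cdot> y)) = topspace (subtopology (composable G) P)"
      unfolding tP topspace_labels using sP surj unfolding topspace_labels by blast
    show "inj_on ?s (topspace (labels (x \<cdot> y)))"
    proof (rule inj_onI)
      fix w w' assume "w \<in> topspace (labels (x \<cdot> y))" "w' \<in> topspace (labels (x \<cdot> y))" "?s w = ?s w'"
      then have "labelling (x \<cdot> y) w" "labelling (x \<cdot> y) w'" "front x w = front x w'" "rear x y w = rear x y w'"
        by simp_all
      then show "w = w'" using glue_front_rear[OF assms] by metis
    qed
  qed (rule compact_space_labels)
  then have "open_map (labels (x \<cdot> y)) (subtopology (composable G) P) ?s"
    by (rule homeomorphic_imp_open_map)
  then show "open_map (labels (x \<cdot> y)) (composable G) ?s"
    unfolding open_map_def openin_open_subtopology[OF P] by blast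
qed

lemma comp_split:
  assumes "cpb x y" "labelling (x \<cdot> y) w"
  shows "cat_comp G (x, front x w) (y, rear x y w) = (x \<cdot> y, w)"
  using glue_front_rear[OF assms] by simp

lemma split_comp:
  assumes "((x, z), (y, z')) \<in> topspace (composable G)"
  obtains w where "cpb x y" "labelling (x \<cdot> y) w" "z = front x w" "z' = rear x y w"
    "cat_comp G (x, z) (y, z') = (x \<cdot> y, w)"
proof -
  have c: "cpb x y" "labelling x z" "labelling y z'" "z (x, sid x) = z' (rid y, rid y)"
    using assms unfolding G_composable_iff by blast+
  show thesis using that[of "glue x y z z'"] c(1) glue[OF c] by simp
qed

text \<open>Over fixed paths, preimages under composition are images under splitting, which is
  open.\<close>

lemma G_continuous_comp: "continuous_map (composable G) (Mor G) (\<lambda>(x, y). cat_comp G x y)"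
  unfolding continuous_map_def
proof (intro conjI allI impI)
  interpret small_category G by (rule small_category_G)
  show "(\<lambda>(x, y). cat_comp G x y) \<in> topspace (composable G) \<rightarrow> topspace (Mor G)"
    using comp_mor by auto
  fix V assume V: "openin (Mor G) V"
  show "openin (composable G) {p \<in> topspace (composable G). (case p of (x, y) \<Rightarrow> cat_comp G x y) \<in> V}" (is "openin _ ?U")
  proof (subst openin_subopen, intro ballI)
    fix p assume p: "p \<in> ?U"
    obtain x z y z' where pe: "p = ((x, z), (y, z'))" by (metis surj_pair)
    then obtain w where w: "cpb x y" "labelling (x \<cdot> y) w" "z = front x w" "z' = rear x y w"
      "cat_comp G (x, z) (y, z') = (x \<cdot> y, w)"
      using p split_comp by blast
    let ?s = "\<lambda>w. ((x, front x w), (y, rear x y w))"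
    let ?T = "{w \<in> topspace (labels (x \<cdot> y)). (x \<cdot> y, w) \<in> V}"
    have "openin (labels (x \<cdot> y)) ?T"
      using openin_continuous_map_preimage[OF continuous_map_component_injection[of "x \<cdot> y" arrows labels]] w(1) V by simp
    then have "openin (composable G) (?s ` ?T)"
      using split_homeo(2)[OF w(1)] unfolding open_map_def by blast
    moreover have "p \<in> ?s ` ?T"
      using p pe w by (intro image_eqI[of _ _ w]) simp_all
    moreover have "?s ` ?T \<subseteq> ?U"
    proof
      fix q assume "q \<in> ?s ` ?T"
      then obtain w' where w': "q = ?s w'" "labelling (x \<cdot> y) w'" "(x \<cdot> y, w') \<in> V" by auto
      have "q \<in> topspace (composable G)"
        using \<open>openin (composable G) (?s ` ?T)\<close> \<open>q \<in> ?s ` ?T\<close> openin_subset by blast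
      then show "q \<in> ?U"
        using w' comp_split[OF w(1) w'(2)] by simp
    qed
    ultimately show "\<exists>T. openin (composable G) T \<and> p \<in> T \<and> T \<subseteq> ?U" by blast
  qed
qed

text \<open>Dually, over fixed paths the image of an open set under composition is its preimage
  under the continuous splitting map.\<close>

lemma G_open_comp: "open_map (composable G) (Mor G) (\<lambda>(x, y). cat_comp G x y)"
  unfolding open_map_def
proof (intro allI impI)
  fix W assume W: "openin (composable G) W"
  let ?c = "\<lambda>(x, y). cat_comp G x y"
  show "openin (Mor G) (?c ` W)"
  proof (subst openin_subopen, intro ballI)
    fix t assume "t \<in> ?c ` W"
    then obtain p where p: "p \<in> W" "t = ?c p" by blast
    obtain x z y z' where pe: "p = ((x, z), (y, z'))" by (metis surj_pair)
    then obtain w where w: "cpb x y" "labelling (x \<cdot> y) w" "z = front x w" "z' = rear x y w"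
      "cat_comp G (x, z) (y, z') = (x \<cdot> y, w)"
      using p(1) openin_subset[OF W] split_comp by blast
    let ?s = "\<lambda>w. ((x, front x w), (y, rear x y w))"
    let ?T = "{w \<in> topspace (labels (x \<cdot> y)). ?s w \<in> W}"
    have "openin (labels (x \<cdot> y)) ?T"
      by (rule openin_continuous_map_preimage[OF split_homeo(1)[OF w(1)] W])
    then have "openin (Mor G) (Pair (x \<cdot> y) ` ?T)"
      using openin_component_image[of "x \<cdot> y" arrows labels] w(1) by simp
    moreover have "t \<in> Pair (x \<cdot> y) ` ?T"
      using p pe w by auto
    moreover have "Pair (x \<cdot> y) ` ?T \<subseteq> ?c ` W"
    proof
      fix q assume "q \<in> Pair (x \<cdot> y) ` ?T"
      then obtain w' where w': "q = (x \<cdot> y, w')" "labelling (x \<cdot> y) w'" "?s w' \<in> W" by auto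
      then show "q \<in> ?c ` W"
        using comp_split[OF w(1) w'(2)] by (intro image_eqI[of _ _ "?s w'"]) simp_all
    qed
    ultimately show "\<exists>T. openin (Mor G) T \<and> t \<in> T \<and> T \<subseteq> ?c ` W" by blast
  qed
qed

lemma G_kgraph: "topological_kgraph k G"
proof -
  interpret G: small_category G by (rule small_category_G)
  have Obj: "Obj G = prod_topology (discrete_topology (topspace (Obj \<Gamma>))) (top_of_set Z)"
    using discrete_Obj by simp
  have HZ: "Hausdorff_space (top_of_set Z)"
    by (simp add: Hausdorff_space_subtopology Hausdorff_space_euclidean)
  show ?thesis
  proof unfold_locales
    fix x assume "x \<in> topspace (Mor G)"
    then show "deg G x \<in> degrees k"
      using deg_degrees by (cases x) simp
  next
    fix v assume "v \<in> topspace (Obj G)"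
    then show "deg G (ident G v) = 0"
      using deg_ident by (cases v) simp
  next
    fix x y assume xy: "(x, y) \<in> topspace (composable G)"
    obtain w z where x: "x = (w, z)" by (cases x)
    obtain w' z' where y: "y = (w', z')" by (cases y)
    show "deg G (cat_comp G x y) = deg G x + deg G y"
      using xy unfolding x y G_composable_iff by simp
  next
    show "Hausdorff_space (Obj G)"
      unfolding Obj using HZ by (simp add: Hausdorff_space_prod_topology Hausdorff_space_discrete_topology)
    have "locally_compact_space (top_of_set Z)"
      using compact_Z by (intro compact_imp_locally_compact_space) (simp add: compact_space_subtopology)
    then show "locally_compact_space (Obj G)"
      unfolding Obj by (simp add: locally_compact_space_prod_topology locally_compact_space_discrete_topology)
    show "locally_compact_space (Mor G)" "Hausdorff_space (Mor G)"
      using compact_space_labels Hausdorff_space_labels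
      by (simp_all add: locally_compact_space_sum_topology Hausdorff_space_sum_topology)
    show "continuous_map (Mor G) (Obj G) (rng G)"
      unfolding G_simps(2) continuous_map_from_sum_topology
    proof
      fix w assume w: "w \<in> arrows"
      have "continuous_map (labels w) (Obj G) (\<lambda>z. (rng \<Gamma> w, z (rid w, rid w)))"
        using continuous_map_coordinate_Z[OF cells_ends(1)[OF w]] rng_obj[OF w]
        by (simp add: continuous_map_pairwise o_def)
      then show "continuous_map (labels w) (Obj G) (\<lambda>z. rng G (w, z))"
        by simp
    qed
    have "local_homeomorphism_map (sum_topology labels arrows) (Obj G) (source G)"
    proof (rule local_homeomorphism_map_from_sum_topology)
      fix w assume w: "w \<in> arrows"
      \<comment> \<open>Over a single path the source map takes values in one copy of Z, which is
        open because the vertices of \<Gamma> are discrete.\<close>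
      have "local_homeomorphism_map (top_of_set Z) (Obj G) (Pair (source \<Gamma> w))"
        unfolding local_homeomorphism_map_iff Obj
      proof (intro conjI ballI)
        show "continuous_map (top_of_set Z) (prod_topology (discrete_topology (topspace (Obj \<Gamma>))) (top_of_set Z)) (Pair (source \<Gamma> w))"
          using source_obj[OF w] by (simp add: continuous_map_pairwise o_def)
        show "open_map (top_of_set Z) (prod_topology (discrete_topology (topspace (Obj \<Gamma>))) (top_of_set Z)) (Pair (source \<Gamma> w))"
          by (rule open_map_Pair_discrete[OF source_obj[OF w]])
        fix a assume "a \<in> topspace (top_of_set Z)"
        then show "\<exists>U. openin (top_of_set Z) U \<and> a \<in> U \<and> inj_on (Pair (source \<Gamma> w)) U"
          by (intro exI[of _ "topspace (top_of_set Z)"]) (simp add: inj_on_def)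
      qed
      from local_homeomorphism_map_compose[OF source_local_homeo[OF w] this]
      show "local_homeomorphism_map (labels w) (Obj G) (\<lambda>z. source G (w, z))"
        by simp
    qed
    then show src: "local_homeomorphism_map (Mor G) (Obj G) (source G)"
      by simp
    show "continuous_map (Mor G) (Obj G) (source G)"
      using src unfolding local_homeomorphism_map_iff by blast
    show "continuous_map (Mor G) (discrete_topology (degrees k)) (deg G)"
      unfolding G_simps(2) continuous_map_from_sum_topology using deg_degrees by simp
  next
    show "continuous_map (composable G) (Mor G) (\<lambda>(x, y). cat_comp G x y)"
      "open_map (composable G) (Mor G) (\<lambda>(x, y). cat_comp G x y)"
      by (rule G_continuous_comp G_open_comp)+
  next
    fix t p q assume t: "t \<in> topspace (Mor G)" and pq: "p \<in> degrees k" "q \<in> degrees k" "deg G t = p + q"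
    obtain w z where w: "t = (w, z)" "w \<in> arrows" "labelling w z" using t by auto
    have "deg \<Gamma> w = p + q" using pq w by simp
    from factorization[OF w(2) this] obtain x y where xy: "cpb x y" "w = x \<cdot> y" "deg \<Gamma> x = p" "deg \<Gamma> y = q"
      by blast
    have lz: "labelling (x \<cdot> y) z" using w(3) xy(2) by simp
    \<comment> \<open>The degrees fix the two factors of the path, and the labels of the factors
      must be the two restrictions.\<close>
    let ?f = "((x, front x z), (y, rear x y z))"
    show "\<exists>!yz. yz \<in> topspace (composable G) \<and> t = cat_comp G (fst yz) (snd yz) \<and>
          deg G (fst yz) = p \<and> deg G (snd yz) = q"
    proof (rule ex1I[of _ ?f])
      have "?f \<in> topspace (composable G)"
        unfolding G_composable_iff
        using xy(1) labelling_front[OF xy(1) lz] labelling_rear[OF xy(1) lz] labelling_glueable[OF xy(1)] by blast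
      then show "?f \<in> topspace (composable G) \<and> t = cat_comp G (fst ?f) (snd ?f) \<and>
          deg G (fst ?f) = p \<and> deg G (snd ?f) = q"
        using comp_split[OF xy(1) lz] xy w(1) by simp
    next
      fix yz assume yz: "yz \<in> topspace (composable G) \<and> t = cat_comp G (fst yz) (snd yz) \<and>
          deg G (fst yz) = p \<and> deg G (snd yz) = q"
      obtain x' a y' b where e: "yz = ((x', a), (y', b))" by (metis surj_pair)
      then obtain u where u: "cpb x' y'" "labelling (x' \<cdot> y') u" "a = front x' u" "b = rear x' y' u"
        "cat_comp G (x', a) (y', b) = (x' \<cdot> y', u)"
        using yz split_comp by blast
      have eq: "x' \<cdot> y' = x \<cdot> y" "u = z" and d: "deg \<Gamma> x' = deg \<Gamma> x"
        using yz e u(5) w(1) xy(2,3) by simp_all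
      from edge_unique[OF u(1) xy(1) eq(1) d] show "yz = ?f"
        using e u(3,4) eq(2) by simp
    qed
  qed
qed

text \<open>Along the path, the prescribed range label is lifted through \<open>lr\<close> to a
  label of the first edge, which prescribes the range label of the rest. The label is arbitrary in
  the induction for this reason.\<close>

lemma labelling_range_exists:
  assumes "w \<in> arrows" "a \<in> Z"
  shows "\<exists>z. labelling w z \<and> z (rid w, rid w) = a"
  using assms
proof (induction arbitrary: a rule: arrow_induct)
  case (vertex v)
  then show ?case
    using labelling_const_label[of v a] rid_vertex[of v] by (metis const_label_def)
next
  case (edge e y)
  obtain b where b: "b \<in> Z" "lr e b = a" using lr_surj[OF edge(1,4)] by blast
  obtain z where z: "labelling y z" "z (rid y, rid y) = ls e b"
    using edge(3)[OF ls_closed[OF edge(1) b(1)]] by blast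
  obtain u where u: "labelling (e \<cdot> y) u" "u (rid e, e) = b"
    using edge_fill_exists[OF edge(1,2) z(1) b(1)] z(2) by metis
  have "u (rid (e \<cdot> y), rid (e \<cdot> y)) = a"
    using labellingD(3)[OF u(1) edge(1) cells_first_edge[OF edge(1,2)]] u(2) b(2) edge(2) by simp
  then show ?case using u(1) by blast
qed

lemma G_paths: "paths G p = (SIGMA w:paths \<Gamma> p. {z. labelling w z})"
  unfolding paths_def by auto

text \<open>In the discrete graph only finitely many paths of degree p end at v, and each
  contributes a compact space of labellings over the open neighbourhood {v} \<times> Z.\<close>

lemma G_row_finite:
  assumes "row_finite k \<Gamma>"
  shows "row_finite k G"
  unfolding row_finite_def
proof (intro ballI)
  fix p va assume p: "p \<in> degrees k" and "va \<in> topspace (Obj G)"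
  then obtain v a where va: "va = (v, a)" "v \<in> topspace (Obj \<Gamma>)" "a \<in> Z" by auto
  obtain V where V: "is_nbhd (Obj \<Gamma>) v V" "compactin (path_space \<Gamma> p) {x \<in> paths \<Gamma> p. rng \<Gamma> x \<in> V}"
    using assms p va(2) unfolding row_finite_def by blast
  have "path_space \<Gamma> p = discrete_topology (paths \<Gamma> p)"
    unfolding path_space_def by (subst discrete_Mor) (simp add: Int_absorb1 paths_def)
  then have "finite {x \<in> paths \<Gamma> p. rng \<Gamma> x \<in> V}"
    using V(2) by (simp add: compactin_discrete_topology)
  moreover have "v \<in> V" using V(1) by (auto simp: is_nbhd_def)
  ultimately have fin: "finite {x \<in> paths \<Gamma> p. rng \<Gamma> x = v}"
    by (auto elim!: rev_finite_subset)
  let ?S = "{x \<in> paths G p. rng G x \<in> {v} \<times> Z}"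
  have S: "?S = (\<Union>w\<in>{x \<in> paths \<Gamma> p. rng \<Gamma> x = v}. Pair w ` topspace (labels w))"
    unfolding G_paths using labels_ends by (auto simp: paths_def)
  have "compactin (Mor G) ?S"
    unfolding S
  proof (rule compactin_Union)
    show "finite ((\<lambda>w. Pair w ` topspace (labels w)) ` {x \<in> paths \<Gamma> p. rng \<Gamma> x = v})"
      using fin by simp
    fix K assume "K \<in> (\<lambda>w. Pair w ` topspace (labels w)) ` {x \<in> paths \<Gamma> p. rng \<Gamma> x = v}"
    then obtain w where w: "w \<in> arrows" "K = Pair w ` topspace (labels w)" by (auto simp: paths_def)
    then show "compactin (Mor G) K"
      using compactin_component_injection[of w arrows labels] compact_space_labels[of w] by (simp add: compact_space_def)
  qed
  then have "compactin (path_space G p) ?S"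
    unfolding path_space_def by (simp add: compactin_subtopology del: G_simps)
  moreover have "is_nbhd (Obj G) va ({v} \<times> Z)"
  proof -
    have "openin (Obj G) ({v} \<times> Z)"
      unfolding G_simps(1) by (subst discrete_Obj) (use va in \<open>simp add: openin_prod_Times_iff\<close>)
    then show ?thesis
      unfolding is_nbhd_def using va openin_subset[of "Obj G"] by (metis SigmaI order_refl singletonI)
  qed
  ultimately show "\<exists>V. is_nbhd (Obj G) va V \<and> compactin (path_space G p) {x \<in> paths G p. rng G x \<in> V}"
    by blast
qed

lemma G_no_source:
  assumes "no_source k \<Gamma>"
  shows "no_source k G"
  unfolding no_source_def
proof (intro ballI allI impI)
  fix p va V assume p: "p \<in> degrees k" and "va \<in> topspace (Obj G)" and V: "is_nbhd (Obj G) va V"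
  then obtain v a where va: "va = (v, a)" "v \<in> topspace (Obj \<Gamma>)" "a \<in> Z" by auto
  have "openin (Obj \<Gamma>) {v}"
    by (subst discrete_Obj) (use va in simp)
  then have "is_nbhd (Obj \<Gamma>) v {v}"
    using va(2) by (auto simp: is_nbhd_def)
  then have "{x \<in> paths \<Gamma> p. rng \<Gamma> x \<in> {v}} \<noteq> {}"
    using assms p va(2) unfolding no_source_def by blast
  then obtain w where w: "w \<in> paths \<Gamma> p" "rng \<Gamma> w = v" by blast
  obtain z where z: "labelling w z" "z (rid w, rid w) = a"
    using labelling_range_exists va(3) w(1) unfolding paths_def by blast
  have "va \<in> V" using V by (auto simp: is_nbhd_def)
  then have "(w, z) \<in> {x \<in> paths G p. rng G x \<in> V}"
    using w z va by (simp add: G_paths)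
  then show "{x \<in> paths G p. rng G x \<in> V} \<noteq> {}" by blast
qed

end

section \<open>Transport along an injection, and flips\<close>

text \<open>Renaming of morphisms along an injection F. Labellings are functions, while the theorem
  prescribes the type \<open>'e \<times> complex\<close> for morphisms; the pullback along the
  inverse makes F a homeomorphism onto its image.\<close>

definition transport :: "('e \<Rightarrow> 'f) \<Rightarrow> ('v, 'e) kgraph_data \<Rightarrow> ('v, 'f) kgraph_data" where
  "transport F \<Lambda> = (let F' = inv_into (topspace (Mor \<Lambda>)) F in
     \<lparr>Obj = Obj \<Lambda>, Mor = pullback_topology (F ` topspace (Mor \<Lambda>)) F' (Mor \<Lambda>),
      rng = \<lambda>x. rng \<Lambda> (F' x), source = \<lambda>x. source \<Lambda> (F' x), ident = \<lambda>v. F (ident \<Lambda> v),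
      cat_comp = \<lambda>x y. F (cat_comp \<Lambda> (F' x) (F' y)), deg = \<lambda>x. deg \<Lambda> (F' x)\<rparr>)"

locale kgraph_transport = topological_kgraph k \<Lambda> for k and \<Lambda> :: "('v, 'e) kgraph_data" +
  fixes F :: "'e \<Rightarrow> 'f"
  assumes inj: "inj_on F (topspace (Mor \<Lambda>))"
begin

notation comp_infix (infixl "\<cdot>" 70)

abbreviation "F' \<equiv> inv_into arrows F"
abbreviation "K \<equiv> transport F \<Lambda>"

lemma transport_simps [simp]:
  "Obj K = Obj \<Lambda>" "rng K x = rng \<Lambda> (F' x)" "source K x = source \<Lambda> (F' x)"
  "ident K v = F (ident \<Lambda> v)" "cat_comp K x y = F (F' x \<cdot> F' y)" "deg K x = deg \<Lambda> (F' x)"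
  by (simp_all add: transport_def Let_def)

lemma untransport_transport [simp]: "x \<in> arrows \<Longrightarrow> F' (F x) = x"
  using inv_into_f_f[OF inj] .

lemma topspace_transport [simp]: "topspace (Mor K) = F ` arrows"
  by (auto simp: transport_def Let_def topspace_pullback_topology)

lemma transport_untransport: "x \<in> topspace (Mor K) \<Longrightarrow> F (F' x) = x" and untransport_arrow: "x \<in> topspace (Mor K) \<Longrightarrow> F' x \<in> arrows"
  by auto

lemma transport_homeo: "homeomorphic_maps (Mor \<Lambda>) (Mor K) F F'"
proof -
  have "continuous_map (Mor \<Lambda>) (Mor K) F"
    unfolding continuous_map_def
  proof (intro conjI allI impI)
    fix U assume "openin (Mor K) U"
    then obtain V where V: "openin (Mor \<Lambda>) V" "U = F' -` V \<inter> F ` arrows"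
      by (auto simp: transport_def Let_def openin_pullback_topology)
    have "F x \<in> U \<longleftrightarrow> x \<in> V" if "x \<in> arrows" for x
      using that V(2) by simp
    then have "{x \<in> arrows. F x \<in> U} = V"
      using openin_subset[OF V(1)] by blast
    then show "openin (Mor \<Lambda>) {x \<in> arrows. F x \<in> U}" using V by simp
  qed simp
  moreover have "continuous_map (Mor K) (Mor \<Lambda>) F'"
    unfolding continuous_map_def
  proof (intro conjI allI impI)
    show "F' \<in> topspace (Mor K) \<rightarrow> arrows" by auto
    fix V assume V: "openin (Mor \<Lambda>) V"
    have "{x \<in> topspace (Mor K). F' x \<in> V} = F' -` V \<inter> F ` arrows" by auto
    then show "openin (Mor K) {x \<in> topspace (Mor K). F' x \<in> V}"
      using V by (auto simp: transport_def Let_def openin_pullback_topology)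
  qed
  ultimately show ?thesis
    unfolding homeomorphic_maps_def using transport_untransport by simp
qed

lemma continuous_transport: "continuous_map (Mor \<Lambda>) (Mor K) F"
  and continuous_untransport: "continuous_map (Mor K) (Mor \<Lambda>) F'"
  using transport_homeo unfolding homeomorphic_maps_def by simp_all

lemma homeomorphic_transport: "homeomorphic_map (Mor \<Lambda>) (Mor K) F"
  and homeomorphic_untransport: "homeomorphic_map (Mor K) (Mor \<Lambda>) F'"
  using transport_homeo unfolding homeomorphic_maps_map by simp_all

lemma composable_transport:
  "(x, y) \<in> topspace (composable K) \<longleftrightarrow> x \<in> F ` arrows \<and> y \<in> F ` arrows \<and> cpb (F' x) (F' y)"
  by (auto simp: composable_def topspace_fibre_product cpb_def)

lemma composable_transport_homeo:
  "homeomorphic_map (composable K) (composable \<Lambda>) (\<lambda>(x, y). (F' x, F' y))"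
proof -
  have fs: "continuous_map (composable H) (Mor H) fst" "continuous_map (composable H) (Mor H) snd"
    for H :: "('a, 'b) kgraph_data"
    unfolding composable_def fibre_product_def
    by (intro continuous_map_from_subtopology continuous_map_fst continuous_map_snd)+
  have "continuous_map (composable K) (composable \<Lambda>) (\<lambda>(x, y). (F' x, F' y))"
  proof -
    have "source \<Lambda> (F' (fst w)) = rng \<Lambda> (F' (snd w))" if "w \<in> topspace (composable K)" for w
      using that by (cases w) (simp only: composable_transport cpb_def fst_conv snd_conv)
    then show ?thesis
      unfolding composable_def[of \<Lambda>] continuous_map_fibre_product case_prod_unfold
      using continuous_map_compose[OF fs(1) continuous_untransport] continuous_map_compose[OF fs(2) continuous_untransport]
      by (auto simp only: fst_conv snd_conv o_def)
  qed
  moreover have "continuous_map (composable \<Lambda>) (composable K) (\<lambda>(x, y). (F x, F y))"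
  proof -
    have "source K (F (fst w)) = rng K (F (snd w))" if "w \<in> topspace (composable \<Lambda>)" for w
      using that by (cases w) (simp add: cpb_def)
    then show ?thesis
      unfolding composable_def[of K] continuous_map_fibre_product case_prod_unfold
      using continuous_map_compose[OF fs(1) continuous_transport] continuous_map_compose[OF fs(2) continuous_transport]
      by (auto simp only: fst_conv snd_conv o_def)
  qed
  ultimately have "homeomorphic_maps (composable K) (composable \<Lambda>) (\<lambda>(x, y). (F' x, F' y)) (\<lambda>(x, y). (F x, F y))"
    unfolding homeomorphic_maps_def
    by (auto simp: composable_transport topspace_composable cpb_def)
  then show ?thesis
    using homeomorphic_maps_map by blast
qed

lemma kgraph_transport: "topological_kgraph k K"
proof unfold_locales
  fix t assume t: "t \<in> topspace (Mor K)"
  then obtain x where x: "t = F x" "x \<in> arrows" by auto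
  show "rng K t \<in> topspace (Obj K)" "source K t \<in> topspace (Obj K)" "deg K t \<in> degrees k"
    "cat_comp K (ident K (rng K t)) t = t" "cat_comp K t (ident K (source K t)) = t"
    using x rng_obj source_obj deg_degrees by (simp_all add: ident_mor)
next
  fix v assume "v \<in> topspace (Obj K)"
  then show "ident K v \<in> topspace (Mor K)" "rng K (ident K v) = v" "source K (ident K v) = v"
    "deg K (ident K v) = 0"
    by (simp_all add: ident_mor rng_ident source_ident deg_ident)
next
  fix x y assume "(x, y) \<in> topspace (composable K)"
  then have xy: "cpb (F' x) (F' y)"
    unfolding composable_transport by blast
  then show "cat_comp K x y \<in> topspace (Mor K)" "rng K (cat_comp K x y) = rng K x"
    "source K (cat_comp K x y) = source K y" "deg K (cat_comp K x y) = deg K x + deg K y"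
    by simp_all
next
  fix x y z assume "(x, y) \<in> topspace (composable K)" "(y, z) \<in> topspace (composable K)"
  then have "cpb (F' x) (F' y)" "cpb (F' y) (F' z)"
    unfolding composable_transport by blast+
  then show "cat_comp K (cat_comp K x y) z = cat_comp K x (cat_comp K y z)"
    using assoc by simp
next
  show "locally_compact_space (Obj K)" "Hausdorff_space (Obj K)"
    using Obj_locally_compact Obj_Hausdorff by simp_all
  have hs: "Mor \<Lambda> homeomorphic_space Mor K"
    using homeomorphic_transport homeomorphic_map_imp_homeomorphic_space by blast
  show "locally_compact_space (Mor K)" "Hausdorff_space (Mor K)"
    using homeomorphic_locally_compact_space[OF hs] homeomorphic_Hausdorff_space[OF hs]
      Mor_locally_compact Mor_Hausdorff by blast+
  have rng': "rng K = rng \<Lambda> \<circ> F'" and source': "source K = source \<Lambda> \<circ> F'" and deg': "deg K = deg \<Lambda> \<circ> F'"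
    by auto
  show "continuous_map (Mor K) (Obj K) (rng K)" "continuous_map (Mor K) (Obj K) (source K)"
    "continuous_map (Mor K) (discrete_topology (degrees k)) (deg K)"
    unfolding rng' source' deg' transport_simps
    using continuous_map_compose[OF continuous_untransport] continuous_rng continuous_source continuous_deg by blast+
  show "local_homeomorphism_map (Mor K) (Obj K) (source K)"
    using local_homeomorphism_map_compose[OF local_homeomorphism_map_homeomorphic[OF homeomorphic_untransport] local_homeo_source]
    unfolding source' o_def transport_simps .
  \<comment> \<open>Composition is conjugated by homeomorphisms, so continuity and openness carry
    over together.\<close>
  have comp': "(\<lambda>(x, y). cat_comp K x y) = F \<circ> ((\<lambda>(x, y). x \<cdot> y) \<circ> (\<lambda>(x, y). (F' x, F' y)))"
    by (auto simp: fun_eq_iff)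
  show "continuous_map (composable K) (Mor K) (\<lambda>(x, y). cat_comp K x y)"
    unfolding comp'
    by (intro continuous_map_compose[OF _ continuous_transport]
      continuous_map_compose[OF homeomorphic_imp_continuous_map[OF composable_transport_homeo] continuous_comp])
  show "open_map (composable K) (Mor K) (\<lambda>(x, y). cat_comp K x y)"
    unfolding comp'
    by (intro open_map_compose[OF _ homeomorphic_imp_open_map[OF homeomorphic_transport]]
      open_map_compose[OF homeomorphic_imp_open_map[OF composable_transport_homeo] open_comp])
next
  fix t p q assume t: "t \<in> topspace (Mor K)" and pq: "deg K t = p + q"
  obtain x where x: "t = F x" "x \<in> arrows" using t by auto
  have "deg \<Lambda> x = p + q" using pq x by simp
  from factorization[OF x(2) this] obtain y z where yz: "cpb y z" "x = y \<cdot> z" "deg \<Lambda> y = p" "deg \<Lambda> z = q"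
    by blast
  note a = cpb_arrow[OF yz(1)]
  show "\<exists>!yz. yz \<in> topspace (composable K) \<and> t = cat_comp K (fst yz) (snd yz) \<and>
          deg K (fst yz) = p \<and> deg K (snd yz) = q"
  proof (rule ex1I[of _ "(F y, F z)"])
    show "(F y, F z) \<in> topspace (composable K) \<and> t = cat_comp K (fst (F y, F z)) (snd (F y, F z)) \<and>
          deg K (fst (F y, F z)) = p \<and> deg K (snd (F y, F z)) = q"
      using x yz a by (simp add: composable_transport)
    fix uv assume uv: "uv \<in> topspace (composable K) \<and> t = cat_comp K (fst uv) (snd uv) \<and>
          deg K (fst uv) = p \<and> deg K (snd uv) = q"
    obtain u v where e: "uv = (u, v)" by (cases uv)
    have c: "u \<in> F ` arrows" "v \<in> F ` arrows" "cpb (F' u) (F' v)" "deg \<Lambda> (F' u) = p"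
      using uv unfolding e composable_transport by auto
    have "F x = F (F' u \<cdot> F' v)" using uv x e by simp
    then have "F' u \<cdot> F' v = y \<cdot> z"
      using inj_onD[OF inj _ x(2) cpb_comp(1)[OF c(3)]] yz(2) by simp
    with edge_unique[OF c(3) yz(1) this] c(4) yz(3) have "F' u = y" "F' v = z" by simp_all
    then show "uv = (F y, F z)"
      using transport_untransport[of u] transport_untransport[of v] c(1,2) e by simp
  qed
qed

lemma paths_transport: "paths K p = F ` paths \<Lambda> p"
  by (auto simp: paths_def)

lemma path_space_transport: "homeomorphic_map (path_space \<Lambda> p) (path_space K p) F"
  unfolding path_space_def
proof (rule homeomorphic_map_subtopologies_alt[OF homeomorphic_transport])
  fix x assume "x \<in> arrows"
  then show "F x \<in> paths K p \<longleftrightarrow> x \<in> paths \<Lambda> p"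
    by (simp add: paths_def)
qed

lemma range_set_transport:
  "{x \<in> paths K p. rng K x \<in> V} = F ` {x \<in> paths \<Lambda> p. rng \<Lambda> x \<in> V}"
  unfolding paths_transport by (auto simp: paths_def)

lemma row_finite_transport: "row_finite k \<Lambda> \<Longrightarrow> row_finite k K"
  unfolding row_finite_def range_set_transport transport_simps(1)
  by (meson homeomorphic_imp_continuous_map image_compactin path_space_transport)

lemma no_source_transport: "no_source k \<Lambda> \<Longrightarrow> no_source k K"
  unfolding no_source_def range_set_transport transport_simps(1) by blast

end

section \<open>Flips in a topological graph of higher rank\<close>

context topological_kgraph
begin

definition path_pairs :: "(nat \<Rightarrow>\<^sub>0 nat) \<Rightarrow> (nat \<Rightarrow>\<^sub>0 nat) \<Rightarrow> ('e \<times> 'e) topology" where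
  "path_pairs p q = fibre_product (path_space \<Lambda> p) (source \<Lambda>) (path_space \<Lambda> q) (rng \<Lambda>)"

lemma topspace_path_space: "topspace (path_space \<Lambda> p) = paths \<Lambda> p"
  by (auto simp: path_space_def paths_def)

lemma topspace_path_pairs: "topspace (path_pairs p q) = {(x, y). cpb x y \<and> deg \<Lambda> x = p \<and> deg \<Lambda> y = q}"
  by (auto simp: path_pairs_def topspace_fibre_product topspace_path_space paths_def cpb_def)

lemma openin_paths: "openin (Mor \<Lambda>) (paths \<Lambda> p)"
proof (cases "p \<in> degrees k")
  case True
  then have "openin (Mor \<Lambda>) {x \<in> arrows. deg \<Lambda> x \<in> {p}}"
    by (intro openin_continuous_map_preimage[OF continuous_deg]) simp
  then show ?thesis by (simp add: paths_def)
next
  case False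
  then have "paths \<Lambda> p = {}" using deg_degrees by (auto simp: paths_def)
  then show ?thesis by simp
qed

lemma path_pairs_subtopology:
  "path_pairs p q = subtopology (composable \<Lambda>) (paths \<Lambda> p \<times> paths \<Lambda> q)"
  unfolding path_pairs_def composable_def fibre_product_def path_space_def
  by (simp only: subtopology_Times[symmetric] subtopology_subtopology Int_commute)

text \<open>Composition is continuous and open, and unique factorization makes it bijective once
  both degrees are fixed; pairs of fixed degrees form an open set since the degree is
  continuous.\<close>

lemma comp_path_pairs_homeo:
  "homeomorphic_map (path_pairs p q) (path_space \<Lambda> (p + q)) (\<lambda>(x, y). x \<cdot> y)"
proof (rule bijective_open_imp_homeomorphic_map)
  let ?c = "\<lambda>(x, y). x \<cdot> y"
  have im: "?c w \<in> paths \<Lambda> (p + q)" if "w \<in> topspace (path_pairs p q)" for w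
    using that by (auto simp: topspace_path_pairs paths_def)
  show "continuous_map (path_pairs p q) (path_space \<Lambda> (p + q)) ?c"
    unfolding path_space_def continuous_map_in_subtopology
    using im continuous_map_from_subtopology[OF continuous_comp] by (auto simp: path_pairs_subtopology)
  have "openin (prod_topology (Mor \<Lambda>) (Mor \<Lambda>)) (paths \<Lambda> p \<times> paths \<Lambda> q)"
    using openin_paths by (simp add: openin_prod_Times_iff)
  then have "openin (composable \<Lambda>) ((paths \<Lambda> p \<times> paths \<Lambda> q) \<inter> {(x, y). source \<Lambda> x = rng \<Lambda> y})"
    unfolding composable_def fibre_product_def openin_subtopology by blast
  moreover have "path_pairs p q = subtopology (composable \<Lambda>) ((paths \<Lambda> p \<times> paths \<Lambda> q) \<inter> {(x, y). source \<Lambda> x = rng \<Lambda> y})"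
    unfolding path_pairs_subtopology composable_def fibre_product_def subtopology_subtopology
    by (simp add: Int_ac)
  ultimately have op: "openin (path_pairs p q) W \<Longrightarrow> openin (composable \<Lambda>) W" for W
    using openin_trans_full by metis
  show "open_map (path_pairs p q) (path_space \<Lambda> (p + q)) ?c"
    unfolding open_map_def
  proof (intro allI impI)
    fix W assume W: "openin (path_pairs p q) W"
    then have "openin (Mor \<Lambda>) (?c ` W)"
      using op open_comp unfolding open_map_def by blast
    moreover have "?c ` W \<subseteq> paths \<Lambda> (p + q)"
      using im openin_subset[OF W] by blast
    ultimately show "openin (path_space \<Lambda> (p + q)) (?c ` W)"
      unfolding path_space_def by (simp add: openin_open_subtopology openin_paths)
  qed
  show "?c ` topspace (path_pairs p q) = topspace (path_space \<Lambda> (p + q))"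
  proof
    show "?c ` topspace (path_pairs p q) \<subseteq> topspace (path_space \<Lambda> (p + q))"
      using im by (auto simp: topspace_path_space)
    show "topspace (path_space \<Lambda> (p + q)) \<subseteq> ?c ` topspace (path_pairs p q)"
    proof
      fix x assume "x \<in> topspace (path_space \<Lambda> (p + q))"
      then have "x \<in> arrows" "deg \<Lambda> x = p + q" by (auto simp: topspace_path_space paths_def)
      then obtain y z where "cpb y z" "x = y \<cdot> z" "deg \<Lambda> y = p" "deg \<Lambda> z = q"
        by (rule factorization)
      then show "x \<in> ?c ` topspace (path_pairs p q)"
        by (intro image_eqI[of _ _ "(y, z)"]) (simp_all add: topspace_path_pairs)
    qed
  qed
  show "inj_on ?c (topspace (path_pairs p q))"
  proof (rule inj_onI)
    fix v w assume "v \<in> topspace (path_pairs p q)" "w \<in> topspace (path_pairs p q)" "?c v = ?c w"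
    then show "v = w"
      using edge_unique[of "fst v" "snd v" "fst w" "snd w"]
      by (auto simp: topspace_path_pairs case_prod_unfold prod_eq_iff)
  qed
qed

text \<open>Compose in degrees p, q and factor again in degrees q, p: the flip is one composition
  homeomorphism followed by the inverse of the other.\<close>

lemma flip_homeo:
  obtains T where "homeomorphic_map (path_pairs p q) (path_pairs q p) T"
    and "\<And>x y x' y'. (x, y) \<in> topspace (path_pairs p q) \<Longrightarrow> T (x, y) = (x', y') \<Longrightarrow> x \<cdot> y = x' \<cdot> y'"
proof -
  let ?c = "\<lambda>(x, y). x \<cdot> y"
  have h: "homeomorphic_map (path_pairs q p) (path_space \<Lambda> (p + q)) ?c"
    using comp_path_pairs_homeo[of q p] by (simp add: add.commute)
  then obtain g where g: "homeomorphic_maps (path_pairs q p) (path_space \<Lambda> (p + q)) ?c g"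
    using homeomorphic_map_maps by blast
  then have hg: "homeomorphic_map (path_space \<Lambda> (p + q)) (path_pairs q p) g"
    using homeomorphic_maps_map by blast
  show thesis
  proof (rule that[of "g \<circ> ?c"])
    show "homeomorphic_map (path_pairs p q) (path_pairs q p) (g \<circ> ?c)"
      using homeomorphic_map_compose[OF comp_path_pairs_homeo hg] .
    fix x y x' y' assume xy: "(x, y) \<in> topspace (path_pairs p q)" "(g \<circ> ?c) (x, y) = (x', y')"
    have "x \<cdot> y \<in> topspace (path_space \<Lambda> (p + q))"
      using xy(1) by (auto simp: topspace_path_pairs topspace_path_space paths_def)
    then have "?c (g (x \<cdot> y)) = x \<cdot> y"
      using g unfolding homeomorphic_maps_def by blast
    then show "x \<cdot> y = x' \<cdot> y'" using xy(2) by simp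
  qed
qed

end

text \<open>An open subset of the partial sum has empty slices over the remaining indices. This
  turns the paths of one degree into a sum of spaces of labellings.\<close>

lemma subtopology_sum_topology_index:
  assumes "I \<subseteq> J"
  shows "subtopology (sum_topology X J) (Sigma I (topspace \<circ> X)) = sum_topology X I"
proof -
  have eq: "openin (sum_topology X J) U \<longleftrightarrow> openin (sum_topology X I) U" if U: "U \<subseteq> Sigma I (topspace \<circ> X)" for U
  proof -
    have "{x. (j, x) \<in> U} = {}" if "j \<notin> I" for j
      using U that by auto
    then have "(\<forall>j\<in>J. openin (X j) {x. (j, x) \<in> U}) \<longleftrightarrow> (\<forall>i\<in>I. openin (X i) {x. (i, x) \<in> U})"
      using assms by (metis openin_empty subsetD)
    moreover have "U \<subseteq> Sigma J (topspace \<circ> X)"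
      using U assms by auto
    ultimately show ?thesis
      using U by (simp add: openin_sum_topology)
  qed
  have "openin (sum_topology X J) (Sigma I (topspace \<circ> X))"
    using eq[OF order_refl] openin_topspace[of "sum_topology X I"] by simp
  then have 1: "openin (subtopology (sum_topology X J) (Sigma I (topspace \<circ> X))) U \<longleftrightarrow>
      openin (sum_topology X J) U \<and> U \<subseteq> Sigma I (topspace \<circ> X)" for U
    by (rule openin_open_subtopology)
  have 2: "openin (sum_topology X I) U \<Longrightarrow> U \<subseteq> Sigma I (topspace \<circ> X)" for U
    using openin_subset[of "sum_topology X I" U] by simp
  show ?thesis
    unfolding topology_eq 1
  proof (intro allI iffI conjI)
    fix U assume "openin (sum_topology X J) U \<and> U \<subseteq> Sigma I (topspace \<circ> X)"
    then show "openin (sum_topology X I) U" using eq[of U] by simp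
  next
    fix U assume U: "openin (sum_topology X I) U"
    show "U \<subseteq> Sigma I (topspace \<circ> X)" by (rule 2[OF U])
    then show "openin (sum_topology X J) U" using eq[of U] U by simp
  qed
qed

text \<open>The open sets of the codomain are the images of the open sets of X under one and the
  same map. This is for the edge spaces, where the theorem claims equality of topologies.\<close>

lemma homeomorphic_map_codomain_unique:
  assumes "homeomorphic_map X Y f" "homeomorphic_map X Y' f"
  shows "Y = Y'"
proof -
  have "openin Y' U" if "homeomorphic_map X Y f" "homeomorphic_map X Y' f" "openin Y U" for Y Y' U
  proof -
    have "U \<subseteq> f ` topspace X"
      using homeomorphic_imp_surjective_map[OF that(1)] openin_subset[OF that(3)] by simp
    then have "U = f ` {x \<in> topspace X. f x \<in> U}"
      by blast
    moreover have "openin X {x \<in> topspace X. f x \<in> U}"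
      using openin_continuous_map_preimage[OF homeomorphic_imp_continuous_map[OF that(1)] that(3)] .
    ultimately show ?thesis
      using homeomorphic_imp_open_map[OF that(2)] unfolding open_map_def by metis
  qed
  then show ?thesis
    unfolding topology_eq using assms by blast
qed

lemma fibre_product_cong:
  assumes "\<And>x. x \<in> topspace X \<Longrightarrow> f x = f' x" "\<And>y. y \<in> topspace Y \<Longrightarrow> g y = g' y"
  shows "fibre_product X f Y g = fibre_product X f' Y g'"
proof -
  have "topspace (prod_topology X Y) \<inter> {(x, y). f x = g y} = topspace (prod_topology X Y) \<inter> {(x, y). f' x = g' y}"
    using assms by auto
  then show ?thesis
    unfolding fibre_product_def by (metis subtopology_restrict)
qed

section \<open>Edge spaces, and injections of labellings into labels\<close>

context topological_labelled_kgraph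
begin

lemma edge_label_homeo:
  assumes "edge e"
  shows "homeomorphic_map (labels e) (top_of_set Z) (\<lambda>z. z (rid e, e))"
proof (rule continuous_imp_homeomorphic_map)
  have c: "(rid e, e) \<in> cells e"
    using cells_first_edge[OF assms cpb_ident(1)] assms by simp
  show "continuous_map (labels e) (top_of_set Z) (\<lambda>z. z (rid e, e))"
    by (rule continuous_map_coordinate_Z[OF c])
  show "Hausdorff_space (top_of_set Z)"
    by (simp add: Hausdorff_space_subtopology Hausdorff_space_euclidean)
  show "(\<lambda>z. z (rid e, e)) ` topspace (labels e) = topspace (top_of_set Z)"
  proof
    show "(\<lambda>z. z (rid e, e)) ` topspace (labels e) \<subseteq> topspace (top_of_set Z)"
      using labellingD(2)[OF _ c] by auto
    show "topspace (top_of_set Z) \<subseteq> (\<lambda>z. z (rid e, e)) ` topspace (labels e)"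
      using labelling_edge_exists[OF assms] by (auto simp: image_iff)
  qed
  show "inj_on (\<lambda>z. z (rid e, e)) (topspace (labels e))"
    using inj_on_edge_label[OF assms] by simp
qed (rule compact_space_labels)

lemma paths_generator_edge: "w \<in> paths \<Gamma> (generator i) \<Longrightarrow> edge w"
  using edgeI by (auto simp: paths_def)

text \<open>A labelling of a single edge is its edge label, and the edges of one colour form a
  discrete set, so the sum over them is a product.\<close>

lemma edge_space_homeo:
  "homeomorphic_map (path_space G (generator i))
     (prod_topology (path_space \<Gamma> (generator i)) (top_of_set Z)) (\<lambda>(w, z). (w, z (rid w, w)))"
proof -
  let ?E = "paths \<Gamma> (generator i)"
  let ?f = "\<lambda>(w, z). (w, z (rid w, w))"
  have dis: "path_space \<Gamma> (generator i) = discrete_topology ?E"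
    unfolding path_space_def by (subst discrete_Mor) (simp add: Int_absorb1 paths_def)
  have "paths G (generator i) = Sigma ?E (topspace \<circ> labels)"
    unfolding G_paths by auto
  then have G: "path_space G (generator i) = sum_topology labels ?E"
    unfolding path_space_def using subtopology_sum_topology_index[of ?E arrows labels]
    by (simp add: paths_def)
  show ?thesis
    unfolding G dis
  proof (rule bijective_open_imp_homeomorphic_map)
    show "continuous_map (sum_topology labels ?E) (prod_topology (discrete_topology ?E) (top_of_set Z)) ?f"
      unfolding continuous_map_from_sum_topology
    proof
      fix w assume w: "w \<in> ?E"
      have "continuous_map (labels w) (top_of_set Z) (\<lambda>z. z (rid w, w))"
        by (rule homeomorphic_imp_continuous_map[OF edge_label_homeo[OF paths_generator_edge[OF w]]])
      then show "continuous_map (labels w) (prod_topology (discrete_topology ?E) (top_of_set Z)) (\<lambda>z. ?f (w, z))"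
        using w by (simp add: continuous_map_pairwise o_def)
    qed
    show "open_map (sum_topology labels ?E) (prod_topology (discrete_topology ?E) (top_of_set Z)) ?f"
      unfolding open_map_from_sum_topology
    proof
      fix w assume w: "w \<in> ?E"
      have "open_map (labels w) (prod_topology (discrete_topology ?E) (top_of_set Z)) (Pair w \<circ> (\<lambda>z. z (rid w, w)))"
        by (rule open_map_compose[OF homeomorphic_imp_open_map[OF edge_label_homeo[OF paths_generator_edge[OF w]]]
          open_map_Pair_discrete[OF w]])
      then show "open_map (labels w) (prod_topology (discrete_topology ?E) (top_of_set Z)) (\<lambda>z. ?f (w, z))"
        by (simp add: o_def)
    qed
    show "?f ` topspace (sum_topology labels ?E) = topspace (prod_topology (discrete_topology ?E) (top_of_set Z))"
    proof
      show "?f ` topspace (sum_topology labels ?E) \<subseteq> topspace (prod_topology (discrete_topology ?E) (top_of_set Z))"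
        using homeomorphic_imp_surjective_map[OF edge_label_homeo[OF paths_generator_edge]] by fastforce
      show "topspace (prod_topology (discrete_topology ?E) (top_of_set Z)) \<subseteq> ?f ` topspace (sum_topology labels ?E)"
      proof
        fix p assume "p \<in> topspace (prod_topology (discrete_topology ?E) (top_of_set Z))"
        then obtain w a where p: "p = (w, a)" "w \<in> ?E" "a \<in> Z" by auto
        obtain z where "labelling w z" "z (rid w, w) = a"
          using labelling_edge_exists[OF paths_generator_edge[OF p(2)] p(3)] by blast
        then show "p \<in> ?f ` topspace (sum_topology labels ?E)"
          using p by (intro image_eqI[of _ _ "(w, z)"]) simp_all
      qed
    qed
    show "inj_on ?f (topspace (sum_topology labels ?E))"
    proof (rule inj_onI)
      fix p q assume pq: "p \<in> topspace (sum_topology labels ?E)" "q \<in> topspace (sum_topology labels ?E)" "?f p = ?f q"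
      obtain w z w' z' where e: "p = (w, z)" "q = (w', z')" by (metis surj_pair)
      then have "w \<in> ?E" "labelling w z" "labelling w z'" "w' = w" "z (rid w, w) = z' (rid w, w)"
        using pq by auto
      then show "p = q"
        using labelling_edge_unique[OF paths_generator_edge] e by blast
    qed
  qed
qed

text \<open>A labelling of \<open>e \<cdot> y\<close> is determined by the label of e and the
  labelling behind e. An injection of pairs of labels into labels, available for an infinite label
  type, thus carries the encoding from y to the longer path.\<close>

lemma labelling_encoding:
  assumes "infinite (UNIV :: 'z set)" "w \<in> arrows"
  shows "\<exists>c :: ('e \<times> 'e \<Rightarrow> 'z) \<Rightarrow> 'z. inj_on c {z. labelling w z}"
proof -
  obtain \<pi> :: "'z \<times> 'z \<Rightarrow> 'z" where \<pi>: "inj \<pi>"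
    using card_of_ordIso[THEN iffD2, OF card_of_Times_same_infinite[OF assms(1)]]
    by (auto simp: bij_betw_def)
  show ?thesis
    using assms(2)
  proof (induction rule: arrow_induct)
    case (vertex v)
    then show ?case using inj_on_vertex_label by blast
  next
    case (edge e y)
    then obtain c :: "('e \<times> 'e \<Rightarrow> 'z) \<Rightarrow> 'z" where c: "inj_on c {z. labelling y z}" by blast
    have "inj_on (\<lambda>z. \<pi> (z (rid e, e), c (rear e y z))) {z. labelling (e \<cdot> y) z}"
    proof (rule inj_onI)
      fix z z' assume z: "z \<in> {z. labelling (e \<cdot> y) z}" "z' \<in> {z. labelling (e \<cdot> y) z}"
        and "\<pi> (z (rid e, e), c (rear e y z)) = \<pi> (z' (rid e, e), c (rear e y z'))"
      then have eq: "z (rid e, e) = z' (rid e, e)" "c (rear e y z) = c (rear e y z')"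
        using injD[OF \<pi>] by blast+
      have "rear e y z = rear e y z'"
        using inj_onD[OF c] eq(2) labelling_rear[OF edge(2)] z by simp
      then show "z = z'"
        using edge_fill_unique[OF edge(1,2)] z eq(1) by simp
    qed
    then show ?case by blast
  qed
qed

text \<open>For two edges of equal degree no coprimality is assumed, so that the labellings of a longer path
  need not be parametrized by a single label; any injection into the label type will do for those.\<close>

definition encode :: "'e \<Rightarrow> ('e \<times> 'e \<Rightarrow> 'z) \<Rightarrow> 'z" where
  "encode w = (if vertex w then (\<lambda>z. z (w, w)) else if edge w then (\<lambda>z. z (rid w, w))
     else (SOME c. inj_on c {z. labelling w z}))"

lemma encode_inj:
  assumes "infinite (UNIV :: 'z set)" "w \<in> arrows"
  shows "inj_on (encode w) {z. labelling w z}"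
proof -
  have "inj_on (SOME c :: _ \<Rightarrow> 'z. inj_on c {z. labelling w z}) {z. labelling w z}"
    by (rule someI_ex[OF labelling_encoding[OF assms]])
  then show ?thesis
    using inj_on_vertex_label inj_on_edge_label by (simp add: encode_def)
qed

end

section \<open>The circle as space of labels\<close>

context twisted_kgraph
begin

lemma topological_labelled:
  assumes "Obj \<Gamma> = discrete_topology (topspace (Obj \<Gamma>))" "Mor \<Gamma> = discrete_topology (topspace (Mor \<Gamma>))"
  shows "topological_labelled_kgraph k \<Gamma> {z. cmod z = 1} (\<lambda>e a. a powi M e) (\<lambda>e a. a powi N e) root_square"
proof unfold_locales
  have circ: "{z. cmod z = 1} = sphere 0 1" by (auto simp: sphere_def)
  show comp: "compact {z. cmod z = 1}"
    unfolding circ by simp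
  have cont: "continuous_on {z. cmod z = 1} (\<lambda>a. a powi i)" for i
    by (intro continuous_intros) auto
  show "continuous_on {z. cmod z = 1} (\<lambda>a. a powi M e)" for e
    by (rule cont)
  show "local_homeomorphism_map circle circle (\<lambda>a. a powi N e)" if "edge e" for e
  proof -
    have "nat (N e) > 0" using N_positive[OF that] by simp
    from local_homeomorphism_map_circle_power[OF this] show ?thesis
      using N_positive[OF that] by (simp add: power_int_def)
  qed
  show "closed {(a, b, b', a'). root_square e f f' e' a b b' a'}" for e f f' e'
  proof -
    \<comment> \<open>The labelled squares form the image of the circle of roots u, so the relation
      is even compact.\<close>
    have "{(a, b, b', a'). root_square e f f' e' a b b' a'} =
        (\<lambda>u. (u powi M f, u powi N e, u powi M e', u powi N f')) ` {u. cmod u = 1}"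
      unfolding root_square_def by blast
    moreover have "compact \<dots>"
      by (intro compact_continuous_image comp continuous_on_Pair cont)
    ultimately show ?thesis
      by (simp add: compact_imp_closed)
  qed
  show "\<exists>b\<in>{z. cmod z = 1}. b powi M e = a" if "edge e" "a \<in> {z. cmod z = 1}" for e a
  proof -
    have "a \<noteq> 0" using that by auto
    then have "cis (Arg a) = a"
      using that(2) by (simp add: cis_Arg sgn_eq)
    moreover have "cis (Arg a / of_int (M e)) powi M e = cis (Arg a)"
      using M_nonzero[OF that(1)] by (simp add: cis_power_int)
    \<comment> \<open>Dividing the argument of a by \<open>M e\<close>, which is nonzero, gives a
      root on the circle; a negative exponent causes no trouble.\<close>
    ultimately show ?thesis
      by (intro bexI[of _ "cis (Arg a / of_int (M e))"]) simp_all
  qed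
qed (use assms in blast)+

end

section \<open>The graph for the given data\<close>

theorem proposition5p1:
  fixes k :: enat
    and \<Gamma> :: "('v, 'e) kgraph_data"
    and T :: "nat \<Rightarrow> nat \<Rightarrow> 'e \<times> 'e \<Rightarrow> 'e \<times> 'e"
    and n :: "nat \<Rightarrow> 'e \<Rightarrow> nat"
    and m :: "nat \<Rightarrow> 'e \<Rightarrow> int"
  assumes "1 \<le> k"
    and "discrete_kgraph k \<Gamma>"
    and "row_finite k \<Gamma>"
    and "no_source k \<Gamma>"
    and "determined_by k \<Gamma> T"
    and "\<forall>i\<in>indices k. \<forall>x\<in>paths \<Gamma> (generator i). n i x > 0"
    and "\<forall>i\<in>indices k. \<forall>x\<in>paths \<Gamma> (generator i). m i x \<noteq> 0"
    and "\<forall>i\<in>indices k. \<forall>j\<in>indices k. i < j \<longrightarrow> (\<forall>(x, y)\<in>edge_pairs \<Gamma> i j.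
           gcd \<bar>m i x * m j y\<bar> (int (n i x * n j y)) = 1)"
    and "\<forall>i\<in>indices k. \<forall>j\<in>indices k. i < j \<longrightarrow> (\<forall>(x, y)\<in>edge_pairs \<Gamma> i j.
           \<forall>y' x'. T i j (x, y) = (y', x') \<longrightarrow>
             m i x * m j y = m j y' * m i x' \<and> n i x * n j y = n j y' * n i x')"
  shows "\<exists>T' :: nat \<Rightarrow> nat \<Rightarrow> ('e \<times> complex) \<times> ('e \<times> complex) \<Rightarrow> ('e \<times> complex) \<times> ('e \<times> complex).
    (\<forall>i\<in>indices k. \<forall>j\<in>indices k. i < j \<longrightarrow>
       homeomorphic_map (twisted_pairs \<Gamma> n m i j) (twisted_pairs \<Gamma> n m j i) (T' i j)) \<and>
    (\<exists>\<Lambda> :: ('v \<times> complex, 'e \<times> complex) kgraph_data.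
       topological_kgraph k \<Lambda> \<and> row_finite k \<Lambda> \<and> no_source k \<Lambda> \<and>
       Obj \<Lambda> = prod_topology (Obj \<Gamma>) circle \<and>
       (\<forall>v\<in>topspace (Obj \<Gamma>). \<forall>z\<in>topspace circle. ident \<Lambda> (v, z) = (ident \<Gamma> v, z)) \<and>
       (\<forall>i\<in>indices k. path_space \<Lambda> (generator i) = twisted_edges \<Gamma> i \<and>
          (\<forall>x\<in>topspace (twisted_edges \<Gamma> i).
             source \<Lambda> x = twisted_source \<Gamma> (n i) x \<and> rng \<Lambda> x = twisted_range \<Gamma> (m i) x)) \<and>
       (\<forall>i\<in>indices k. \<forall>j\<in>indices k. i < j \<longrightarrow>
          (\<forall>(x, y)\<in>topspace (twisted_pairs \<Gamma> n m i j). \<forall>x' y'.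
             T' i j (x, y) = (x', y') \<longrightarrow> cat_comp \<Lambda> x y = cat_comp \<Lambda> x' y')))"
proof -
  interpret topological_kgraph k \<Gamma>
    using assms(2) by (simp add: discrete_kgraph_def)
  have dis: "Obj \<Gamma> = discrete_topology (topspace (Obj \<Gamma>))" "Mor \<Gamma> = discrete_topology (topspace (Mor \<Gamma>))"
    using assms(2) by (simp_all add: discrete_kgraph_def)
  \<comment> \<open>The colour of an edge, well defined because distinct indices have distinct
    generators.\<close>
  define c where "c e = (THE i. deg \<Gamma> e = generator i)" for e
  have c: "c e = i" if "deg \<Gamma> e = generator i" for e i
    unfolding c_def that by (rule the_equality) (simp_all only: generator_eq_iff)
  define M where "M e = m (c e) e" for e
  define N where "N e = int (n (c e) e)" for e
  have col: "c e \<in> indices k" "e \<in> paths \<Gamma> (generator (c e))" if ed: "edge e" for e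
  proof -
    obtain i where "i \<in> indices k" "deg \<Gamma> e = generator i" using ed by (rule edge_degree)
    then show "c e \<in> indices k" "e \<in> paths \<Gamma> (generator (c e))"
      using c ed by (simp_all add: paths_def)
  qed
  have c_paths: "c e = i" if "e \<in> paths \<Gamma> (generator i)" for e i
    using that c by (simp add: paths_def)
  \<comment> \<open>Hypotheses (i) and (ii) speak of i < j, so the square is first taken with its
    colours in this order. There \<open>determined_by\<close> identifies the value of T with the
    second factorization.\<close>
  have ordered: "coprime (M e * M f) (N e * N f) \<and> M e * M f = M f' * M e' \<and> N e * N f = N f' * N e'"
    if s: "square e f f' e'" and lt: "c e < c f" for e f f' e'
  proof -
    note sD = squareD[OF s]
    note ind = col(1)[OF sD(1)] col(1)[OF sD(2)]
    have c': "c f' = c f" "c e' = c e"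
      using sD(8,9) by (simp_all add: c_def)
    have ep: "(e, f) \<in> edge_pairs \<Gamma> (c e) (c f)" "(f', e') \<in> edge_pairs \<Gamma> (c f) (c e)"
      using col sD(1-6) c' by (simp_all add: edge_pairs_def cpb_def) metis+
    have "\<forall>(x, y)\<in>edge_pairs \<Gamma> (c e) (c f). \<forall>(y', x')\<in>edge_pairs \<Gamma> (c f) (c e).
        T (c e) (c f) (x, y) = (y', x') \<longleftrightarrow> cat_comp \<Gamma> x y = cat_comp \<Gamma> y' x'"
      using assms(5)[unfolded determined_by_def, rule_format, OF ind lt] by (rule conjunct2)
    then have T: "T (c e) (c f) (e, f) = (f', e')"
      using ep sD(7) by blast
    have "gcd \<bar>m (c e) e * m (c f) f\<bar> (int (n (c e) e * n (c f) f)) = 1"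
      using assms(8)[rule_format, OF ind lt ep(1)] by (simp only: prod.case)
    moreover have "m (c e) e * m (c f) f = m (c f) f' * m (c e) e' \<and> n (c e) e * n (c f) f = n (c f) f' * n (c e) e'"
      using assms(9)[rule_format, OF ind lt ep(1)] T by (simp only: prod.case)
    ultimately show ?thesis
      unfolding M_def N_def c' coprime_iff_gcd_eq_1 by (simp flip: of_nat_mult)
  qed
  \<comment> \<open>The other orientation is the same square read from its second factorization; by
    the product rules the two pairs of products coincide, so coprimality carries over too.\<close>
  have sq: "coprime (M e * M f) (N e * N f) \<and> M e * M f = M f' * M e' \<and> N e * N f = N f' * N e'"
    if s: "square e f f' e'" for e f f' e'
  proof (cases "c e < c f")
    case True
    then show ?thesis using ordered s by blast
  next
    case False
    note sD = squareD[OF s]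
    have c': "c f' = c f" "c e' = c e"
      using sD(8,9) by (simp_all add: c_def)
    have "c e \<noteq> c f"
      using col(2) sD(1,2,10) by (metis (mono_tags, lifting) mem_Collect_eq paths_def)
    then have "c f' < c e'" using False c' by simp
    with ordered[OF square_sym[OF s]] show ?thesis by metis
  qed
  interpret twisted_kgraph k \<Gamma> M N
  proof unfold_locales
    fix e assume "edge e"
    then show "M e \<noteq> 0" "N e > 0"
      using col assms(6,7) by (auto simp: M_def N_def)
  qed (use sq in blast)+
  interpret L: topological_labelled_kgraph k \<Gamma> "{z. cmod z = 1}" "\<lambda>e a. a powi M e" "\<lambda>e a. a powi N e" root_square
    by (rule topological_labelled[OF dis])
  let ?G = "L.labelled_graph"
  define F where "F = (\<lambda>(w, z). (w, L.encode w z))"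
  have inf: "infinite (UNIV :: complex set)"
    by (rule infinite_UNIV_char_0)
  interpret G: kgraph_transport k ?G F
  proof (intro kgraph_transport.intro kgraph_transport_axioms.intro)
    show "topological_kgraph k ?G" by (rule L.G_kgraph)
    show "inj_on F (topspace (Mor ?G))"
    proof (rule inj_onI)
      fix p q assume pq: "p \<in> topspace (Mor ?G)" "q \<in> topspace (Mor ?G)" "F p = F q"
      obtain w z w' z' where e: "p = (w, z)" "q = (w', z')" by (metis surj_pair)
      then have "w' = w" "w \<in> topspace (Mor \<Gamma>)" "labelling w z" "labelling w z'" "L.encode w z = L.encode w z'"
        using pq by (auto simp: F_def)
      then show "p = q"
        using inj_onD[OF L.encode_inj[OF inf]] e by blast
    qed
  qed
  let ?\<Lambda> = "transport F ?G"
  interpret \<Lambda>: topological_kgraph k ?\<Lambda> by (rule G.kgraph_transport)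
  \<comment> \<open>On edges F keeps exactly the edge label, so that the renamed edges are the pairs
    of the theorem.\<close>
  have enc_edge: "F (w, z) = (w, z (rid w, w))" if "w \<in> paths \<Gamma> (generator i)" for w z i
    using edge_not_vertex[OF L.paths_generator_edge[OF that]] L.paths_generator_edge[OF that]
    by (simp add: F_def L.encode_def)
  \<comment> \<open>The map F carries the space of labelled edges homeomorphically onto both sides,
    hence their topologies are equal.\<close>
  have space: "path_space ?\<Lambda> (generator i) = twisted_edges \<Gamma> i" for i
  proof (rule homeomorphic_map_codomain_unique[OF G.path_space_transport])
    have "homeomorphic_map (path_space ?G (generator i)) (twisted_edges \<Gamma> i) (\<lambda>(w, z). (w, z (rid w, w)))"
      unfolding twisted_edges_def by (rule L.edge_space_homeo)
    moreover have "(case x of (w, z) \<Rightarrow> (w, z (rid w, w))) = F x" if "x \<in> topspace (path_space ?G (generator i))" for x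
      using that enc_edge unfolding G.topspace_path_space L.G_paths by auto
    ultimately show "homeomorphic_map (path_space ?G (generator i)) (twisted_edges \<Gamma> i) F"
      by (rule homeomorphic_map_eq)
  qed
  have ends: "source ?\<Lambda> x = twisted_source \<Gamma> (n i) x \<and> rng ?\<Lambda> x = twisted_range \<Gamma> (m i) x"
    if x: "x \<in> topspace (twisted_edges \<Gamma> i)" for x i
  proof -
    have "x \<in> F ` paths ?G (generator i)"
      using x unfolding space[symmetric] \<Lambda>.topspace_path_space G.paths_transport .
    then obtain w z where wz: "x = F (w, z)" "w \<in> paths \<Gamma> (generator i)" "labelling w z"
      unfolding L.G_paths by blast
    have w: "edge w" using wz(2) by (rule L.paths_generator_edge)
    have c: "(rid w, w) \<in> cells w"
      using cells_first_edge[OF w cpb_ident(1)] w by simp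
    have "(w, z) \<in> topspace (Mor ?G)" using w wz(3) by simp
    then have "G.F' x = (w, z)"
      using G.untransport_transport wz(1) by (simp only:)
    then have 1: "source ?\<Lambda> x = (source \<Gamma> w, z (w, sid w))" "rng ?\<Lambda> x = (rng \<Gamma> w, z (rid w, rid w))"
      by (simp_all only: G.transport_simps L.G_simps)
    have 2: "x = (w, z (rid w, w))"
      using wz(1) enc_edge[OF wz(2)] by (simp only:)
    have "z (rid w, w) powi M w = z (rid w, rid w)" "z (rid w, w) powi N w = z (w, sid w)"
      using labellingD(3,4)[OF wz(3) w c] w by simp_all
    then show ?thesis
      unfolding 1 unfolding 2 by (simp add: twisted_source_def twisted_range_def M_def N_def c_paths[OF wz(2)])
  qed
  have pairs: "twisted_pairs \<Gamma> n m i j = \<Lambda>.path_pairs (generator i) (generator j)" for i j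
    unfolding twisted_pairs_def \<Lambda>.path_pairs_def space
    by (rule fibre_product_cong) (use ends in simp_all)
  define flip where "flip i j S \<longleftrightarrow> homeomorphic_map (twisted_pairs \<Gamma> n m i j) (twisted_pairs \<Gamma> n m j i) S \<and>
      (\<forall>(x, y)\<in>topspace (twisted_pairs \<Gamma> n m i j). \<forall>x' y'. S (x, y) = (x', y') \<longrightarrow>
         cat_comp ?\<Lambda> x y = cat_comp ?\<Lambda> x' y')" for i j S
  have ex: "\<exists>S. flip i j S" for i j
  proof -
    obtain S where "homeomorphic_map (\<Lambda>.path_pairs (generator i) (generator j)) (\<Lambda>.path_pairs (generator j) (generator i)) S"
      "\<And>x y x' y'. (x, y) \<in> topspace (\<Lambda>.path_pairs (generator i) (generator j)) \<Longrightarrow> S (x, y) = (x', y') \<Longrightarrow>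
        cat_comp ?\<Lambda> x y = cat_comp ?\<Lambda> x' y'"
      by (rule \<Lambda>.flip_homeo[of "generator i" "generator j"]) blast
    then show ?thesis
      unfolding flip_def pairs by blast
  qed
  define T' where "T' i j = (SOME S. flip i j S)" for i j
  have T': "flip i j (T' i j)" for i j
    unfolding T'_def by (rule someI_ex[OF ex])
  have ident: "ident ?\<Lambda> (v, z) = (ident \<Gamma> v, z)" if "v \<in> topspace (Obj \<Gamma>)" for v z
    using that by (simp only: G.transport_simps L.G_simps) (simp add: F_def L.encode_def const_label_def)
  show ?thesis
  proof (rule exI[of _ T'], intro conjI exI[of _ ?\<Lambda>])
    show "\<forall>i\<in>indices k. \<forall>j\<in>indices k. i < j \<longrightarrow>
        homeomorphic_map (twisted_pairs \<Gamma> n m i j) (twisted_pairs \<Gamma> n m j i) (T' i j)"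
      using T' unfolding flip_def by blast
    show "topological_kgraph k ?\<Lambda>" by (rule G.kgraph_transport)
    show "row_finite k ?\<Lambda>" by (rule G.row_finite_transport[OF L.G_row_finite[OF assms(3)]])
    show "no_source k ?\<Lambda>" by (rule G.no_source_transport[OF L.G_no_source[OF assms(4)]])
    show "Obj ?\<Lambda> = prod_topology (Obj \<Gamma>) circle" by simp
    show "\<forall>v\<in>topspace (Obj \<Gamma>). \<forall>z\<in>topspace circle. ident ?\<Lambda> (v, z) = (ident \<Gamma> v, z)"
      using ident by blast
    show "\<forall>i\<in>indices k. path_space ?\<Lambda> (generator i) = twisted_edges \<Gamma> i \<and>
        (\<forall>x\<in>topspace (twisted_edges \<Gamma> i).
           source ?\<Lambda> x = twisted_source \<Gamma> (n i) x \<and> rng ?\<Lambda> x = twisted_range \<Gamma> (m i) x)"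
      using space ends by blast
    show "\<forall>i\<in>indices k. \<forall>j\<in>indices k. i < j \<longrightarrow>
        (\<forall>(x, y)\<in>topspace (twisted_pairs \<Gamma> n m i j). \<forall>x' y'.
           T' i j (x, y) = (x', y') \<longrightarrow> cat_comp ?\<Lambda> x y = cat_comp ?\<Lambda> x' y')"
      using T' unfolding flip_def by blast
  qed
qed

end
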